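(* Let $\widetilde W=W_{\mathrm{aff}}\rtimes\Omega=\Lambda\rtimes W_\circ$ be a quasi-Coxeter group acting on $\mathcal A$. If $\mathfrak A$ and $\mathfrak B$ are NT-compatible marked alcoves in $\mathcal A$, then the pair $\{\mathfrak A,\mathfrak B\}$ has the Diamond Property. In particular, if $w\in\widetilde W$ and $w\notin\Lambda$, then $w$ has the Diamond Property.
   Context: Affine Weyl group. $\Sigma$ is a reduced irreducible root system with finite Weyl group $W_\circ$; $\mathcal A$ is the real vector space spanned by $\Sigma^\vee$. A hyperplane means the null-set in $\mathcal A$ of an affine functional $\alpha+k$, $\alpha\in\Sigma$, $k\in\mathbf Z$; $s_H$ is the reflection across $H$. $W_{\mathrm{aff}}$ is the group generated by all $s_H$. Alcoves are the connected components of the complement of all hyperplanes; a wall of an alcove is a hyperplane containing one of its codimension-1 faces; two distinct alcoves are adjacent if they share a codimension-1 face. A vertex $v$ is special if for each $\alpha\in\Sigma$ some hyperplane $\alpha+k=0$ passes through $v$. Fix a special vertex $v_\circ$, identify $W_\circ$ with the stabilizer of $v_\circ$ in $W_{\mathrm{aff}}$, fix a Weyl chamber $\mathcal C_\circ$ at $v_\circ$, and let $\mathfrak A_\circ\subset\mathcal C_\circ$ be the base alcove, i.e. the alcove in $\mathcal C_\circ$ with $v_\circ$ in its closure. $\Delta_{\mathrm{aff}}$ is the set of reflections in the walls of $\mathfrak A_\circ$, and $\ell$ the Coxeter length of $(W_{\mathrm{aff}},\Delta_{\mathrm{aff}})$. For alcoves, $d(\mathfrak A,\mathfrak B)$ is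 the number of hyperplanes separating them. Quasi-Coxeter group. $\Omega$ is a finitely generated abelian group with a homomorphism $\psi$ to the group of invertible affine transformations of $\mathcal A$ normalizing $W_{\mathrm{aff}}$; $\widetilde W=W_{\mathrm{aff}}\rtimes\Omega$ (with $\Omega$ acting on $W_{\mathrm{aff}}$ by conjugation via $\psi$) acts on $\mathcal A$ by $(w,\tau)(a)=w(\psi(\tau)(a))$; $\ell(w,\tau)=\ell(w)$. $\Lambda\subset\widetilde W$ is the subgroup of all elements acting on $\mathcal A$ by translations. Assumed: $\tau(\mathfrak A_\circ)=\mathfrak A_\circ$ for all $\tau\in\Omega$; $\widetilde W=\Lambda\rtimes W_\circ$; $\ell$ is constant on each $W_\circ$-conjugacy class in $\Lambda$; $\Lambda$ is finitely generated and abelian. Marked alcoves. A marked alcove is a triple $(\mathfrak A,v,\mathbf t)$ with $\mathfrak A$ an alcove, $v\in\overline{\mathfrak A}$ a special vertex, and $\mathbf t$ a bijection (labeling) from $\Delta_{\mathrm{aff}}$ to the set of walls of $\mathfrak A$; one writes $\mathfrak A$ for the triple, with $v_{\mathfrak A}=v$, $\mathbf t_{\mathfrak A}=\mathbf t$. Marked alcoves $(\mathfrak A,v,\mathbf t)$, $(\mathfrak B,v',\mathbf s)$ are NT-compatible if there is $w\in\widetilde W$ with $w\notin\Lambda$, $\mathfrak B=w(\mathfrak A)$, $v'=w(v)$, $\mathbf s=w\circ\mathbf t$. For $s\in\Delta_{\mathrm{aff}}$, $(\mathfrak A,v,\mathbf t)^s=(s_H(\mathfrak A),s_H(v),s_H\circ\mathbf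 t)$ with $H=\mathbf t(s)$. Diamond Property for pairs. An ordered pair $(\mathfrak A,\mathfrak B)$ of marked alcoves is laterally-conjugate to $(\mathfrak A',\mathfrak B')$ if there are $n\ge0$ and $s_1,\dots,s_n\in\Delta_{\mathrm{aff}}$ such that, with $\mathfrak A_0=\mathfrak A$, $\mathfrak B_0=\mathfrak B$, $\mathfrak A_i=\mathfrak A_{i-1}^{s_i}$, $\mathfrak B_i=\mathfrak B_{i-1}^{s_i}$, one has $\mathfrak A_n=\mathfrak A'$, $\mathfrak B_n=\mathfrak B'$ and $d(\mathfrak A_i,\mathfrak B_i)=d(\mathfrak A,\mathfrak B)$ for all $i$. A pair $\{\mathfrak A,\mathfrak B\}$ has the Direct Diamond Property if there is $s\in\Delta_{\mathrm{aff}}$ with $\mathbf t_{\mathfrak A}(s)\ne\mathbf t_{\mathfrak B}(s)$ such that both alcoves are on the same side of $\mathbf t_{\mathfrak A}(s)$ and both are on the same side of $\mathbf t_{\mathfrak B}(s)$. It has the Diamond Property if it is laterally-conjugate to a pair with the Direct Diamond Property. Diamond Property for elements. $w,w'\in\widetilde W$ are laterally-conjugate if there are $n\ge 0$ and $s_1,\dots,s_n\in\Delta_{\mathrm{aff}}$ with $w'=s_n\cdots s_1ws_1\cdots s_n$ and $\ell(s_i\cdots s_1ws_1\cdots s_i)=\ell(w)$ for all $i$. $w$ has the Direct Diamond Property if there is $s\in\Delta_{\mathrm{aff}}$ with $sws\ne w$, $\ell(sw)>\ell(w)$, $\ell(ws)>\ell(w)$; $w$ has the Diamond Property if it is laterally-conjugate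 to an element with the Direct Diamond Property. *)

theory Defs
  imports "HOL-Analysis.Analysis" "HOL-Algebra.Algebra"
begin

text \<open>
  The space \<open>\<A>\<close> is a Euclidean space \<open>'a\<close> whose inner product is invariant under the finite Weyl
  group. The inner product identifies \<open>\<A>\<close> with its dual, so a root \<open>\<alpha>\<close> is a vector acting as the
  functional \<open>\<lambda>x. \<alpha> \<bullet> x\<close>, its coroot is \<open>2\<alpha> / (\<alpha> \<bullet> \<alpha>)\<close>, and \<open>\<A>\<close> is spanned by the coroots because
  the roots span.
\<close>

definition coroot :: "'a::euclidean_space \<Rightarrow> 'a" where
  "coroot \<alpha> = (2 / (\<alpha> \<bullet> \<alpha>)) *\<^sub>R \<alpha>"

definition root_system :: "'a::euclidean_space set \<Rightarrow> bool" where
  "root_system \<Phi> \<longleftrightarrow>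
     finite \<Phi> \<and> 0 \<notin> \<Phi> \<and> span \<Phi> = UNIV \<and>
     (\<forall>\<alpha>\<in>\<Phi>. \<forall>\<beta>\<in>\<Phi>. \<beta> - (\<beta> \<bullet> coroot \<alpha>) *\<^sub>R \<alpha> \<in> \<Phi>) \<and>
     (\<forall>\<alpha>\<in>\<Phi>. \<forall>\<beta>\<in>\<Phi>. \<beta> \<bullet> coroot \<alpha> \<in> \<int>)"

definition reduced_root_system :: "'a::euclidean_space set \<Rightarrow> bool" where
  "reduced_root_system \<Phi> \<longleftrightarrow>
     root_system \<Phi> \<and> (\<forall>\<alpha>\<in>\<Phi>. \<forall>c. c *\<^sub>R \<alpha> \<in> \<Phi> \<longrightarrow> c = 1 \<or> c = - 1)"

definition irreducible_root_system :: "'a::euclidean_space set \<Rightarrow> bool" where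
  "irreducible_root_system \<Phi> \<longleftrightarrow>
     root_system \<Phi> \<and> \<Phi> \<noteq> {} \<and>
     \<not> (\<exists>\<Phi>1 \<Phi>2. \<Phi>1 \<noteq> {} \<and> \<Phi>2 \<noteq> {} \<and> \<Phi> = \<Phi>1 \<union> \<Phi>2 \<and> \<Phi>1 \<inter> \<Phi>2 = {} \<and>
            (\<forall>\<alpha>\<in>\<Phi>1. \<forall>\<beta>\<in>\<Phi>2. \<alpha> \<bullet> \<beta> = 0))"


section \<open>Hyperplanes, alcoves, walls\<close>

definition hyperplanes :: "'a::euclidean_space set \<Rightarrow> 'a set set" where
  "hyperplanes \<Phi> = {{x. \<alpha> \<bullet> x + of_int k = 0} | \<alpha> k. \<alpha> \<in> \<Phi>}"

definition hrefl :: "'a::euclidean_space set \<Rightarrow> 'a \<Rightarrow> 'a" where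
  "hrefl H x = 2 *\<^sub>R closest_point H x - x"

lemma hrefl_eq:
  fixes \<alpha> :: "'a::euclidean_space"
  assumes "\<alpha> \<noteq> 0"
  shows "hrefl {x. \<alpha> \<bullet> x + c = 0} x = x - (\<alpha> \<bullet> x + c) *\<^sub>R coroot \<alpha>"
proof -
  let ?H = "{x. \<alpha> \<bullet> x + c = 0}"
  let ?y = "x - ((\<alpha> \<bullet> x + c) / (\<alpha> \<bullet> \<alpha>)) *\<^sub>R \<alpha>"
  have H: "?H = {x. \<alpha> \<bullet> x = - c}" by auto
  have nz: "\<alpha> \<bullet> \<alpha> \<noteq> 0" using assms by simp
  have y: "?y \<in> ?H" using nz by (simp add: inner_diff_right)
  have "?y = closest_point ?H x"
  proof (rule closest_point_unique)
    show "convex ?H" "closed ?H" unfolding H by (simp_all add: convex_hyperplane closed_hyperplane)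
    show "\<forall>z\<in>?H. dist x ?y \<le> dist x z"
    proof
      fix z assume "z \<in> ?H"
      then have "\<alpha> \<bullet> x + c = \<alpha> \<bullet> (x - z)" by (simp add: inner_diff_right)
      then have "\<bar>\<alpha> \<bullet> x + c\<bar> \<le> norm \<alpha> * norm (x - z)" by (metis Cauchy_Schwarz_ineq2)
      then have "\<bar>\<alpha> \<bullet> x + c\<bar> / norm \<alpha> \<le> norm (x - z)"
        using assms by (simp add: field_simps)
      moreover have "dist x ?y = \<bar>\<alpha> \<bullet> x + c\<bar> / norm \<alpha>"
        using assms by (simp add: dist_norm dot_square_norm power2_eq_square)
      ultimately show "dist x ?y \<le> dist x z" by (simp add: dist_norm)
    qed
  qed (use y in simp)
  then show ?thesis
    unfolding hrefl_def coroot_def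
    by (metis (no_types, lifting) add_diff_cancel_right' diff_diff_eq2 diff_add_eq scaleR_2
        scaleR_right_diff_distrib scaleR_scaleR times_divide_eq_left times_divide_eq_right mult.commute)
qed

definition alcoves :: "'a::euclidean_space set \<Rightarrow> 'a set set" where
  "alcoves \<Phi> = components (- \<Union>(hyperplanes \<Phi>))"

definition walls :: "'a::euclidean_space set \<Rightarrow> 'a set \<Rightarrow> 'a set set" where
  "walls \<Phi> A = {H \<in> hyperplanes \<Phi>. \<exists>F. F facet_of closure A \<and> F \<subseteq> H}"

definition special_vertex :: "'a::euclidean_space set \<Rightarrow> 'a \<Rightarrow> bool" where
  "special_vertex \<Phi> v \<longleftrightarrow>
     (\<exists>A\<in>alcoves \<Phi>. v extreme_point_of closure A) \<and>
     (\<forall>\<alpha>\<in>\<Phi>. \<exists>k::int. \<alpha> \<bullet> v + of_int k = 0)"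

definition chambers_at :: "'a::euclidean_space set \<Rightarrow> 'a \<Rightarrow> 'a set set" where
  "chambers_at \<Phi> v = components (- \<Union>{H \<in> hyperplanes \<Phi>. v \<in> H})"

definition same_side :: "'a::euclidean_space set \<Rightarrow> 'a set \<Rightarrow> 'a set \<Rightarrow> bool" where
  "same_side H A B \<longleftrightarrow> (\<exists>S\<in>components (- H). A \<subseteq> S \<and> B \<subseteq> S)"

definition separates :: "'a::euclidean_space set \<Rightarrow> 'a set \<Rightarrow> 'a set \<Rightarrow> bool" where
  "separates H A B \<longleftrightarrow>
     (\<exists>S\<in>components (- H). \<exists>T\<in>components (- H). S \<noteq> T \<and> A \<subseteq> S \<and> B \<subseteq> T)"

definition alcove_dist :: "'a::euclidean_space set \<Rightarrow> 'a set \<Rightarrow> 'a set \<Rightarrow> nat" where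
  "alcove_dist \<Phi> A B = card {H \<in> hyperplanes \<Phi>. separates H A B}"


section \<open>The affine Weyl group\<close>

definition aff_group :: "('a::euclidean_space \<Rightarrow> 'a) monoid" where
  "aff_group = \<lparr>carrier = {f. bij f \<and> (\<exists>L b. linear L \<and> f = (\<lambda>x. L x + b))},
                mult = (\<circ>), one = id\<rparr>"

definition Waff :: "'a::euclidean_space set \<Rightarrow> ('a \<Rightarrow> 'a) set" where
  "Waff \<Phi> = generate aff_group (hrefl ` hyperplanes \<Phi>)"

text \<open>The Weyl group \<open>W\<^sub>\<circ>\<close>, as the stabilizer of the special vertex \<open>v\<close>.\<close>

definition Wfin :: "'a::euclidean_space set \<Rightarrow> 'a \<Rightarrow> ('a \<Rightarrow> 'a) set" where
  "Wfin \<Phi> v = {w \<in> Waff \<Phi>. w v = v}"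

definition Delta_aff :: "'a::euclidean_space set \<Rightarrow> 'a set \<Rightarrow> ('a \<Rightarrow> 'a) set" where
  "Delta_aff \<Phi> A0 = hrefl ` walls \<Phi> A0"

definition aff_length :: "'a::euclidean_space set \<Rightarrow> 'a set \<Rightarrow> ('a \<Rightarrow> 'a) \<Rightarrow> nat" where
  "aff_length \<Phi> A0 w =
     (LEAST n. \<exists>ss. length ss = n \<and> set ss \<subseteq> Delta_aff \<Phi> A0 \<and> w = foldr (\<circ>) ss id)"


section \<open>Quasi-Coxeter groups\<close>

definition aff_normalizer :: "'a::euclidean_space set \<Rightarrow> ('a \<Rightarrow> 'a) monoid" where
  "aff_normalizer \<Phi> = aff_group\<lparr>carrier :=
     {f \<in> carrier aff_group. {f \<circ> w \<circ> inv\<^bsub>aff_group\<^esub> f | w. w \<in> Waff \<Phi>} = Waff \<Phi>}\<rparr>"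

definition fin_gen :: "('g, 'm) monoid_scheme \<Rightarrow> bool" where
  "fin_gen G \<longleftrightarrow> (\<exists>S. finite S \<and> S \<subseteq> carrier G \<and> generate G S = carrier G)"

definition Wtilde ::
  "'a::euclidean_space set \<Rightarrow> ('o, 'm) monoid_scheme \<Rightarrow> ('o \<Rightarrow> 'a \<Rightarrow> 'a) \<Rightarrow> (('a \<Rightarrow> 'a) \<times> 'o) monoid" where
  "Wtilde \<Phi> \<Omega> \<psi> =
     \<lparr>carrier = Waff \<Phi> \<times> carrier \<Omega>,
      mult = (\<lambda>(w, \<tau>) (w', \<tau>'). (w \<circ> (\<psi> \<tau> \<circ> w' \<circ> inv\<^bsub>aff_group\<^esub> (\<psi> \<tau>)), \<tau> \<otimes>\<^bsub>\<Omega>\<^esub> \<tau>')),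
      one = (id, \<one>\<^bsub>\<Omega>\<^esub>)\<rparr>"

definition act :: "('o \<Rightarrow> 'a \<Rightarrow> 'a) \<Rightarrow> ('a \<Rightarrow> 'a) \<times> 'o \<Rightarrow> 'a \<Rightarrow> 'a" where
  "act \<psi> w x = fst w (\<psi> (snd w) x)"

definition len :: "'a::euclidean_space set \<Rightarrow> 'a set \<Rightarrow> ('a \<Rightarrow> 'a) \<times> 'o \<Rightarrow> nat" where
  "len \<Phi> A0 w = aff_length \<Phi> A0 (fst w)"

definition transl ::
  "'a::euclidean_space set \<Rightarrow> ('o, 'm) monoid_scheme \<Rightarrow> ('o \<Rightarrow> 'a \<Rightarrow> 'a) \<Rightarrow> (('a \<Rightarrow> 'a) \<times> 'o) set" where
  "transl \<Phi> \<Omega> \<psi> = {w \<in> carrier (Wtilde \<Phi> \<Omega> \<psi>). \<exists>c. \<forall>x. act \<psi> w x = x + c}"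

definition embed :: "('o, 'm) monoid_scheme \<Rightarrow> ('a \<Rightarrow> 'a) \<Rightarrow> ('a \<Rightarrow> 'a) \<times> 'o" where
  "embed \<Omega> w = (w, \<one>\<^bsub>\<Omega>\<^esub>)"

locale quasi_coxeter =
  fixes \<Phi> :: "'a::euclidean_space set"
    and v0 :: 'a and C0 A0 :: "'a set"
    and \<Omega> :: "('o, 'm) monoid_scheme"
    and \<psi> :: "'o \<Rightarrow> 'a \<Rightarrow> 'a"
  assumes reduced: "reduced_root_system \<Phi>"
    and irreducible: "irreducible_root_system \<Phi>"
    and special_v0: "special_vertex \<Phi> v0"
    and chamber: "C0 \<in> chambers_at \<Phi> v0"
    and base_alcove: "A0 \<in> alcoves \<Phi>" "A0 \<subseteq> C0" "v0 \<in> closure A0"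
    and Omega_comm: "comm_group \<Omega>"
    and Omega_fin_gen: "fin_gen \<Omega>"
    and psi_hom: "\<psi> \<in> hom \<Omega> (aff_normalizer \<Phi>)"
    and Omega_base: "\<tau> \<in> carrier \<Omega> \<Longrightarrow> \<psi> \<tau> ` A0 = A0"
    and transl_normal: "transl \<Phi> \<Omega> \<psi> \<lhd> Wtilde \<Phi> \<Omega> \<psi>"
    and transl_Wfin_inter: "transl \<Phi> \<Omega> \<psi> \<inter> embed \<Omega> ` Wfin \<Phi> v0 = {\<one>\<^bsub>Wtilde \<Phi> \<Omega> \<psi>\<^esub>}"
    and transl_Wfin_prod:
      "transl \<Phi> \<Omega> \<psi> <#>\<^bsub>Wtilde \<Phi> \<Omega> \<psi>\<^esub> (embed \<Omega> ` Wfin \<Phi> v0) = carrier (Wtilde \<Phi> \<Omega> \<psi>)"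
    and len_conj:
      "\<lbrakk>l \<in> transl \<Phi> \<Omega> \<psi>; u \<in> embed \<Omega> ` Wfin \<Phi> v0\<rbrakk> \<Longrightarrow>
       len \<Phi> A0 (u \<otimes>\<^bsub>Wtilde \<Phi> \<Omega> \<psi>\<^esub> l \<otimes>\<^bsub>Wtilde \<Phi> \<Omega> \<psi>\<^esub> inv\<^bsub>Wtilde \<Phi> \<Omega> \<psi>\<^esub> u) = len \<Phi> A0 l"
    and transl_comm: "comm_group ((Wtilde \<Phi> \<Omega> \<psi>)\<lparr>carrier := transl \<Phi> \<Omega> \<psi>\<rparr>)"
    and transl_fin_gen: "fin_gen ((Wtilde \<Phi> \<Omega> \<psi>)\<lparr>carrier := transl \<Phi> \<Omega> \<psi>\<rparr>)"


section \<open>Marked alcoves\<close>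

record 'a marked =
  alc :: "'a set"
  vtx :: 'a
  lab :: "('a \<Rightarrow> 'a) \<Rightarrow> 'a set"

text \<open>
  A labeling is a function on \<open>Delta_aff\<close> only; \<open>extensional\<close> and \<open>restrict\<close> pin down its values
  elsewhere, so that equality of records is equality of marked alcoves.
\<close>

definition marked_alcove :: "'a::euclidean_space set \<Rightarrow> 'a set \<Rightarrow> 'a marked \<Rightarrow> bool" where
  "marked_alcove \<Phi> A0 M \<longleftrightarrow>
     alc M \<in> alcoves \<Phi> \<and> vtx M \<in> closure (alc M) \<and> special_vertex \<Phi> (vtx M) \<and>
     lab M \<in> extensional (Delta_aff \<Phi> A0) \<and>
     bij_betw (lab M) (Delta_aff \<Phi> A0) (walls \<Phi> (alc M))"

definition transport ::
  "'a::euclidean_space set \<Rightarrow> 'a set \<Rightarrow> ('a \<Rightarrow> 'a) \<Rightarrow> 'a marked \<Rightarrow> 'a marked" where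
  "transport \<Phi> A0 f M =
     \<lparr>alc = f ` alc M, vtx = f (vtx M), lab = (\<lambda>r\<in>Delta_aff \<Phi> A0. f ` lab M r)\<rparr>"

definition NT_compatible ::
  "'a::euclidean_space set \<Rightarrow> 'a set \<Rightarrow> ('o, 'm) monoid_scheme \<Rightarrow> ('o \<Rightarrow> 'a \<Rightarrow> 'a) \<Rightarrow>
     'a marked \<Rightarrow> 'a marked \<Rightarrow> bool" where
  "NT_compatible \<Phi> A0 \<Omega> \<psi> M N \<longleftrightarrow>
     (\<exists>w\<in>carrier (Wtilde \<Phi> \<Omega> \<psi>). w \<notin> transl \<Phi> \<Omega> \<psi> \<and> N = transport \<Phi> A0 (act \<psi> w) M)"

definition move ::
  "'a::euclidean_space set \<Rightarrow> 'a set \<Rightarrow> 'a marked \<Rightarrow> ('a \<Rightarrow> 'a) \<Rightarrow> 'a marked" where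
  "move \<Phi> A0 M s = transport \<Phi> A0 (hrefl (lab M s)) M"


section \<open>The Diamond Property for pairs\<close>

definition lat_conj_pair ::
  "'a::euclidean_space set \<Rightarrow> 'a set \<Rightarrow> 'a marked \<times> 'a marked \<Rightarrow> 'a marked \<times> 'a marked \<Rightarrow> bool" where
  "lat_conj_pair \<Phi> A0 = (\<lambda>(M, N) (M', N').
     \<exists>(n::nat) s Ms Ns.
       (\<forall>i\<in>{1..n}. s i \<in> Delta_aff \<Phi> A0) \<and> Ms 0 = M \<and> Ns 0 = N \<and>
       (\<forall>i\<in>{1..n}. Ms i = move \<Phi> A0 (Ms (i - 1)) (s i) \<and> Ns i = move \<Phi> A0 (Ns (i - 1)) (s i)) \<and>
       Ms n = M' \<and> Ns n = N' \<and>
       (\<forall>i\<le>n. alcove_dist \<Phi> (alc (Ms i)) (alc (Ns i)) = alcove_dist \<Phi> (alc M) (alc N)))"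

definition direct_diamond_pair ::
  "'a::euclidean_space set \<Rightarrow> 'a set \<Rightarrow> 'a marked \<times> 'a marked \<Rightarrow> bool" where
  "direct_diamond_pair \<Phi> A0 = (\<lambda>(M, N).
     \<exists>s\<in>Delta_aff \<Phi> A0. lab M s \<noteq> lab N s \<and>
       same_side (lab M s) (alc M) (alc N) \<and> same_side (lab N s) (alc M) (alc N))"

definition diamond_pair ::
  "'a::euclidean_space set \<Rightarrow> 'a set \<Rightarrow> 'a marked \<times> 'a marked \<Rightarrow> bool" where
  "diamond_pair \<Phi> A0 P \<longleftrightarrow> (\<exists>Q. lat_conj_pair \<Phi> A0 P Q \<and> direct_diamond_pair \<Phi> A0 Q)"


section \<open>The Diamond Property for elements\<close>

definition lat_conj ::
  "'a::euclidean_space set \<Rightarrow> 'a set \<Rightarrow> ('o, 'm) monoid_scheme \<Rightarrow> ('o \<Rightarrow> 'a \<Rightarrow> 'a) \<Rightarrow>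
     ('a \<Rightarrow> 'a) \<times> 'o \<Rightarrow> ('a \<Rightarrow> 'a) \<times> 'o \<Rightarrow> bool" where
  "lat_conj \<Phi> A0 \<Omega> \<psi> w w' \<longleftrightarrow>
     (\<exists>(n::nat) s ws.
       (\<forall>i\<in>{1..n}. s i \<in> Delta_aff \<Phi> A0) \<and> ws 0 = w \<and>
       (\<forall>i\<in>{1..n}. ws i =
          embed \<Omega> (s i) \<otimes>\<^bsub>Wtilde \<Phi> \<Omega> \<psi>\<^esub> ws (i - 1) \<otimes>\<^bsub>Wtilde \<Phi> \<Omega> \<psi>\<^esub> embed \<Omega> (s i)) \<and>
       ws n = w' \<and> (\<forall>i\<le>n. len \<Phi> A0 (ws i) = len \<Phi> A0 w))"

definition direct_diamond ::
  "'a::euclidean_space set \<Rightarrow> 'a set \<Rightarrow> ('o, 'm) monoid_scheme \<Rightarrow> ('o \<Rightarrow> 'a \<Rightarrow> 'a) \<Rightarrow>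
     ('a \<Rightarrow> 'a) \<times> 'o \<Rightarrow> bool" where
  "direct_diamond \<Phi> A0 \<Omega> \<psi> w \<longleftrightarrow>
     (\<exists>s\<in>Delta_aff \<Phi> A0.
       embed \<Omega> s \<otimes>\<^bsub>Wtilde \<Phi> \<Omega> \<psi>\<^esub> w \<otimes>\<^bsub>Wtilde \<Phi> \<Omega> \<psi>\<^esub> embed \<Omega> s \<noteq> w \<and>
       len \<Phi> A0 (embed \<Omega> s \<otimes>\<^bsub>Wtilde \<Phi> \<Omega> \<psi>\<^esub> w) > len \<Phi> A0 w \<and>
       len \<Phi> A0 (w \<otimes>\<^bsub>Wtilde \<Phi> \<Omega> \<psi>\<^esub> embed \<Omega> s) > len \<Phi> A0 w)"

definition diamond ::
  "'a::euclidean_space set \<Rightarrow> 'a set \<Rightarrow> ('o, 'm) monoid_scheme \<Rightarrow> ('o \<Rightarrow> 'a \<Rightarrow> 'a) \<Rightarrow>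
     ('a \<Rightarrow> 'a) \<times> 'o \<Rightarrow> bool" where
  "diamond \<Phi> A0 \<Omega> \<psi> w \<longleftrightarrow>
     (\<exists>w'\<in>carrier (Wtilde \<Phi> \<Omega> \<psi>). lat_conj \<Phi> A0 \<Omega> \<psi> w w' \<and> direct_diamond \<Phi> A0 \<Omega> \<psi> w')"

end

(*
  For a non-translation w acting by the isometry phi, consider the alcoves A' reached from A by
  crossing walls without changing d(A', phi A'). If none of them had a wall H with H and phi H
  distinct and neither separating A' from phi A', then crossing a wall in a direction in which
  D(x) = |phi x - x|^2 increases would always keep the distance constant: if H and phi H both
  separated, the derivative of D across H would be nonpositive. As D attains a maximum on the
  closures of these alcoves, at p say, a generic line near p in the direction of grad D(p) crosses
  walls one at a time and only uphill, so it stays in these alcoves and reaches points with a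
  larger D, a contradiction. The gradient does not vanish at p because D is convex and, phi not
  being a translation, not constant.
*)

theory Submission
  imports Defs
begin

text \<open>Both claims reduce to one statement about a single alcove. In an NT-compatible pair the
  second alcove is the image of the first under \<phi>, and crossing equally labelled walls
  preserves this. For elements, writing the current alcove as g(A0) turns a crossing into
  conjugation by one base reflection; this needs the Coxeter length to be a number of separating
  hyperplanes, hence transitivity, exchange and freeness for \<open>Waff\<close>.
  \<open>psi_hom\<close> only provides affine maps normalizing \<open>Waff\<close>: that \<phi> is
  an isometry comes from the decomposition into translations and \<open>Wfin\<close>, and that it
  permutes the hyperplanes from the fact that every reflection in \<open>Waff\<close> has its
  hyperplane in the arrangement. The maximum point p may lie on many hyperplanes, so the line cannot
  start at p. It starts at a nearby point of the same alcove, with direction u and length T fixed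
  beforehand: D(p + T u) > D(p) and the uphill condition for the finitely many roots positive on u
  are open conditions and survive the shift.\<close>

section \<open>Affine hyperplanes and isometries\<close>

text \<open>The offset is an arbitrary real because the image of a hyperplane under an isometry is
  handled before it is known to belong to the arrangement.\<close>

definition ahyp :: "'a::euclidean_space \<Rightarrow> real \<Rightarrow> 'a set" where
  "ahyp \<alpha> c = {x. \<alpha> \<bullet> x + c = 0}"

lemma mem_ahyp [simp]: "x \<in> ahyp \<alpha> c \<longleftrightarrow> \<alpha> \<bullet> x + c = 0"
  by (simp add: ahyp_def)

lemma hrefl_ahyp: "\<alpha> \<noteq> 0 \<Longrightarrow> hrefl (ahyp \<alpha> c) x = x - (\<alpha> \<bullet> x + c) *\<^sub>R coroot \<alpha>"
  unfolding ahyp_def by (rule hrefl_eq)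

lemma coroot_inner: "\<alpha> \<noteq> 0 \<Longrightarrow> \<alpha> \<bullet> coroot \<alpha> = 2"
  by (simp add: coroot_def)

lemma halfspaces_nonempty:
  fixes \<alpha> :: "'a::euclidean_space"
  assumes "\<alpha> \<noteq> 0"
  shows "{x. \<alpha> \<bullet> x + c > 0} \<noteq> {}" "{x. \<alpha> \<bullet> x + c < 0} \<noteq> {}"
proof -
  have "((1 - c) / (\<alpha> \<bullet> \<alpha>)) *\<^sub>R \<alpha> \<in> {x. \<alpha> \<bullet> x + c > 0}" using assms by simp
  then show "{x. \<alpha> \<bullet> x + c > 0} \<noteq> {}" by blast
  have "((- 1 - c) / (\<alpha> \<bullet> \<alpha>)) *\<^sub>R \<alpha> \<in> {x. \<alpha> \<bullet> x + c < 0}" using assms by simp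
  then show "{x. \<alpha> \<bullet> x + c < 0} \<noteq> {}" by blast
qed

lemma open_halfspaces:
  fixes \<alpha> :: "'a::euclidean_space"
  shows "open {x. \<alpha> \<bullet> x + c > 0}" "open {x. \<alpha> \<bullet> x + c < 0}"
    "convex {x. \<alpha> \<bullet> x + c > 0}" "convex {x. \<alpha> \<bullet> x + c < 0}"
proof -
  have "{x. \<alpha> \<bullet> x + c > 0} = {x. \<alpha> \<bullet> x > - c}" "{x. \<alpha> \<bullet> x + c < 0} = {x. \<alpha> \<bullet> x < - c}" by auto
  then show "open {x. \<alpha> \<bullet> x + c > 0}" "open {x. \<alpha> \<bullet> x + c < 0}"
    "convex {x. \<alpha> \<bullet> x + c > 0}" "convex {x. \<alpha> \<bullet> x + c < 0}"
    by (simp_all add: open_halfspace_gt open_halfspace_lt convex_halfspace_gt convex_halfspace_lt)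
qed

text \<open>Translates the component language of \<open>same_side\<close> and
  \<open>separates\<close> into signs of one affine functional.\<close>

lemma components_compl_hyperplane:
  fixes \<alpha> :: "'a::euclidean_space"
  assumes "\<alpha> \<noteq> 0"
  shows "components (- ahyp \<alpha> c) = {{x. \<alpha> \<bullet> x + c > 0}, {x. \<alpha> \<bullet> x + c < 0}}"
proof (rule components_open_unique)
  show "disjoint {{x. \<alpha> \<bullet> x + c > 0}, {x. \<alpha> \<bullet> x + c < 0}}"
    by (auto simp: pairwise_def disjnt_def)
  show "\<Union> {{x. \<alpha> \<bullet> x + c > 0}, {x. \<alpha> \<bullet> x + c < 0}} = - ahyp \<alpha> c"
    by (auto simp: ahyp_def)
  have 1: "open {x. \<alpha> \<bullet> x + c > 0} \<and> connected {x. \<alpha> \<bullet> x + c > 0} \<and> {x. \<alpha> \<bullet> x + c > 0} \<noteq> {}"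
    using halfspaces_nonempty(1)[OF assms] open_halfspaces(1,3) convex_connected by blast
  have 2: "open {x. \<alpha> \<bullet> x + c < 0} \<and> connected {x. \<alpha> \<bullet> x + c < 0} \<and> {x. \<alpha> \<bullet> x + c < 0} \<noteq> {}"
    using halfspaces_nonempty(2)[OF assms] open_halfspaces(2,4) convex_connected by blast
  show "open S \<and> connected S \<and> S \<noteq> {}" if "S \<in> {{x. \<alpha> \<bullet> x + c > 0}, {x. \<alpha> \<bullet> x + c < 0}}" for S
    using that 1 2 by (elim insertE) (simp_all only: empty_iff simp_thms)
qed

lemma separates_halfspaces:
  fixes \<alpha> :: "'a::euclidean_space"
  assumes "\<alpha> \<noteq> 0"
  shows "separates (ahyp \<alpha> c) A B \<longleftrightarrow>
    (A \<subseteq> {x. \<alpha> \<bullet> x + c > 0} \<and> B \<subseteq> {x. \<alpha> \<bullet> x + c < 0}) \<or>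
    (A \<subseteq> {x. \<alpha> \<bullet> x + c < 0} \<and> B \<subseteq> {x. \<alpha> \<bullet> x + c > 0})"
proof -
  have "{x. \<alpha> \<bullet> x + c > 0} \<noteq> {x. \<alpha> \<bullet> x + c < 0}"
    using halfspaces_nonempty(1)[OF assms, of c] by (fastforce simp: set_eq_iff)
  then show ?thesis
    unfolding separates_def components_compl_hyperplane[OF assms] by auto
qed

lemma same_side_halfspaces:
  fixes \<alpha> :: "'a::euclidean_space"
  assumes "\<alpha> \<noteq> 0"
  shows "same_side (ahyp \<alpha> c) A B \<longleftrightarrow>
    A \<union> B \<subseteq> {x. \<alpha> \<bullet> x + c > 0} \<or> A \<union> B \<subseteq> {x. \<alpha> \<bullet> x + c < 0}"
  unfolding same_side_def components_compl_hyperplane[OF assms] by auto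

text \<open>The source of all genericity below: hyperplanes are null sets, and countably many null
  sets do not fill a nonempty open set. A pair (0, c) with c nonzero is harmless since it describes
  the empty set; only (0, 0) would describe the whole space.\<close>

lemma negligible_countable_hyperplanes:
  fixes F :: "('a::euclidean_space \<times> real) set"
  assumes "countable F" "\<And>\<alpha> c. (\<alpha>, c) \<in> F \<Longrightarrow> \<alpha> \<noteq> 0 \<or> c \<noteq> 0" "open U" "U \<noteq> {}"
  shows "\<exists>x\<in>U. \<forall>(\<alpha>, c)\<in>F. \<alpha> \<bullet> x \<noteq> c"
proof (rule ccontr)
  assume "\<not> ?thesis"
  then have sub: "U \<subseteq> \<Union> ((\<lambda>(\<alpha>, c). {x. \<alpha> \<bullet> x = c}) ` F)" by fastforce
  have "negligible (\<Union> ((\<lambda>(\<alpha>, c). {x. \<alpha> \<bullet> x = c}) ` F))"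
    using assms(1,2) by (intro negligible_countable_Union) (auto intro!: negligible_hyperplane)
  then show False
    using sub open_not_negligible[OF assms(3,4)] negligible_subset by blast
qed

section \<open>Affine isometries and their effect on hyperplanes\<close>

definition isom :: "('a::euclidean_space \<Rightarrow> 'a) \<Rightarrow> bool" where
  "isom f \<longleftrightarrow> (\<exists>L b. orthogonal_transformation L \<and> f = (\<lambda>x. L x + b))"

lemma isom_id: "isom id"
  unfolding isom_def by (rule exI[of _ "\<lambda>x. x"], rule exI[of _ 0]) auto

lemma isom_comp: "isom f \<Longrightarrow> isom g \<Longrightarrow> isom (f \<circ> g)"
proof -
  assume "isom f" "isom g"
  then obtain L b M c where *: "orthogonal_transformation L" "f = (\<lambda>x. L x + b)"
    "orthogonal_transformation M" "g = (\<lambda>x. M x + c)" unfolding isom_def by auto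
  then have "f \<circ> g = (\<lambda>x. (L \<circ> M) x + (L c + b))"
    by (auto simp: orthogonal_transformation_def linear_add fun_eq_iff)
  then show ?thesis using *(1,3) orthogonal_transformation_compose unfolding isom_def by blast
qed

lemma isom_bij: "isom f \<Longrightarrow> bij f"
proof -
  assume "isom f"
  then obtain L b where *: "orthogonal_transformation L" "f = (\<lambda>x. L x + b)"
    unfolding isom_def by auto
  then have "f = (\<lambda>x. x + b) \<circ> L" by auto
  moreover have "bij (\<lambda>x::'a. x + b)" by (rule bij_plus_right)
  ultimately show ?thesis using *(1) orthogonal_transformation_bij bij_comp by metis
qed

lemma isom_inv: "isom f \<Longrightarrow> isom (inv_into UNIV f)"
proof -
  assume "isom f"
  then obtain L b where *: "orthogonal_transformation L" "f = (\<lambda>x. L x + b)"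
    unfolding isom_def by auto
  have o: "orthogonal_transformation (inv_into UNIV L)" by (simp add: * orthogonal_transformation_inv)
  have "inv_into UNIV f = (\<lambda>x. inv_into UNIV L x + inv_into UNIV L (- b))"
  proof (rule inv_equality)
    fix x
    have lin: "linear L" "linear (inv_into UNIV L)" using o *(1) orthogonal_transformation_linear by blast+
    have li: "inv_into UNIV L (L y) = y" "L (inv_into UNIV L y) = y" for y
      using orthogonal_transformation_inj[OF *(1)] orthogonal_transformation_surj[OF *(1)]
      by (auto simp: surj_f_inv_f)
    show "inv_into UNIV L (f x) + inv_into UNIV L (- b) = x"
      unfolding *(2) by (simp add: linear_add[OF lin(2)] linear_neg[OF lin(2)] li)
    show "f (inv_into UNIV L x + inv_into UNIV L (- b)) = x"
      unfolding *(2) by (simp add: linear_add[OF lin(1)] li)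
  qed
  then show ?thesis using o unfolding isom_def by blast
qed

lemma isom_norm: "isom f \<Longrightarrow> norm (f x - f y) = norm (x - y)"
  unfolding isom_def by (auto simp: orthogonal_transformation_norm orthogonal_transformation_linear
      simp flip: linear_diff)

lemma isom_continuous: "isom f \<Longrightarrow> continuous_on S f"
  unfolding isom_def orthogonal_transformation_def linear_conv_bounded_linear
  by (elim exE conjE) (simp add: continuous_on_add linear_continuous_on)

lemma isom_closure: "isom f \<Longrightarrow> f ` closure S = closure (f ` S)"
proof -
  assume "isom f"
  show ?thesis
  proof
    show "f ` closure S \<subseteq> closure (f ` S)"
      using \<open>isom f\<close> by (intro image_closure_subset) (auto simp: isom_continuous closure_subset)
    have "inv_into UNIV f ` closure (f ` S) \<subseteq> closure (inv_into UNIV f ` f ` S)"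
      using \<open>isom f\<close> by (intro image_closure_subset) (auto simp: isom_continuous isom_inv closure_subset)
    also have "\<dots> = closure S" using \<open>isom f\<close> by (simp add: isom_bij bij_is_inj image_inv_f_f)
    finally show "closure (f ` S) \<subseteq> f ` closure S"
      using \<open>isom f\<close> by (metis bij_is_surj image_f_inv_f image_mono isom_bij)
  qed
qed

text \<open>The new offset is chosen so that the transported functional takes at f x the value of
  the old one at x; signs and sides are then carried along unchanged.\<close>

lemma isom_ahyp:
  fixes f L :: "'a::euclidean_space \<Rightarrow> 'a"
  assumes "orthogonal_transformation L" "f = (\<lambda>x. L x + b)"
  shows "f ` ahyp \<alpha> c = ahyp (L \<alpha>) (c - L \<alpha> \<bullet> b)"
    and "L \<alpha> \<bullet> f x + (c - L \<alpha> \<bullet> b) = \<alpha> \<bullet> x + c"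
    and "\<alpha> \<noteq> 0 \<Longrightarrow> L \<alpha> \<noteq> 0"
    and "coroot (L \<alpha>) = L (coroot \<alpha>)"
proof -
  show 2: "L \<alpha> \<bullet> f x + (c - L \<alpha> \<bullet> b) = \<alpha> \<bullet> x + c" for x
    using assms by (simp add: inner_add_right orthogonal_transformation_def)
  have "isom f" unfolding isom_def by (intro exI conjI) (rule assms)+
  then have "surj f" by (simp add: isom_bij bij_is_surj)
  then show "f ` ahyp \<alpha> c = ahyp (L \<alpha>) (c - L \<alpha> \<bullet> b)"
  proof (intro equalityI subsetI)
    fix y assume "y \<in> ahyp (L \<alpha>) (c - L \<alpha> \<bullet> b)"
    moreover obtain x where "y = f x" using \<open>surj f\<close> by blast
    ultimately show "y \<in> f ` ahyp \<alpha> c" using 2[of x] by auto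
  next
    fix y assume "y \<in> f ` ahyp \<alpha> c"
    then obtain x where "y = f x" "\<alpha> \<bullet> x + c = 0" by auto
    then show "y \<in> ahyp (L \<alpha>) (c - L \<alpha> \<bullet> b)" using 2[of x] by auto
  qed
  show "\<alpha> \<noteq> 0 \<Longrightarrow> L \<alpha> \<noteq> 0"
    using assms(1) orthogonal_transformation_norm by (metis norm_eq_zero)
  show "coroot (L \<alpha>) = L (coroot \<alpha>)"
    using assms(1) unfolding coroot_def orthogonal_transformation_def
    by (simp add: linear_cmul)
qed

lemma isom_hrefl:
  assumes "isom f" "\<alpha> \<noteq> 0"
  shows "hrefl (f ` ahyp \<alpha> c) (f x) = f (hrefl (ahyp \<alpha> c) x)"
proof -
  obtain L b where *: "orthogonal_transformation L" "f = (\<lambda>x. L x + b)"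
    using assms(1) unfolding isom_def by auto
  note i = isom_ahyp[OF *]
  have "hrefl (f ` ahyp \<alpha> c) (f x) = f x - (\<alpha> \<bullet> x + c) *\<^sub>R L (coroot \<alpha>)"
    unfolding i(1) hrefl_ahyp[OF i(3)[OF assms(2)]] i(2) i(4) ..
  also have "\<dots> = f (hrefl (ahyp \<alpha> c) x)"
    using assms(2) *(1) by (simp add: hrefl_ahyp *(2) orthogonal_transformation_linear linear_diff linear_cmul)
  finally show ?thesis .
qed

lemma separates_isom:
  assumes "isom f" "\<alpha> \<noteq> 0"
  shows "separates (f ` ahyp \<alpha> c) (f ` A) (f ` B) \<longleftrightarrow> separates (ahyp \<alpha> c) A B"
proof -
  obtain L b where *: "orthogonal_transformation L" "f = (\<lambda>x. L x + b)"
    using assms(1) unfolding isom_def by auto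
  have i: "f ` ahyp \<alpha> c = ahyp (L \<alpha>) (c - L \<alpha> \<bullet> b)"
    "L \<alpha> \<bullet> f x + (c - L \<alpha> \<bullet> b) = \<alpha> \<bullet> x + c" "L \<alpha> \<noteq> 0" for x
    using isom_ahyp[OF *] assms(2) by blast+
  have 1: "f ` S \<subseteq> {x. L \<alpha> \<bullet> x + (c - L \<alpha> \<bullet> b) > 0} \<longleftrightarrow> S \<subseteq> {x. \<alpha> \<bullet> x + c > 0}" for S
    unfolding image_subset_iff mem_Collect_eq i(2) by auto
  have 2: "f ` S \<subseteq> {x. L \<alpha> \<bullet> x + (c - L \<alpha> \<bullet> b) < 0} \<longleftrightarrow> S \<subseteq> {x. \<alpha> \<bullet> x + c < 0}" for S
    unfolding image_subset_iff mem_Collect_eq i(2) by auto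
  show ?thesis
    by (simp only: i(1) separates_halfspaces[OF i(3)] separates_halfspaces[OF assms(2)] 1 2)
qed

lemma hrefl_hyperplane:
  fixes \<alpha> :: "'a::euclidean_space"
  assumes "\<alpha> \<noteq> 0"
  shows "\<alpha> \<bullet> hrefl (ahyp \<alpha> c) x + c = - (\<alpha> \<bullet> x + c)"
    and "x \<in> ahyp \<alpha> c \<Longrightarrow> hrefl (ahyp \<alpha> c) x = x"
    and "hrefl (ahyp \<alpha> c) (hrefl (ahyp \<alpha> c) x) = x"
    and "isom (hrefl (ahyp \<alpha> c))"
    and "hrefl (ahyp \<alpha> c) \<noteq> id"
proof -
  let ?s = "hrefl (ahyp \<alpha> c)"
  show 1: "\<alpha> \<bullet> ?s x + c = - (\<alpha> \<bullet> x + c)" for x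
    by (simp add: hrefl_ahyp[OF assms] inner_diff_right coroot_inner[OF assms])
  show "x \<in> ahyp \<alpha> c \<Longrightarrow> ?s x = x" for x by (simp add: hrefl_ahyp[OF assms])
  show 3: "?s (?s x) = x" for x
    by (simp only: hrefl_ahyp[OF assms, of _ "?s x"] 1) (simp add: hrefl_ahyp[OF assms] scaleR_left_diff_distrib scaleR_left_distrib)
  obtain y where "\<alpha> \<bullet> y + c > 0" using halfspaces_nonempty(1)[OF assms, of c] by blast
  then show "?s \<noteq> id" using 1[of y] by auto
  define L where "L x = x - (\<alpha> \<bullet> x) *\<^sub>R coroot \<alpha>" for x
  have "L v \<bullet> L w = v \<bullet> w" for v w
    using assms by (simp add: L_def coroot_def inner_diff_left inner_diff_right inner_commute)
  moreover have "linear L"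
    by (auto simp: L_def algebra_simps intro!: linearI)
  ultimately have "orthogonal_transformation L" unfolding orthogonal_transformation_def by blast
  moreover have "?s = (\<lambda>x. L x + (- c) *\<^sub>R coroot \<alpha>)"
    by (auto simp: hrefl_ahyp[OF assms] L_def fun_eq_iff algebra_simps)
  ultimately show "isom ?s" unfolding isom_def by blast
qed

section \<open>Alcoves as intersections of slabs\<close>

locale root_sys =
  fixes \<Phi> :: "'a::euclidean_space set"
  assumes root_system: "root_system \<Phi>"
begin

abbreviation "hyps \<equiv> hyperplanes \<Phi>"
abbreviation "alcs \<equiv> alcoves \<Phi>"

definition reg :: "'a set" where
  "reg = - \<Union> hyps"

text \<open>Avoiding all hyperplanes along a path means keeping the integer part of every root
  value, so the alcove of a regular \<open>x\<close> is this finite intersection of open slabs. If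
  \<open>x\<close> lies on a hyperplane, the set does not contain \<open>x\<close>.\<close>

definition cell :: "'a \<Rightarrow> 'a set" where
  "cell x = (\<Inter>\<alpha>\<in>\<Phi>. {y. \<alpha> \<bullet> y > of_int \<lfloor>\<alpha> \<bullet> x\<rfloor>} \<inter> {y. \<alpha> \<bullet> y < of_int \<lfloor>\<alpha> \<bullet> x\<rfloor> + 1})"

lemma finite_roots: "finite \<Phi>" and root_nonzero: "\<alpha> \<in> \<Phi> \<Longrightarrow> \<alpha> \<noteq> 0"
  and span_roots: "span \<Phi> = UNIV"
  and root_reflection: "\<alpha> \<in> \<Phi> \<Longrightarrow> \<beta> \<in> \<Phi> \<Longrightarrow> \<beta> - (\<beta> \<bullet> coroot \<alpha>) *\<^sub>R \<alpha> \<in> \<Phi>"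
  and root_integral: "\<alpha> \<in> \<Phi> \<Longrightarrow> \<beta> \<in> \<Phi> \<Longrightarrow> \<beta> \<bullet> coroot \<alpha> \<in> \<int>"
  using root_system unfolding root_system_def by blast+

lemma uminus_root: "\<alpha> \<in> \<Phi> \<Longrightarrow> - \<alpha> \<in> \<Phi>"
  using root_reflection[of \<alpha> \<alpha>] coroot_inner[of \<alpha>] root_nonzero[of \<alpha>]
  by (simp add: scaleR_2)

lemma hyps_eq: "hyps = {ahyp \<alpha> (of_int k) | \<alpha> k. \<alpha> \<in> \<Phi>}"
  unfolding hyperplanes_def ahyp_def ..

lemma hypsE:
  assumes "H \<in> hyps"
  obtains \<alpha> k where "\<alpha> \<in> \<Phi>" "\<alpha> \<noteq> 0" "H = ahyp \<alpha> (of_int k)"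
  using assms root_nonzero unfolding hyps_eq by blast

lemma hypsI: "\<alpha> \<in> \<Phi> \<Longrightarrow> ahyp \<alpha> (of_int k) \<in> hyps"
  unfolding hyps_eq by blast

lemma reg_iff: "x \<in> reg \<longleftrightarrow> (\<forall>\<alpha>\<in>\<Phi>. \<alpha> \<bullet> x \<notin> \<int>)"
proof -
  have "x \<in> \<Union> hyps \<longleftrightarrow> (\<exists>\<alpha>\<in>\<Phi>. \<exists>k::int. \<alpha> \<bullet> x + of_int k = 0)"
    by (metis UnionE UnionI hypsE hypsI mem_ahyp)
  also have "\<dots> \<longleftrightarrow> (\<exists>\<alpha>\<in>\<Phi>. \<alpha> \<bullet> x \<in> \<int>)"
  proof -
    have "(\<exists>k::int. r + of_int k = 0) \<longleftrightarrow> r \<in> \<int>" for r :: real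
    proof
      assume "\<exists>k::int. r + of_int k = 0"
      then obtain k :: int where "r = of_int (- k)" by (auto simp: add_eq_0_iff2)
      then show "r \<in> \<int>" by (metis Ints_of_int)
    next
      assume "r \<in> \<int>"
      then obtain k :: int where "r = of_int k" by (auto elim: Ints_cases)
      then show "\<exists>k::int. r + of_int k = 0" by (intro exI[of _ "- k"]) simp
    qed
    then show ?thesis by simp
  qed
  finally show ?thesis unfolding reg_def by auto
qed

lemma mem_cell: "y \<in> cell x \<longleftrightarrow> (\<forall>\<alpha>\<in>\<Phi>. of_int \<lfloor>\<alpha> \<bullet> x\<rfloor> < \<alpha> \<bullet> y \<and> \<alpha> \<bullet> y < of_int \<lfloor>\<alpha> \<bullet> x\<rfloor> + 1)"
  by (auto simp: cell_def)

lemma open_cell: "open (cell x)"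
  unfolding cell_def
  by (intro open_INT open_Int ballI finite_roots open_halfspace_gt open_halfspace_lt)

lemma convex_cell: "convex (cell x)"
  unfolding cell_def
  by (intro convex_INT convex_Int convex_halfspace_gt convex_halfspace_lt)

lemma floor_cell: "y \<in> cell x \<Longrightarrow> \<alpha> \<in> \<Phi> \<Longrightarrow> \<lfloor>\<alpha> \<bullet> y\<rfloor> = \<lfloor>\<alpha> \<bullet> x\<rfloor>"
  unfolding mem_cell by (simp add: floor_eq_iff less_imp_le)

lemma cell_subset_reg: "cell x \<subseteq> reg"
proof
  fix y assume y: "y \<in> cell x"
  have "\<alpha> \<bullet> y \<notin> \<int>" if "\<alpha> \<in> \<Phi>" for \<alpha>
    using y floor_cell[OF y that] that by (auto simp: mem_cell elim!: Ints_cases)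
  then show "y \<in> reg" by (simp add: reg_iff)
qed

lemma cell_self: "x \<in> reg \<Longrightarrow> x \<in> cell x"
proof -
  assume "x \<in> reg"
  then have "of_int \<lfloor>\<alpha> \<bullet> x\<rfloor> \<noteq> \<alpha> \<bullet> x" if "\<alpha> \<in> \<Phi>" for \<alpha>
    using that unfolding reg_iff by (metis Ints_of_int)
  then show ?thesis
    unfolding mem_cell by (auto simp: real_of_int_floor_add_one_gt intro!: le_neq_trans)
qed

lemma cell_eq: "y \<in> cell x \<Longrightarrow> cell y = cell x"
proof -
  assume "y \<in> cell x"
  then have "\<lfloor>\<alpha> \<bullet> y\<rfloor> = \<lfloor>\<alpha> \<bullet> x\<rfloor>" if "\<alpha> \<in> \<Phi>" for \<alpha> using that by (rule floor_cell)
  then show ?thesis unfolding set_eq_iff mem_cell by simp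
qed

text \<open>The cells partition \<open>reg\<close> into nonempty open connected pieces, and such a
  partition can only be the one into components.\<close>

lemma alcoves_eq: "alcs = cell ` reg"
proof -
  have "components reg = cell ` reg"
  proof (rule components_open_unique)
    show "disjoint (cell ` reg)"
      unfolding pairwise_def disjnt_def using cell_eq by (metis disjoint_iff imageE)
    show "\<Union> (cell ` reg) = reg" using cell_self cell_subset_reg by blast
    show "open S \<and> connected S \<and> S \<noteq> {}" if "S \<in> cell ` reg" for S
      using that open_cell convex_connected[OF convex_cell] cell_self by auto
  qed
  then show ?thesis unfolding alcoves_def reg_def .
qed

lemma cell_alcove: "x \<in> reg \<Longrightarrow> cell x \<in> alcs"
  unfolding alcoves_eq by blast

lemma alcove_eq_cell: "A \<in> alcs \<Longrightarrow> x \<in> A \<Longrightarrow> A = cell x"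
  unfolding alcoves_eq by (elim imageE) (simp add: cell_eq)

lemma alcove_facts:
  assumes "A \<in> alcs"
  shows "A \<noteq> {}" "open A" "convex A" "A \<subseteq> reg"
proof -
  obtain x where "x \<in> reg" "A = cell x" using assms unfolding alcoves_eq by blast
  then show "A \<noteq> {}" "open A" "convex A" "A \<subseteq> reg"
    using open_cell convex_cell cell_self[of x] cell_subset_reg by auto
qed

lemma alcove_disjoint: "A \<in> alcs \<Longrightarrow> B \<in> alcs \<Longrightarrow> x \<in> A \<Longrightarrow> x \<in> B \<Longrightarrow> A = B"
  using alcove_eq_cell[of A x] alcove_eq_cell[of B x] by simp

text \<open>Every root takes values in a unit interval on the alcove, and the roots span, so every
  linear functional is bounded there.\<close>

lemma alcove_bounded:
  assumes "A \<in> alcs"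
  shows "bounded A"
proof -
  obtain x where x: "A = cell x" using assms unfolding alcoves_eq by blast
  have b: "bounded ((\<lambda>y. v \<bullet> y) ` A)" for v
  proof -
    have "v \<in> span \<Phi>" using span_roots by simp
    then show ?thesis
    proof (induction rule: span_induct_alt)
      case base
      have "(\<lambda>y. 0 \<bullet> y) ` A \<subseteq> {0}" by auto
      then show ?case using bounded_subset[of "{0::real}"] by simp
    next
      case (step c \<alpha> v)
      have "(\<lambda>y. \<alpha> \<bullet> y) ` A \<subseteq> {of_int \<lfloor>\<alpha> \<bullet> x\<rfloor> .. of_int \<lfloor>\<alpha> \<bullet> x\<rfloor> + 1}"
        using step(1) unfolding x mem_cell image_subset_iff by (auto simp: mem_cell less_imp_le)
      then have "bounded ((\<lambda>y. \<alpha> \<bullet> y) ` A)" using bounded_closed_interval bounded_subset by blast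
      then have "bounded ((\<lambda>t. c *\<^sub>R t) ` (\<lambda>y. \<alpha> \<bullet> y) ` A)" by (rule bounded_scaling)
      then have "bounded ((\<lambda>y. c * (\<alpha> \<bullet> y)) ` A)" by (simp add: image_image)
      then show ?case using bounded_plus_comp[OF _ step(2)] by (simp add: inner_add_left)
    qed
  qed
  then have "\<forall>i\<in>Basis. \<exists>C. \<forall>y\<in>A. \<bar>i \<bullet> y\<bar> \<le> C"
    unfolding bounded_iff by simp
  then obtain C where C: "\<And>i y. i \<in> Basis \<Longrightarrow> y \<in> A \<Longrightarrow> \<bar>i \<bullet> y\<bar> \<le> C i" by metis
  have "norm y \<le> (\<Sum>i\<in>Basis. C i)" if "y \<in> A" for y
  proof -
    have "norm y \<le> (\<Sum>i\<in>Basis. \<bar>y \<bullet> i\<bar>)" by (rule norm_le_l1)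
    also have "\<dots> \<le> (\<Sum>i\<in>Basis. C i)" using C that by (intro sum_mono) (simp add: inner_commute)
    finally show ?thesis .
  qed
  then show ?thesis unfolding bounded_iff by blast
qed

text \<open>By Cauchy-Schwarz each of the finitely many roots is bounded on S, which leaves finitely
  many integer offsets.\<close>

lemma finite_hyps_meeting:
  assumes "bounded S"
  shows "finite {H \<in> hyps. H \<inter> S \<noteq> {}}"
proof -
  obtain R where R: "\<And>x. x \<in> S \<Longrightarrow> norm x \<le> R" using assms unfolding bounded_iff by blast
  define N where "N = (\<lambda>\<alpha>::'a. \<lceil>norm \<alpha> * \<bar>R\<bar>\<rceil>)"
  have "{H \<in> hyps. H \<inter> S \<noteq> {}} \<subseteq> (\<lambda>(\<alpha>, k). ahyp \<alpha> (of_int k)) ` (SIGMA \<alpha>:\<Phi>. {- N \<alpha>..N \<alpha>})"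
  proof
    fix H assume H: "H \<in> {H \<in> hyps. H \<inter> S \<noteq> {}}"
    then obtain \<alpha> k where a: "\<alpha> \<in> \<Phi>" "H = ahyp \<alpha> (of_int k)" using hypsE by blast
    obtain x where x: "x \<in> S" "\<alpha> \<bullet> x + of_int k = 0" using H a by auto
    have "\<bar>of_int k\<bar> = \<bar>\<alpha> \<bullet> x\<bar>" using x(2) by linarith
    also have "\<dots> \<le> norm \<alpha> * norm x" by (rule Cauchy_Schwarz_ineq2)
    also have "\<dots> \<le> norm \<alpha> * \<bar>R\<bar>" using R[OF x(1)] by (intro mult_left_mono) auto
    finally have "\<bar>of_int k\<bar> \<le> norm \<alpha> * \<bar>R\<bar>" .
    then have "\<bar>k\<bar> \<le> N \<alpha>" unfolding N_def by linarith
    then show "H \<in> (\<lambda>(\<alpha>, k). ahyp \<alpha> (of_int k)) ` (SIGMA \<alpha>:\<Phi>. {- N \<alpha>..N \<alpha>})"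
      using a by (force simp: abs_le_iff)
  qed
  then show ?thesis using finite_roots finite_subset by blast
qed

lemma closed_hyp: "H \<in> hyps \<Longrightarrow> closed H"
proof -
  assume "H \<in> hyps"
  then obtain \<alpha> k where "H = ahyp \<alpha> (of_int k)" using hypsE by blast
  then have "H = {x. \<alpha> \<bullet> x = - of_int k}" by (auto simp: ahyp_def)
  then show ?thesis by (simp add: closed_hyperplane)
qed

lemma locally_finite_hyps:
  obtains e where "e > 0" "\<forall>H\<in>hyps. H \<inter> ball p e \<noteq> {} \<longrightarrow> p \<in> H"
proof -
  let ?F = "{H \<in> hyps. H \<inter> ball p 1 \<noteq> {} \<and> p \<notin> H}"
  have "?F \<subseteq> {H \<in> hyps. H \<inter> ball p 1 \<noteq> {}}" by blast
  then have "finite ?F" using finite_hyps_meeting[OF bounded_ball] finite_subset by blast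
  then have "closed (\<Union> ?F)" using closed_hyp by (intro closed_Union) auto
  then have "open (ball p 1 - \<Union> ?F)" by (intro open_Diff) auto
  moreover have "p \<in> ball p 1 - \<Union> ?F" by auto
  ultimately obtain e where e: "e > 0" "ball p e \<subseteq> ball p 1 - \<Union> ?F"
    by (rule openE)
  then show ?thesis using that[of e] by blast
qed

section \<open>Separation\<close>

lemma alcove_sign:
  assumes "A \<in> alcs" "\<alpha> \<in> \<Phi>"
  shows "A \<subseteq> {x. \<alpha> \<bullet> x + of_int k > 0} \<or> A \<subseteq> {x. \<alpha> \<bullet> x + of_int k < 0}"
proof -
  obtain x where x: "A = cell x" using assms unfolding alcoves_eq by blast
  show ?thesis
  proof (cases "- k \<le> \<lfloor>\<alpha> \<bullet> x\<rfloor>")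
    case True
    then have "- real_of_int k \<le> of_int \<lfloor>\<alpha> \<bullet> x\<rfloor>" by linarith
    then show ?thesis using assms(2) unfolding x by (force simp: mem_cell)
  next
    case False
    then have "- real_of_int k \<ge> of_int \<lfloor>\<alpha> \<bullet> x\<rfloor> + 1" by linarith
    then show ?thesis using assms(2) unfolding x by (force simp: mem_cell)
  qed
qed

text \<open>An alcove lies strictly on one side of each hyperplane, so one sample point per alcove
  decides separation.\<close>

lemma separates_alcoves:
  assumes "A \<in> alcs" "B \<in> alcs" "\<alpha> \<in> \<Phi>" "x \<in> A" "y \<in> B"
  shows "separates (ahyp \<alpha> (of_int k)) A B \<longleftrightarrow> (\<alpha> \<bullet> x + of_int k > 0) \<noteq> (\<alpha> \<bullet> y + of_int k > 0)"
    and "same_side (ahyp \<alpha> (of_int k)) A B \<longleftrightarrow> (\<alpha> \<bullet> x + of_int k > 0) = (\<alpha> \<bullet> y + of_int k > 0)"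
  using alcove_sign[OF assms(1,3), of k] alcove_sign[OF assms(2,3), of k] assms(4,5)
  unfolding separates_halfspaces[OF root_nonzero[OF assms(3)]] same_side_halfspaces[OF root_nonzero[OF assms(3)]]
  by fastforce+

lemma same_side_iff: "A \<in> alcs \<Longrightarrow> B \<in> alcs \<Longrightarrow> H \<in> hyps \<Longrightarrow> same_side H A B \<longleftrightarrow> \<not> separates H A B"
proof -
  assume *: "A \<in> alcs" "B \<in> alcs" "H \<in> hyps"
  obtain \<alpha> k where a: "\<alpha> \<in> \<Phi>" "H = ahyp \<alpha> (of_int k)" using *(3) hypsE by blast
  obtain x y where "x \<in> A" "y \<in> B" using alcove_facts(1)[OF *(1)] alcove_facts(1)[OF *(2)] by blast
  from separates_alcoves[OF *(1,2) a(1) this] show ?thesis unfolding a(2) by simp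
qed

text \<open>The side of a hyperplane is a two-valued label, and separation is the exclusive or of
  two labels. All later distance counts rest on this additivity.\<close>

lemma separates_triangle:
  assumes "A \<in> alcs" "B \<in> alcs" "C \<in> alcs" "H \<in> hyps"
  shows "separates H A C \<longleftrightarrow> separates H A B \<noteq> separates H B C"
proof -
  obtain \<alpha> k where a: "\<alpha> \<in> \<Phi>" "H = ahyp \<alpha> (of_int k)" using assms(4) hypsE by blast
  obtain x y z where x: "x \<in> A" "y \<in> B" "z \<in> C"
    using alcove_facts(1)[OF assms(1)] alcove_facts(1)[OF assms(2)] alcove_facts(1)[OF assms(3)] by blast
  show ?thesis
    unfolding a(2) separates_alcoves(1)[OF assms(1,3) a(1) x(1,3)]
      separates_alcoves(1)[OF assms(1,2) a(1) x(1,2)] separates_alcoves(1)[OF assms(2,3) a(1) x(2,3)] by auto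
qed

lemma separates_sym: "separates H A B \<longleftrightarrow> separates H B A"
  unfolding separates_def by blast

lemma separates_self: "A \<in> alcs \<Longrightarrow> H \<in> hyps \<Longrightarrow> \<not> separates H A A"
  using separates_triangle[of A A A H] by blast

definition Sep :: "'a set \<Rightarrow> 'a set \<Rightarrow> 'a set set" where
  "Sep A B = {H \<in> hyps. separates H A B}"

lemma alcove_dist_eq: "alcove_dist \<Phi> A B = card (Sep A B)"
  unfolding alcove_dist_def Sep_def ..

text \<open>A separating hyperplane must meet the segment between two sample points, which is
  bounded.\<close>

lemma finite_Sep:
  assumes "A \<in> alcs" "B \<in> alcs"
  shows "finite (Sep A B)"
proof -
  obtain x y where xy: "x \<in> A" "y \<in> B"
    using alcove_facts(1)[OF assms(1)] alcove_facts(1)[OF assms(2)] by blast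
  have "Sep A B \<subseteq> {H \<in> hyps. H \<inter> closed_segment x y \<noteq> {}}"
  proof
    fix H assume H: "H \<in> Sep A B"
    then obtain \<alpha> k where a: "\<alpha> \<in> \<Phi>" "H = ahyp \<alpha> (of_int k)" "H \<in> hyps"
      using hypsE unfolding Sep_def by blast
    then have *: "(\<alpha> \<bullet> x > - of_int k) \<noteq> (\<alpha> \<bullet> y > - of_int k)"
      using H separates_alcoves(1)[OF assms a(1) xy] unfolding Sep_def by (simp add: less_diff_eq) linarith
    have "connected (closed_segment x y)" by simp
    then have "\<exists>z\<in>closed_segment x y. \<alpha> \<bullet> z = - of_int k"
      using * connected_ivt_hyperplane[of "closed_segment x y" x y \<alpha> "- of_int k"]
        connected_ivt_hyperplane[of "closed_segment x y" y x \<alpha> "- of_int k"] by force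
    then show "H \<in> {H \<in> hyps. H \<inter> closed_segment x y \<noteq> {}}" using a by fastforce
  qed
  then show ?thesis using finite_hyps_meeting[OF bounded_closed_segment] finite_subset by blast
qed

lemma Sep_empty:
  assumes "A \<in> alcs" "B \<in> alcs" "Sep A B = {}"
  shows "A = B"
proof -
  obtain x y where xy: "x \<in> A" "y \<in> B"
    using alcove_facts(1)[OF assms(1)] alcove_facts(1)[OF assms(2)] by blast
  have *: "(\<alpha> \<bullet> x + of_int k > 0) = (\<alpha> \<bullet> y + of_int k > 0)" if "\<alpha> \<in> \<Phi>" for \<alpha> k
    using separates_alcoves(1)[OF assms(1,2) that xy] assms(3) hypsI[OF that] unfolding Sep_def by blast
  have x: "x \<in> cell x" "A = cell x" using alcove_eq_cell[OF assms(1) xy(1)] xy by auto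
  have y: "y \<in> reg" using alcove_facts(4)[OF assms(2)] xy by blast
  have "y \<in> cell x" unfolding mem_cell
  proof (intro ballI conjI)
    fix \<alpha> assume a: "\<alpha> \<in> \<Phi>"
    show "of_int \<lfloor>\<alpha> \<bullet> x\<rfloor> < \<alpha> \<bullet> y" using *[OF a, of "- \<lfloor>\<alpha> \<bullet> x\<rfloor>"] x(1) a by (simp add: mem_cell)
    \<comment> \<open>Not being separated at the upper end of the slab gives only a weak inequality;
      regularity of \<open>y\<close> excludes equality.\<close>
    have "\<alpha> \<bullet> y \<noteq> of_int (\<lfloor>\<alpha> \<bullet> x\<rfloor> + 1)" using y a unfolding reg_iff by (metis Ints_of_int)
    then show "\<alpha> \<bullet> y < of_int \<lfloor>\<alpha> \<bullet> x\<rfloor> + 1"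
      using *[OF a, of "- \<lfloor>\<alpha> \<bullet> x\<rfloor> - 1"] real_of_int_floor_add_one_gt[of "\<alpha> \<bullet> x"] by simp
  qed
  then show ?thesis using alcove_disjoint[OF assms(1,2)] xy x(2) by blast
qed

section \<open>Symmetries of the hyperplane arrangement\<close>

text \<open>The common setting for the reflections and for the whole action of
  \<open>Wtilde\<close>: alcoves, walls, separation and distance are all transported along such
  maps.\<close>

definition symm :: "('a \<Rightarrow> 'a) \<Rightarrow> bool" where
  "symm f \<longleftrightarrow> isom f \<and> (\<lambda>H. f ` H) ` hyps = hyps"

lemma symm_id: "symm id"
  unfolding symm_def by (simp add: isom_id)

lemma symm_comp: "symm f \<Longrightarrow> symm g \<Longrightarrow> symm (f \<circ> g)"
proof -
  assume *: "symm f" "symm g"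
  have "(\<lambda>H. (f \<circ> g) ` H) ` hyps = (\<lambda>H. f ` H) ` (\<lambda>H. g ` H) ` hyps"
    by (simp add: image_image)
  then show ?thesis using * unfolding symm_def by (simp add: isom_comp)
qed

lemma symm_isom: "symm f \<Longrightarrow> isom f"
  unfolding symm_def by blast

lemma symm_bij: "symm f \<Longrightarrow> bij f"
  by (simp add: symm_isom isom_bij)

lemma symm_hyp: "symm f \<Longrightarrow> H \<in> hyps \<Longrightarrow> f ` H \<in> hyps"
  unfolding symm_def by blast

lemma symm_inv: "symm f \<Longrightarrow> symm (inv_into UNIV f)"
proof -
  assume f: "symm f"
  let ?g = "inv_into UNIV f"
  have "(\<lambda>H. ?g ` H) ` (\<lambda>H. f ` H) ` hyps = hyps"
    using f by (simp add: image_image symm_bij bij_is_inj image_inv_f_f)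
  then show ?thesis using f unfolding symm_def by (simp add: isom_inv)
qed

lemma symm_reg: "symm f \<Longrightarrow> f ` reg = reg"
proof -
  assume f: "symm f"
  have "f ` reg = - f ` \<Union> hyps" unfolding reg_def using f by (simp add: bij_image_Compl_eq symm_bij)
  also have "f ` \<Union> hyps = \<Union> ((\<lambda>H. f ` H) ` hyps)" by blast
  finally show ?thesis using f unfolding symm_def reg_def by simp
qed

text \<open>The image is connected and regular, hence inside one alcove; the same argument for the
  inverse map gives equality.\<close>

lemma symm_alcove:
  assumes "symm f" "A \<in> alcs"
  shows "f ` A \<in> alcs"
proof -
  have sub: "\<exists>B\<in>alcs. g ` C \<subseteq> B" if g: "symm g" and C: "C \<in> alcs" for g C
  proof -
    obtain x where x: "x \<in> C" using alcove_facts(1)[OF C] by blast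
    have "connected (g ` C)"
      using alcove_facts(3)[OF C] isom_continuous[OF symm_isom[OF g]]
      by (intro connected_continuous_image convex_connected)
    moreover have "g ` C \<subseteq> reg" using alcove_facts(4)[OF C] symm_reg[OF g] by blast
    ultimately have "g ` C \<subseteq> connected_component_set reg (g x)"
      using x by (intro connected_component_maximal) auto
    moreover have "connected_component_set reg (g x) \<in> alcs"
      using x \<open>g ` C \<subseteq> reg\<close> unfolding alcoves_def reg_def[symmetric] components_def by blast
    ultimately show ?thesis by blast
  qed
  let ?g = "inv_into UNIV f"
  obtain B where B: "B \<in> alcs" "f ` A \<subseteq> B" using sub assms by blast
  obtain C where C: "C \<in> alcs" "?g ` B \<subseteq> C" using sub[OF symm_inv[OF assms(1)] B(1)] by blast
  have gf: "?g ` f ` A = A" using assms(1) by (simp add: symm_bij bij_is_inj image_inv_f_f)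
  then have "A \<subseteq> C" using B C by (metis image_mono order_trans)
  then have "A = C" using alcove_disjoint alcove_facts(1) assms(2) C(1) by (metis ex_in_conv subsetD)
  then have "f ` ?g ` B \<subseteq> f ` A" using C by blast
  moreover have "f ` ?g ` B = B" using assms(1) by (simp add: symm_bij bij_is_surj image_f_inv_f)
  ultimately show ?thesis using B by (metis equalityI)
qed

lemma symm_separates: "symm f \<Longrightarrow> H \<in> hyps \<Longrightarrow> separates (f ` H) (f ` A) (f ` B) \<longleftrightarrow> separates H A B"
  using separates_isom hypsE symm_isom by metis

lemma symm_Sep:
  assumes "symm f"
  shows "Sep (f ` A) (f ` B) = (\<lambda>H. f ` H) ` Sep A B"
proof -
  have "Sep (f ` A) (f ` B) = {H \<in> (\<lambda>H. f ` H) ` hyps. separates H (f ` A) (f ` B)}"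
    using assms unfolding symm_def Sep_def by simp
  also have "\<dots> = (\<lambda>H. f ` H) ` {H \<in> hyps. separates (f ` H) (f ` A) (f ` B)}" by auto
  also have "{H \<in> hyps. separates (f ` H) (f ` A) (f ` B)} = Sep A B"
    unfolding Sep_def using symm_separates[OF assms] by auto
  finally show ?thesis .
qed

lemma symm_dist: "symm f \<Longrightarrow> alcove_dist \<Phi> (f ` A) (f ` B) = alcove_dist \<Phi> A B"
  unfolding alcove_dist_eq symm_Sep
  by (intro card_image inj_on_image inj_on_subset[OF bij_is_inj[OF symm_bij] subset_UNIV])

lemma symm_hrefl: "symm f \<Longrightarrow> H \<in> hyps \<Longrightarrow> hrefl (f ` H) \<circ> f = f \<circ> hrefl H"
proof -
  assume *: "symm f" "H \<in> hyps"
  obtain \<alpha> k where "\<alpha> \<noteq> 0" "H = ahyp \<alpha> (of_int k)" using *(2) hypsE by blast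
  then show ?thesis using isom_hrefl[OF symm_isom[OF *(1)], of \<alpha>] by (simp add: fun_eq_iff)
qed

text \<open>Composing \<beta> + m with the reflection in \<alpha> + k gives a reflected root with
  offset m - j k, where j is the Cartan number of \<beta> and \<alpha>; integrality of j keeps the
  hyperplane in the arrangement.\<close>

lemma hrefl_symm:
  assumes "H \<in> hyps"
  shows "symm (hrefl H)"
proof -
  obtain \<alpha> k where a: "\<alpha> \<in> \<Phi>" "\<alpha> \<noteq> 0" "H = ahyp \<alpha> (of_int k)" using assms hypsE by blast
  note r = hrefl_hyperplane[OF a(2), where c = "of_int k", folded a(3)]
  have sub: "hrefl H ` K \<in> hyps" if K: "K \<in> hyps" for K
  proof -
    obtain \<beta> m where b: "\<beta> \<in> \<Phi>" "K = ahyp \<beta> (of_int m)" using K hypsE by blast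
    obtain j where j: "\<beta> \<bullet> coroot \<alpha> = of_int j" using root_integral[OF a(1) b(1)] Ints_cases by blast
    let ?\<gamma> = "\<beta> - (\<beta> \<bullet> coroot \<alpha>) *\<^sub>R \<alpha>"
    have "hrefl H ` K = ahyp ?\<gamma> (of_int (m - j * k))"
    proof -
      have eq: "\<beta> \<bullet> hrefl H x + of_int m = ?\<gamma> \<bullet> x + of_int (m - j * k)" for x
        unfolding a(3) hrefl_ahyp[OF a(2)] by (simp add: inner_diff_right inner_diff_left j algebra_simps)
      have "x \<in> hrefl H ` K \<longleftrightarrow> hrefl H x \<in> K" for x using r(3) by (metis imageE image_eqI)
      then have "x \<in> hrefl H ` K \<longleftrightarrow> x \<in> ahyp ?\<gamma> (of_int (m - j * k))" for x
        unfolding mem_ahyp eq[of x, symmetric] by (simp add: b(2))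
      then show ?thesis by blast
    qed
    then show ?thesis using hypsI[OF root_reflection[OF a(1) b(1)]] by metis
  qed
  have "K \<in> (\<lambda>K. hrefl H ` K) ` hyps" if "K \<in> hyps" for K
  proof -
    have "hrefl H ` hrefl H ` K = K" using r(3) by (simp add: image_image)
    then show ?thesis using sub[OF that] by (metis image_eqI)
  qed
  then have "(\<lambda>K. hrefl H ` K) ` hyps = hyps" using sub by blast
  then show ?thesis using r(4) unfolding symm_def by blast
qed

lemma hrefl_involution: "H \<in> hyps \<Longrightarrow> hrefl H \<circ> hrefl H = id"
  by (elim hypsE) (simp add: fun_eq_iff hrefl_hyperplane(3))

lemma hrefl_fixes: "H \<in> hyps \<Longrightarrow> p \<in> H \<Longrightarrow> hrefl H p = p"
  by (elim hypsE) (simp add: hrefl_hyperplane(2))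

lemma separates_hrefl:
  assumes "H \<in> hyps" "A \<in> alcs"
  shows "separates H A (hrefl H ` A)"
proof -
  obtain \<alpha> k where a: "\<alpha> \<in> \<Phi>" "\<alpha> \<noteq> 0" "H = ahyp \<alpha> (of_int k)" using assms hypsE by blast
  obtain x where x: "x \<in> A" using alcove_facts(1)[OF assms(2)] by blast
  have "\<alpha> \<bullet> x + of_int k \<noteq> 0" using x alcove_sign[OF assms(2) a(1), of k] by force
  then show ?thesis
    unfolding a(3) using x separates_alcoves(1)[OF assms(2) symm_alcove[OF hrefl_symm[OF assms(1)] assms(2)] a(1) x, of "hrefl H x" k]
      hrefl_hyperplane(1)[OF a(2), of "of_int k" x] a(3) by auto
qed

end

section \<open>Walls and generic points on hyperplanes\<close>

context root_sys
begin

text \<open>Ambient points are projected orthogonally onto the hyperplane by \<open>pr\<close>,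
  which reduces genericity inside the hyperplane to genericity in the whole space.\<close>

lemma generic_point_on_hyperplane:
  assumes "\<alpha> \<noteq> 0" "p0 \<in> ahyp \<alpha> c" "e > 0"
  shows "\<exists>p \<in> ahyp \<alpha> c \<inter> ball p0 e. \<forall>H\<in>hyps. p \<in> H \<longrightarrow> H = ahyp \<alpha> c"
proof -
  define pr where "pr x = x - ((\<alpha> \<bullet> x + c) / (\<alpha> \<bullet> \<alpha>)) *\<^sub>R \<alpha>" for x
  define r where "r \<beta> = (\<beta> \<bullet> \<alpha>) / (\<alpha> \<bullet> \<alpha>)" for \<beta>
  \<comment> \<open>A pair in \<open>F\<close> encodes the condition on x that \<open>pr x\<close>
    lies on \<beta> + m = 0. The removed pair (0, 0) arises exactly when \<beta> + m is a multiple
    of \<alpha> + c, that is, when this hyperplane is the given one.\<close>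
  define F where "F = (\<lambda>(\<beta>, m). (\<beta> - r \<beta> *\<^sub>R \<alpha>, c * r \<beta> - of_int m)) ` (\<Phi> \<times> (UNIV :: int set)) - {(0, 0)}"
  have nz: "\<alpha> \<bullet> \<alpha> \<noteq> 0" using assms(1) by simp
  have pr_mem: "pr x \<in> ahyp \<alpha> c" for x using nz by (simp add: pr_def inner_diff_right)
  have pr_val: "\<beta> \<bullet> pr x = (\<beta> - r \<beta> *\<^sub>R \<alpha>) \<bullet> x - c * r \<beta>" for \<beta> x
    by (simp add: pr_def r_def inner_diff_right inner_diff_left add_divide_distrib distrib_right)
  have "continuous_on UNIV pr" unfolding pr_def by (intro continuous_intros) (use nz in auto)
  then have "open (pr -` ball p0 e)" by (intro open_vimage) auto
  moreover have "pr p0 = p0" using assms(2) by (simp add: pr_def)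
  then have "pr -` ball p0 e \<noteq> {}" using assms(3) by (metis centre_in_ball empty_iff vimageI)
  moreover have "countable F" unfolding F_def by (simp add: countable_finite finite_roots)
  moreover have "\<gamma> \<noteq> 0 \<or> d \<noteq> 0" if "(\<gamma>, d) \<in> F" for \<gamma> d using that unfolding F_def by auto
  ultimately obtain x where x: "x \<in> pr -` ball p0 e" "\<forall>(\<gamma>, d)\<in>F. \<gamma> \<bullet> x \<noteq> d"
    using negligible_countable_hyperplanes[of F "pr -` ball p0 e"] by blast
  have "H = ahyp \<alpha> c" if H: "H \<in> hyps" "pr x \<in> H" for H
  proof -
    obtain \<beta> m where b: "\<beta> \<in> \<Phi>" "\<beta> \<noteq> 0" "H = ahyp \<beta> (of_int m)" using H(1) hypsE by blast
    have "(\<beta> - r \<beta> *\<^sub>R \<alpha>) \<bullet> x = c * r \<beta> - of_int m"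
      using H(2) pr_val[of \<beta> x] unfolding b(3) mem_ahyp by linarith
    then have "(\<beta> - r \<beta> *\<^sub>R \<alpha>, c * r \<beta> - of_int m) \<notin> F" using x(2) by blast
    moreover have "(\<beta> - r \<beta> *\<^sub>R \<alpha>, c * r \<beta> - of_int m) \<in> F \<union> {(0, 0)}"
      unfolding F_def using b(1) by force
    ultimately have eq: "\<beta> = r \<beta> *\<^sub>R \<alpha>" "of_int m = r \<beta> * c" by (auto simp: mult.commute)
    have "r \<beta> \<noteq> 0" using eq(1) b(2) by auto
    moreover have "\<beta> \<bullet> y + of_int m = r \<beta> * (\<alpha> \<bullet> y + c)" for y
      by (subst eq(1)) (simp add: eq(2) algebra_simps)
    ultimately show ?thesis unfolding b(3) ahyp_def by simp
  qed
  then show ?thesis using x(1) pr_mem by blast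
qed

lemma closure_alcove_sign:
  assumes "p \<in> closure A"
  shows "A \<subseteq> {x. \<alpha> \<bullet> x + c > 0} \<Longrightarrow> \<alpha> \<bullet> p + c \<ge> 0"
    and "A \<subseteq> {x. \<alpha> \<bullet> x + c < 0} \<Longrightarrow> \<alpha> \<bullet> p + c \<le> 0"
proof -
  have eq: "{x. \<alpha> \<bullet> x + c \<ge> 0} = {x. \<alpha> \<bullet> x \<ge> - c}" "{x. \<alpha> \<bullet> x + c \<le> 0} = {x. \<alpha> \<bullet> x \<le> - c}"
    by auto
  show "\<alpha> \<bullet> p + c \<ge> 0" if "A \<subseteq> {x. \<alpha> \<bullet> x + c > 0}"
  proof -
    have "closure A \<subseteq> {x. \<alpha> \<bullet> x + c \<ge> 0}"
      using that by (intro closure_minimal) (auto simp: eq closed_halfspace_ge)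
    then show ?thesis using assms by blast
  qed
  show "\<alpha> \<bullet> p + c \<le> 0" if "A \<subseteq> {x. \<alpha> \<bullet> x + c < 0}"
  proof -
    have "closure A \<subseteq> {x. \<alpha> \<bullet> x + c \<le> 0}"
      using that by (intro closure_minimal) (auto simp: eq closed_halfspace_le)
    then show ?thesis using assms by blast
  qed
qed

text \<open>Weak inequalities at \<open>q\<close> and strict ones at \<open>x\<close> combine to
  strict ones on the open segment, so \<open>q\<close> is a limit of points of A.\<close>

lemma closure_alcove_mem:
  assumes A: "A \<in> alcs" "x \<in> A"
    and q: "\<And>\<alpha> k. \<alpha> \<in> \<Phi> \<Longrightarrow> \<alpha> \<bullet> x + of_int k > 0 \<Longrightarrow> \<alpha> \<bullet> q + of_int k \<ge> 0"
  shows "q \<in> closure A"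
proof -
  have "open_segment q x \<subseteq> A"
  proof
    fix z assume "z \<in> open_segment q x"
    then obtain t where t: "0 < t" "t < 1" "z = (1 - t) *\<^sub>R q + t *\<^sub>R x" by (auto simp: in_segment)
    have pos: "\<alpha> \<bullet> z + of_int k > 0" if "\<alpha> \<in> \<Phi>" "\<alpha> \<bullet> x + of_int k > 0" for \<alpha> k
    proof -
      have "\<alpha> \<bullet> z + of_int k = (1 - t) * (\<alpha> \<bullet> q + of_int k) + t * (\<alpha> \<bullet> x + of_int k)"
        by (simp add: t(3) inner_add_right algebra_simps)
      also have "\<dots> > 0" using t q[OF that] that(2) by (intro add_nonneg_pos) auto
      finally show ?thesis .
    qed
    have x: "x \<in> cell x" using alcove_eq_cell[OF A] A(2) by simp
    have "z \<in> cell x" unfolding mem_cell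
    proof (intro ballI conjI)
      fix \<alpha> assume a: "\<alpha> \<in> \<Phi>"
      show "of_int \<lfloor>\<alpha> \<bullet> x\<rfloor> < \<alpha> \<bullet> z"
        using pos[OF a, of "- \<lfloor>\<alpha> \<bullet> x\<rfloor>"] x a by (simp add: mem_cell)
      \<comment> \<open>The upper bound of a slab for \<alpha> is a lower bound of a slab for
        -\<alpha>, so the hypothesis on positive sides covers both ends.\<close>
      show "\<alpha> \<bullet> z < of_int \<lfloor>\<alpha> \<bullet> x\<rfloor> + 1"
        using pos[OF uminus_root[OF a], of "\<lfloor>\<alpha> \<bullet> x\<rfloor> + 1"] x a by (simp add: mem_cell)
    qed
    then show "z \<in> A" using alcove_eq_cell[OF A] by simp
  qed
  then have "closure (open_segment q x) \<subseteq> closure A" by (rule closure_mono)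
  then show ?thesis
    using A(2) closure_subset by (cases "q = x") (auto simp: closure_open_segment)
qed

text \<open>A point in the relative interior of a panel, the codimension-1 face of A on H. By
  \<open>wall_iff\<close> this pointwise notion can replace facets.\<close>

definition panel_point :: "'a set \<Rightarrow> 'a set \<Rightarrow> 'a \<Rightarrow> bool" where
  "panel_point A H p \<longleftrightarrow> H \<in> hyps \<and> p \<in> closure A \<and> p \<in> H \<and> (\<forall>K\<in>hyps. p \<in> K \<longrightarrow> K = H)"

text \<open>A change of sign would put a zero of the functional, hence a hyperplane missing
  \<open>p\<close>, into the ball.\<close>

lemma near_sign:
  assumes e: "\<forall>H\<in>hyps. H \<inter> ball p e \<noteq> {} \<longrightarrow> p \<in> H"
    and "\<alpha> \<in> \<Phi>" "\<alpha> \<bullet> p + of_int k \<noteq> 0" "q \<in> ball p e"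
  shows "\<alpha> \<bullet> q + of_int k > 0 \<longleftrightarrow> \<alpha> \<bullet> p + of_int k > 0"
proof -
  have "e > 0" using assms(4) by (metis ball_empty empty_iff not_less)
  have ne: "\<alpha> \<bullet> z \<noteq> - of_int k" if "z \<in> ball p e" for z
  proof
    assume "\<alpha> \<bullet> z = - of_int k"
    then have "z \<in> ahyp \<alpha> (of_int k) \<inter> ball p e" using that by simp
    then have "p \<in> ahyp \<alpha> (of_int k)" using e hypsI[OF assms(2)] by blast
    then show False using assms(3) by simp
  qed
  have c: "connected (ball p e)" "p \<in> ball p e" using \<open>e > 0\<close> by simp_all
  have "\<not> (\<alpha> \<bullet> p \<le> - of_int k \<and> - of_int k \<le> \<alpha> \<bullet> q)" "\<not> (\<alpha> \<bullet> q \<le> - of_int k \<and> - of_int k \<le> \<alpha> \<bullet> p)"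
    using connected_ivt_hyperplane[OF c(1) c(2) assms(4)] connected_ivt_hyperplane[OF c(1) assms(4) c(2)] ne
    by blast+
  then show "\<alpha> \<bullet> q + of_int k > 0 \<longleftrightarrow> \<alpha> \<bullet> p + of_int k > 0" by linarith
qed

lemma aff_dim_closure_alcove:
  assumes "A \<in> alcs"
  shows "aff_dim (closure A) = DIM('a)"
proof -
  have "A \<subseteq> interior (closure A)"
    using alcove_facts(2)[OF assms] by (intro interior_maximal closure_subset)
  then have "interior (closure A) \<noteq> {}" using alcove_facts(1)[OF assms] by blast
  then show ?thesis by (rule aff_dim_nonempty_interior)
qed

text \<open>Near \<open>p\<close> no hyperplane other than H restricts the closure of A within H, so
  a whole disc of H around \<open>p\<close> belongs to the face that H cuts out; this face therefore
  has the dimension of H.\<close>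

lemma panel_point_wall:
  assumes A: "A \<in> alcs" and p: "panel_point A H p"
  shows "H \<in> walls \<Phi> A"
proof -
  have H: "H \<in> hyps" "p \<in> closure A" "p \<in> H" and uniq: "\<And>K. K \<in> hyps \<Longrightarrow> p \<in> K \<Longrightarrow> K = H"
    using p unfolding panel_point_def by auto
  obtain \<alpha> k where a: "\<alpha> \<in> \<Phi>" "\<alpha> \<noteq> 0" "H = ahyp \<alpha> (of_int k)" using H(1) hypsE by blast
  have Heq: "H = {x. \<alpha> \<bullet> x = - of_int k}" unfolding a(3) by (auto simp: ahyp_def)
  let ?F = "closure A \<inter> H"
  have cc: "convex (closure A)" using alcove_facts(3)[OF A] by (rule convex_closure)
  have face: "?F face_of closure A"
  proof (cases "A \<subseteq> {x. \<alpha> \<bullet> x + of_int k > 0}")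
    case True
    then have "\<alpha> \<bullet> x \<ge> - of_int k" if "x \<in> closure A" for x
      using closure_alcove_sign(1)[OF that True] by linarith
    then show ?thesis unfolding Heq by (rule face_of_Int_supporting_hyperplane_ge[OF cc])
  next
    case False
    then have neg: "A \<subseteq> {x. \<alpha> \<bullet> x + of_int k < 0}" using alcove_sign[OF A a(1)] by blast
    then have "\<alpha> \<bullet> x \<le> - of_int k" if "x \<in> closure A" for x
      using closure_alcove_sign(2)[OF that neg] by linarith
    then show ?thesis unfolding Heq by (rule face_of_Int_supporting_hyperplane_le[OF cc])
  qed
  obtain e where e: "e > 0" "\<forall>H\<in>hyps. H \<inter> ball p e \<noteq> {} \<longrightarrow> p \<in> H"
    using locally_finite_hyps[of p] by blast
  obtain x where x: "x \<in> A" using alcove_facts(1)[OF A] by blast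
  have sub: "H \<inter> ball p e \<subseteq> ?F"
  proof
    fix q assume q: "q \<in> H \<inter> ball p e"
    have "q \<in> closure A"
    proof (rule closure_alcove_mem[OF A x])
      fix \<beta> m assume b: "\<beta> \<in> \<Phi>" "\<beta> \<bullet> x + of_int m > 0"
      then have Ab: "A \<subseteq> {x. \<beta> \<bullet> x + of_int m > 0}" using alcove_sign[OF A b(1), of m] x by force
      show "\<beta> \<bullet> q + of_int m \<ge> 0"
      proof (cases "\<beta> \<bullet> p + of_int m = 0")
        case True
        then have "ahyp \<beta> (of_int m) = H" using uniq[OF hypsI[OF b(1), of m]] by simp
        then have "\<beta> \<bullet> q + of_int m = 0" using q by (metis IntD1 mem_ahyp)
        then show ?thesis by simp
      next
        case False
        moreover have "\<beta> \<bullet> p + of_int m \<ge> 0" using closure_alcove_sign(1)[OF H(2) Ab] .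
        ultimately show ?thesis
          using near_sign[OF e(2) b(1) False, of q] q by (simp add: less_eq_real_def)
      qed
    qed
    then show "q \<in> ?F" using q by blast
  qed
  note ad = aff_dim_closure_alcove[OF A]
  have "aff_dim (H \<inter> ball p e) = aff_dim H"
    using H(3) e(1) by (intro aff_dim_convex_Int_open) (auto simp: Heq convex_hyperplane)
  moreover have "aff_dim H = int (DIM('a)) - 1" unfolding Heq using a(2) by simp
  moreover have "aff_dim ?F \<le> aff_dim H" by (rule aff_dim_subset) simp
  ultimately have "aff_dim ?F = aff_dim (closure A) - 1"
    using aff_dim_subset[OF sub] ad by linarith
  then have "?F facet_of closure A" unfolding facet_of_def using face H(2,3) by blast
  then show ?thesis unfolding walls_def using H(1) by blast
qed

text \<open>By dimension the affine hull of the facet is H, so the facet contains a disc of H, and a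
  generic point of that disc lies on no other hyperplane.\<close>

lemma wall_panel_point:
  assumes A: "A \<in> alcs" and "H \<in> walls \<Phi> A"
  shows "\<exists>p. panel_point A H p"
proof -
  obtain F where H: "H \<in> hyps" and F: "F face_of closure A" "F \<noteq> {}" "aff_dim F = aff_dim (closure A) - 1" "F \<subseteq> H"
    using assms unfolding walls_def facet_of_def by blast
  obtain \<alpha> k where a: "\<alpha> \<in> \<Phi>" "\<alpha> \<noteq> 0" "H = ahyp \<alpha> (of_int k)" using H hypsE by blast
  have Heq: "H = {x. \<alpha> \<bullet> x = - of_int k}" unfolding a(3) by (auto simp: ahyp_def)
  have dim: "aff_dim F = aff_dim H" using F(3) aff_dim_closure_alcove[OF A] a(2) unfolding Heq by simp
  have hull: "affine hull F = H"
  proof (rule affine_dim_equal)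
    show "affine H" unfolding Heq by (rule affine_hyperplane)
    then show "affine hull F \<subseteq> H" using F(4) by (rule hull_minimal[rotated])
  qed (use F(2) dim in auto)
  have "convex F" using F(1) face_of_imp_convex by blast
  then have "rel_interior F \<noteq> {}" using F(2) rel_interior_eq_empty by blast
  then obtain p0 e where p0: "p0 \<in> F" "e > 0" "ball p0 e \<inter> H \<subseteq> F"
    unfolding ex_in_conv[symmetric] mem_rel_interior_ball hull by blast
  then have "p0 \<in> ahyp \<alpha> (of_int k)" using F(4) a(3) by blast
  from generic_point_on_hyperplane[OF a(2) this p0(2)]
  obtain p where p: "p \<in> H" "p \<in> ball p0 e" "\<forall>K\<in>hyps. p \<in> K \<longrightarrow> K = H"
    unfolding a(3)[symmetric] by blast
  then have "p \<in> closure A" using p0(3) face_of_imp_subset[OF F(1)] by blast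
  then show ?thesis using p H unfolding panel_point_def by blast
qed

lemma wall_iff: "A \<in> alcs \<Longrightarrow> H \<in> walls \<Phi> A \<longleftrightarrow> (\<exists>p. panel_point A H p)"
  using panel_point_wall wall_panel_point by blast

lemma wall_hyp: "H \<in> walls \<Phi> A \<Longrightarrow> H \<in> hyps"
  unfolding walls_def by blast

lemma finite_walls: "A \<in> alcs \<Longrightarrow> finite (walls \<Phi> A)"
proof -
  assume A: "A \<in> alcs"
  have "walls \<Phi> A \<subseteq> {H \<in> hyps. H \<inter> closure A \<noteq> {}}"
    unfolding walls_def facet_of_def using face_of_imp_subset by fastforce
  then show ?thesis
    using finite_hyps_meeting[OF bounded_closure[OF alcove_bounded[OF A]]] finite_subset by blast
qed

lemma symm_panel_point:
  assumes "symm f" "panel_point A H p"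
  shows "panel_point (f ` A) (f ` H) (f p)"
proof -
  have inj: "inj f" using symm_bij[OF assms(1)] bij_is_inj by blast
  have *: "H \<in> hyps" "p \<in> closure A" "p \<in> H" "\<And>K. K \<in> hyps \<Longrightarrow> p \<in> K \<Longrightarrow> K = H"
    using assms(2) unfolding panel_point_def by auto
  have "K = f ` H" if K: "K \<in> hyps" "f p \<in> K" for K
  proof -
    obtain K' where K': "K' \<in> hyps" "K = f ` K'" using K(1) assms(1) unfolding symm_def by blast
    then have "p \<in> K'" using K(2) inj_image_mem_iff[OF inj] by blast
    then show ?thesis using *(4)[OF K'(1)] K'(2) by blast
  qed
  moreover have "f p \<in> closure (f ` A)"
    using *(2) isom_closure[OF symm_isom[OF assms(1)], of A] by blast
  ultimately show ?thesis
    unfolding panel_point_def using *(3) symm_hyp[OF assms(1) *(1)] by blast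
qed

lemma symm_wall: "symm f \<Longrightarrow> A \<in> alcs \<Longrightarrow> H \<in> walls \<Phi> A \<Longrightarrow> f ` H \<in> walls \<Phi> (f ` A)"
  using symm_panel_point wall_iff symm_alcove by metis

text \<open>The closures of the two alcoves share a point of H that avoids every other hyperplane,
  so H alone separates them; crossing a wall thus toggles one element of \<open>Sep\<close>.\<close>

lemma separates_cross:
  assumes A: "A \<in> alcs" and H: "H \<in> walls \<Phi> A" and B: "B \<in> alcs" and K: "K \<in> hyps"
  shows "separates K (hrefl H ` A) B \<longleftrightarrow> (K = H) \<noteq> separates K A B"
proof -
  obtain p where "panel_point A H p" using wall_panel_point[OF A H] by blast
  then have p: "H \<in> hyps" "p \<in> closure A" "p \<in> H" "\<And>K. K \<in> hyps \<Longrightarrow> p \<in> K \<Longrightarrow> K = H"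
    unfolding panel_point_def by auto
  let ?A' = "hrefl H ` A"
  note s = hrefl_symm[OF p(1)]
  have A': "?A' \<in> alcs" by (rule symm_alcove[OF s A])
  have p': "p \<in> closure ?A'"
    using p(2) isom_closure[OF symm_isom[OF s], of A] hrefl_fixes[OF p(1,3)] by (metis image_eqI)
  have "separates K ?A' A \<longleftrightarrow> K = H"
  proof (cases "K = H")
    case True
    then show ?thesis using separates_hrefl[OF p(1) A] separates_sym by blast
  next
    case False
    obtain \<alpha> k where a: "\<alpha> \<in> \<Phi>" "\<alpha> \<noteq> 0" "K = ahyp \<alpha> (of_int k)" using K hypsE by blast
    have nz: "\<alpha> \<bullet> p + of_int k \<noteq> 0" using p(4)[OF K] False a(3) by auto
    obtain x y where xy: "x \<in> ?A'" "y \<in> A" using alcove_facts(1)[OF A] by blast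
    show ?thesis
      unfolding a(3) separates_alcoves(1)[OF A' A a(1) xy]
      using alcove_sign[OF A a(1), of k] alcove_sign[OF A' a(1), of k] nz xy False a(3)
        closure_alcove_sign[OF p(2), of \<alpha> "of_int k"] closure_alcove_sign[OF p', of \<alpha> "of_int k"]
      by fastforce
  qed
  then show ?thesis using separates_triangle[OF A' A B K] by blast
qed

section \<open>Generic lines\<close>

text \<open>Ensures that a line leaving an alcove at a point of some hyperplane does so at a
  \<open>panel_point\<close>.\<close>

definition generic_line :: "'a \<Rightarrow> 'a \<Rightarrow> bool" where
  "generic_line x u \<longleftrightarrow> (\<forall>t. \<forall>H\<in>hyps. \<forall>K\<in>hyps. x + t *\<^sub>R u \<in> H \<longrightarrow> x + t *\<^sub>R u \<in> K \<longrightarrow> H = K)"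

text \<open>The direction is prescribed (later it is a gradient), so only the starting point is free
  to avoid coincidences. Hyperplanes parallel to u cause no trouble: a line starting off such a
  hyperplane never meets it.\<close>

lemma exists_generic_line:
  assumes "open U" "U \<noteq> {}"
  shows "\<exists>x\<in>U. generic_line x u \<and> x \<in> reg \<and> x + T *\<^sub>R u \<in> reg"
proof -
  define P where "P = \<Phi> \<times> (UNIV :: int set)"
  \<comment> \<open>Eliminating t from the equations that put x + t u on \<alpha> + k = 0 and on
    \<beta> + m = 0 leaves the linear condition on x encoded by \<open>g\<close>. If both
    hyperplanes are transverse to u, the trivial condition (0, 0) means that they coincide.\<close>
  define g where "g = (\<lambda>((\<alpha>, k), (\<beta>, m)). ((\<beta> \<bullet> u) *\<^sub>R \<alpha> - (\<alpha> \<bullet> u) *\<^sub>R \<beta>, (\<alpha> \<bullet> u) * of_int m - (\<beta> \<bullet> u) * of_int k :: real))"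
  \<comment> \<open>The first two families keep the start and the end of the segment off all
    hyperplanes.\<close>
  define F where "F = (\<lambda>(\<alpha>, k). (\<alpha>, - of_int k)) ` P \<union> (\<lambda>(\<alpha>, k). (\<alpha>, - of_int k - T * (\<alpha> \<bullet> u))) ` P
    \<union> (g ` (P \<times> P) - {(0, 0)})"
  have "countable P" unfolding P_def by (simp add: countable_finite finite_roots)
  then have "countable F" unfolding F_def by simp
  moreover have "\<gamma> \<noteq> 0 \<or> d \<noteq> 0" if "(\<gamma>, d) \<in> F" for \<gamma> d
    using that root_nonzero unfolding F_def P_def by auto
  ultimately obtain x where x: "x \<in> U" "\<forall>(\<gamma>, d)\<in>F. \<gamma> \<bullet> x \<noteq> d"
    using negligible_countable_hyperplanes[of F U] assms by blast
  have n1: "\<alpha> \<bullet> x + of_int k \<noteq> 0" if "\<alpha> \<in> \<Phi>" for \<alpha> k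
  proof -
    have "(\<alpha>, - of_int k) \<in> F" unfolding F_def P_def using that by force
    then have "\<alpha> \<bullet> x \<noteq> - of_int k" using x(2) by blast
    then show ?thesis by linarith
  qed
  have n2: "\<alpha> \<bullet> (x + T *\<^sub>R u) + of_int k \<noteq> 0" if "\<alpha> \<in> \<Phi>" for \<alpha> k
  proof -
    have "(\<alpha>, - of_int k - T * (\<alpha> \<bullet> u)) \<in> F" unfolding F_def P_def using that by force
    then have "\<alpha> \<bullet> x \<noteq> - of_int k - T * (\<alpha> \<bullet> u)" using x(2) by blast
    then show ?thesis by (simp add: inner_add_right)
  qed
  have reg: "y \<in> reg" if "\<And>\<alpha> k. \<alpha> \<in> \<Phi> \<Longrightarrow> \<alpha> \<bullet> y + of_int k \<noteq> 0" for y
    unfolding reg_def using that hypsE by (metis ComplI UnionE mem_ahyp)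
  have "H = K" if H: "H \<in> hyps" "x + t *\<^sub>R u \<in> H" and K: "K \<in> hyps" "x + t *\<^sub>R u \<in> K" for H K t
  proof -
    obtain \<alpha> k where a: "\<alpha> \<in> \<Phi>" "H = ahyp \<alpha> (of_int k)" using H hypsE by blast
    obtain \<beta> m where b: "\<beta> \<in> \<Phi>" "K = ahyp \<beta> (of_int m)" using K hypsE by blast
    have ha: "\<alpha> \<bullet> x + of_int k = - (t * (\<alpha> \<bullet> u))" using H(2) unfolding a(2) by (simp add: inner_add_right)
    have hb: "\<beta> \<bullet> x + of_int m = - (t * (\<beta> \<bullet> u))" using K(2) unfolding b(2) by (simp add: inner_add_right)
    have nz: "\<alpha> \<bullet> u \<noteq> 0" "\<beta> \<bullet> u \<noteq> 0" using ha hb n1[OF a(1)] n1[OF b(1)] by auto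
    let ?\<gamma> = "(\<beta> \<bullet> u) *\<^sub>R \<alpha> - (\<alpha> \<bullet> u) *\<^sub>R \<beta>" and ?d = "(\<alpha> \<bullet> u) * of_int m - (\<beta> \<bullet> u) * of_int k :: real"
    have key: "?\<gamma> \<bullet> y - ?d = (\<beta> \<bullet> u) * (\<alpha> \<bullet> y + of_int k) - (\<alpha> \<bullet> u) * (\<beta> \<bullet> y + of_int m)" for y
      by (simp add: inner_diff_left algebra_simps)
    have "?\<gamma> \<bullet> x - ?d = 0" unfolding key ha hb by simp
    then have "?\<gamma> \<bullet> x = ?d" by simp
    then have "(?\<gamma>, ?d) \<notin> F" using x(2) by blast
    moreover have "(?\<gamma>, ?d) \<in> g ` (P \<times> P)"
      by (rule image_eqI[of _ _ "((\<alpha>, k), (\<beta>, m))"]) (use a(1) b(1) in \<open>auto simp: g_def P_def\<close>)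
    ultimately have "?\<gamma> = 0" "?d = 0" unfolding F_def by auto
    then have "(\<beta> \<bullet> u) * (\<alpha> \<bullet> y + of_int k) = (\<alpha> \<bullet> u) * (\<beta> \<bullet> y + of_int m)" for y
      using key[of y] by simp
    then have "\<alpha> \<bullet> y + of_int k = 0 \<longleftrightarrow> \<beta> \<bullet> y + of_int m = 0" for y
      using nz by (metis mult_eq_0_iff)
    then show ?thesis unfolding a(2) b(2) ahyp_def by simp
  qed
  then have "generic_line x u" unfolding generic_line_def by blast
  then show ?thesis using x(1) reg[of x] reg[of "x + T *\<^sub>R u"] n1 n2 by blast
qed

text \<open>Compactness provides the least time outside A. The exit point lies in the closure but is
  not regular: otherwise its open cell would meet A and hence be A.\<close>

lemma first_crossing:
  assumes A: "A \<in> alcs" and x: "x \<in> A" and T: "T > 0" and y: "x + T *\<^sub>R u \<in> reg" "x + T *\<^sub>R u \<notin> A"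
    and gen: "generic_line x u"
  obtains t \<alpha> k where "0 < t" "t < T" "\<alpha> \<in> \<Phi>" "panel_point A (ahyp \<alpha> (of_int k)) (x + t *\<^sub>R u)"
    "A \<subseteq> {z. \<alpha> \<bullet> z + of_int k < 0}" "\<alpha> \<bullet> u > 0"
proof -
  let ?f = "\<lambda>s. x + s *\<^sub>R u"
  have cont: "continuous_on S ?f" for S by (intro continuous_intros)
  define Z where "Z = {0..T} \<inter> ?f -` (- A)"
  have "closed (?f -` (- A))"
    using alcove_facts(2)[OF A] cont by (intro closed_vimage) (auto simp: closed_def)
  then have "compact Z" unfolding Z_def by (intro compact_Int_closed) auto
  moreover have "T \<in> Z" unfolding Z_def using T y(2) by auto
  ultimately obtain t where t: "t \<in> Z" "\<And>s. s \<in> Z \<Longrightarrow> t \<le> s" using compact_attains_inf[of Z] by blast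
  have t0: "0 \<le> t" "t \<le> T" "?f t \<notin> A" using t(1) unfolding Z_def by auto
  have "t \<noteq> 0" using t0(3) x by auto
  then have tpos: "0 < t" using t0(1) by simp
  have before: "?f s \<in> A" if "0 \<le> s" "s < t" for s
    using t(2)[of s] that t0(2) unfolding Z_def by auto
  have "?f ` closure {0..<t} \<subseteq> closure A"
    using before closure_subset by (intro image_closure_subset cont closed_closure) force
  then have pcl: "?f t \<in> closure A" using tpos by (simp add: image_subset_iff)
  have "?f t \<notin> reg"
  proof
    assume r: "?f t \<in> reg"
    then have "cell (?f t) \<inter> A \<noteq> {}"
      using pcl open_cell cell_self open_Int_closure_eq_empty by blast
    then have "cell (?f t) = A" using alcove_disjoint[OF cell_alcove[OF r] A] by blast
    then show False using cell_self[OF r] t0(3) by blast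
  qed
  then obtain H where H: "H \<in> hyps" "?f t \<in> H" unfolding reg_def by blast
  then have pp: "panel_point A H (?f t)" unfolding panel_point_def using pcl gen generic_line_def by blast
  have "t \<noteq> T" using \<open>?f t \<notin> reg\<close> y(1) by blast
  then have tT: "t < T" using t0(2) by simp
  obtain \<beta> m where b: "\<beta> \<in> \<Phi>" "H = ahyp \<beta> (of_int m)" using H(1) hypsE by blast
  \<comment> \<open>The sign of the root is chosen so that A is on the negative side; the functional
    then increases to 0 along the line, which gives \<alpha> \<bullet> u > 0.\<close>
  obtain \<alpha> k where a: "\<alpha> \<in> \<Phi>" "H = ahyp \<alpha> (of_int k)" "A \<subseteq> {z. \<alpha> \<bullet> z + of_int k < 0}"
  proof (cases "A \<subseteq> {z. \<beta> \<bullet> z + of_int m < 0}")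
    case True
    then show ?thesis using that[of \<beta> m] b by blast
  next
    case False
    then have "A \<subseteq> {z. \<beta> \<bullet> z + of_int m > 0}" using alcove_sign[OF A b(1), of m] by blast
    then have "A \<subseteq> {z. - \<beta> \<bullet> z + of_int (- m) < 0}" by auto
    moreover have "H = ahyp (- \<beta>) (of_int (- m))" unfolding b(2) ahyp_def by auto
    ultimately show ?thesis using that[of "- \<beta>" "- m"] uminus_root[OF b(1)] by blast
  qed
  have "\<alpha> \<bullet> x + of_int k < 0" using a(3) x by blast
  moreover have "\<alpha> \<bullet> x + of_int k + t * (\<alpha> \<bullet> u) = 0"
    using H(2) unfolding a(2) by (simp add: inner_add_right)
  ultimately have "t * (\<alpha> \<bullet> u) > 0" by linarith
  then have "\<alpha> \<bullet> u > 0" using tpos by (simp add: zero_less_mult_iff)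
  then show ?thesis using that[OF tpos tT a(1) _ a(3)] pp a(2) by blast
qed

text \<open>The first wall crossed on a generic line from A to B separates them, because an affine
  functional vanishes only once on a transverse line.\<close>

lemma exists_separating_wall:
  assumes A: "A \<in> alcs" and B: "B \<in> alcs" and "A \<noteq> B"
  shows "\<exists>H\<in>walls \<Phi> A. separates H A B"
proof -
  obtain x0 y0 where x0: "x0 \<in> A" "y0 \<in> B" using alcove_facts(1)[OF A] alcove_facts(1)[OF B] by blast
  define u where "u = y0 - x0"
  let ?U = "A \<inter> (\<lambda>x. x + u) -` B"
  have "open ((\<lambda>x. x + u) -` B)"
    using alcove_facts(2)[OF B] by (intro open_vimage continuous_intros)
  then have "open ?U" using alcove_facts(2)[OF A] by blast
  moreover have "x0 \<in> ?U" using x0 by (simp add: u_def)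
  ultimately obtain x where x: "x \<in> ?U" "generic_line x u" "x + 1 *\<^sub>R u \<in> reg"
    using exists_generic_line[of ?U u 1] by blast
  have y: "x + 1 *\<^sub>R u \<in> B" using x(1) by simp
  then have "x + 1 *\<^sub>R u \<notin> A" using alcove_disjoint[OF A B] assms(3) by blast
  from first_crossing[OF A _ zero_less_one x(3) this x(2)] x(1)
  obtain t \<alpha> k where t: "0 < t" "t < 1" "\<alpha> \<in> \<Phi>" "panel_point A (ahyp \<alpha> (of_int k)) (x + t *\<^sub>R u)"
    "A \<subseteq> {z. \<alpha> \<bullet> z + of_int k < 0}" "\<alpha> \<bullet> u > 0" by blast
  have "\<alpha> \<bullet> (x + t *\<^sub>R u) + of_int k = 0" using t(4) unfolding panel_point_def by simp
  then have "\<alpha> \<bullet> (x + 1 *\<^sub>R u) + of_int k = (1 - t) * (\<alpha> \<bullet> u)"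
    by (simp add: inner_add_right algebra_simps)
  then have "\<alpha> \<bullet> (x + 1 *\<^sub>R u) + of_int k > 0" using t(2,6) by simp
  moreover have "\<not> \<alpha> \<bullet> x + of_int k > 0" using t(5) x(1) by fastforce
  ultimately have "separates (ahyp \<alpha> (of_int k)) A B"
    using separates_alcoves(1)[OF A B t(3) _ y, of x k] x(1) by blast
  then show ?thesis using panel_point_wall[OF A t(4)] by blast
qed

text \<open>Induction on the number of hyperplanes between the current alcove and the last one: a
  crossed hyperplane is never met again, so each crossing removes it from \<open>Sep\<close>. The
  invariant is that the line is inside the current alcove at some time \<open>t0\<close>.\<close>

lemma generic_line_stays:
  assumes gen: "generic_line x u" and y: "x + T *\<^sub>R u \<in> reg" and S: "S \<subseteq> alcs"
    and step: "\<And>B t \<alpha> k. B \<in> S \<Longrightarrow> 0 \<le> t \<Longrightarrow> t \<le> T \<Longrightarrow> \<alpha> \<in> \<Phi> \<Longrightarrow> \<alpha> \<bullet> u > 0 \<Longrightarrow>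
      B \<subseteq> {z. \<alpha> \<bullet> z + of_int k < 0} \<Longrightarrow> panel_point B (ahyp \<alpha> (of_int k)) (x + t *\<^sub>R u) \<Longrightarrow>
      hrefl (ahyp \<alpha> (of_int k)) ` B \<in> S"
  shows "B \<in> S \<Longrightarrow> 0 \<le> t0 \<Longrightarrow> t0 \<le> T \<Longrightarrow> x + t0 *\<^sub>R u \<in> B \<Longrightarrow> cell (x + T *\<^sub>R u) \<in> S"
proof (induction "card (Sep B (cell (x + T *\<^sub>R u)))" arbitrary: B t0 rule: less_induct)
  case less
  let ?y = "x + T *\<^sub>R u"
  let ?C = "cell ?y"
  have C: "?C \<in> alcs" "?y \<in> ?C" using cell_alcove[OF y] cell_self[OF y] by auto
  have B: "B \<in> alcs" using less.prems(1) S by blast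
  show ?case
  proof (cases "?y \<in> B")
    case True
    then show ?thesis using alcove_eq_cell[OF B] less.prems(1) by simp
  next
    case False
    let ?x = "x + t0 *\<^sub>R u"
    have sh: "?x + s *\<^sub>R u = x + (t0 + s) *\<^sub>R u" for s by (simp add: scaleR_left_distrib)
    have "t0 \<noteq> T" using False less.prems(4) by blast
    then have T: "T - t0 > 0" using less.prems(3) by simp
    have gen': "generic_line ?x u" using gen unfolding generic_line_def sh by blast
    have eqy: "?x + (T - t0) *\<^sub>R u = ?y" unfolding sh by simp
    obtain t1 \<alpha> k where t1: "0 < t1" "t1 < T - t0" "\<alpha> \<in> \<Phi>" "panel_point B (ahyp \<alpha> (of_int k)) (?x + t1 *\<^sub>R u)"
      "B \<subseteq> {z. \<alpha> \<bullet> z + of_int k < 0}" "\<alpha> \<bullet> u > 0"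
      using first_crossing[OF B less.prems(4) T _ _ gen'] y False unfolding eqy by blast
    define t where "t = t0 + t1"
    let ?H = "ahyp \<alpha> (of_int k)"
    let ?p = "x + t *\<^sub>R u"
    let ?B' = "hrefl ?H ` B"
    have pp: "panel_point B ?H ?p" using t1(4) unfolding sh t_def .
    have tb: "0 \<le> t" "t < T" using t1 less.prems unfolding t_def by auto
    have B'S: "?B' \<in> S" using step[OF less.prems(1) tb(1) _ t1(3,6,5) pp] tb by simp
    then have B': "?B' \<in> alcs" using S by blast
    have wall: "?H \<in> walls \<Phi> B" using panel_point_wall[OF B pp] .
    have H: "?H \<in> hyps" "?p \<in> closure B" "\<alpha> \<bullet> ?p + of_int k = 0" and uniq: "\<And>K. K \<in> hyps \<Longrightarrow> ?p \<in> K \<Longrightarrow> K = ?H"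
      using pp unfolding panel_point_def by auto
    obtain b where b: "b \<in> B" using alcove_facts(1)[OF B] by blast
    have bneg: "\<alpha> \<bullet> b + of_int k < 0" using b t1(5) by blast
    have after: "\<alpha> \<bullet> (x + s *\<^sub>R u) + of_int k > 0" if "s > t" for s
    proof -
      have "\<alpha> \<bullet> (x + s *\<^sub>R u) + of_int k = (s - t) * (\<alpha> \<bullet> u)"
        using H(3) by (simp add: inner_add_right algebra_simps)
      then show ?thesis using that t1(6) by simp
    qed
    have "separates ?H B ?C"
      using separates_alcoves(1)[OF B C(1) t1(3) b C(2)] bneg after[OF tb(2)] by simp
    then have HS: "?H \<in> Sep B ?C" unfolding Sep_def using H(1) by blast
    have "Sep ?B' ?C = Sep B ?C - {?H}"
      unfolding Sep_def using separates_cross[OF B wall C(1)] HS[unfolded Sep_def] by blast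
    then have lt: "card (Sep ?B' ?C) < card (Sep B ?C)"
      using card_Diff1_less[OF finite_Sep[OF B C(1)] HS] by simp
    obtain e where e: "e > 0" "\<forall>H\<in>hyps. H \<inter> ball ?p e \<noteq> {} \<longrightarrow> ?p \<in> H"
      using locally_finite_hyps[of ?p] by blast
    have un: "norm u > 0" using t1(6) by auto
    \<comment> \<open>A time after the crossing that is short enough to meet no other hyperplane and
      not to overshoot T; the factor 2 makes the distance bound strict.\<close>
    define \<delta> where "\<delta> = min (T - t) (e / (2 * norm u))"
    have d: "\<delta> > 0" "\<delta> \<le> T - t" "\<delta> * norm u < e"
    proof -
      show "\<delta> > 0" "\<delta> \<le> T - t" using tb e(1) un unfolding \<delta>_def by auto
      have "\<delta> * norm u \<le> e / (2 * norm u) * norm u"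
        unfolding \<delta>_def using un by (intro mult_right_mono) auto
      then show "\<delta> * norm u < e" using un e(1) by simp
    qed
    let ?z = "x + (t + \<delta>) *\<^sub>R u"
    have "dist ?p ?z = \<delta> * norm u" using d(1) by (simp add: dist_norm scaleR_left_distrib)
    then have z: "?z \<in> ball ?p e" using d(3) by (simp only: mem_ball)
    have zH: "\<alpha> \<bullet> ?z + of_int k > 0" using after[of "t + \<delta>"] d(1) by simp
    have zreg: "?z \<in> reg"
    proof (rule ccontr)
      assume "?z \<notin> reg"
      then obtain K where K: "K \<in> hyps" "?z \<in> K" unfolding reg_def by blast
      then have "K = ?H" using e(2) K z uniq[OF K(1)] by blast
      then show False using K(2) zH by simp
    qed
    note D = cell_alcove[OF zreg] cell_self[OF zreg]
    \<comment> \<open>No hyperplane separates the reflected alcove from the cell just past the wall,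
      so they are equal and the line has entered \<open>?B'\<close>.\<close>
    have "\<not> separates K ?B' (cell ?z)" if K: "K \<in> hyps" for K
    proof (cases "K = ?H")
      case True
      have "separates ?H B (cell ?z)"
        using separates_alcoves(1)[OF B D(1) t1(3) b D(2)] bneg zH by simp
      then show ?thesis using separates_cross[OF B wall D(1) K] True by blast
    next
      case False
      obtain \<beta> m where bm: "\<beta> \<in> \<Phi>" "K = ahyp \<beta> (of_int m)" using K hypsE by blast
      have nz: "\<beta> \<bullet> ?p + of_int m \<noteq> 0" using uniq[OF K] False bm(2) by auto
      have "(\<beta> \<bullet> b + of_int m > 0) = (\<beta> \<bullet> ?p + of_int m > 0)"
        using alcove_sign[OF B bm(1), of m] closure_alcove_sign[OF H(2), of \<beta> "of_int m"] b nz by fastforce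
      then have "\<not> separates K B (cell ?z)"
        using separates_alcoves(1)[OF B D(1) bm(1) b D(2)] near_sign[OF e(2) bm(1) nz z] bm(2) by simp
      then show ?thesis using separates_cross[OF B wall D(1) K] False by blast
    qed
    then have "?B' = cell ?z" using Sep_empty[OF B' D(1)] unfolding Sep_def by blast
    then have zB': "?z \<in> ?B'" using D(2) by simp
    show ?thesis using less.hyps[OF lt B'S _ _ zB'] tb d by simp
  qed
qed

end

section \<open>The affine Weyl group\<close>

lemma aff_group_simps [simp]: "f \<otimes>\<^bsub>aff_group\<^esub> g = f \<circ> g" "\<one>\<^bsub>aff_group\<^esub> = id"
  by (simp_all add: aff_group_def)

lemma mem_aff_group: "f \<in> carrier aff_group \<longleftrightarrow> bij f \<and> (\<exists>L b. linear L \<and> f = (\<lambda>x. L x + b))"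
  by (simp add: aff_group_def)

lemma isom_aff_group: "isom f \<Longrightarrow> f \<in> carrier aff_group"
  using isom_bij[of f] unfolding isom_def mem_aff_group orthogonal_transformation_def by blast

lemma inv_into_aff_group:
  assumes "f \<in> carrier aff_group"
  shows "inv_into UNIV f \<in> carrier aff_group"
proof -
  obtain L b where L: "linear L" "f = (\<lambda>x. L x + b)" and f: "bij f"
    using assms unfolding mem_aff_group by auto
  have "inj L"
  proof (rule injI)
    fix x y assume "L x = L y"
    then have "f x = f y" by (simp add: L(2))
    then show "x = y" using bij_is_inj[OF f] by (simp add: inj_eq)
  qed
  then have M: "linear (inv_into UNIV L)" "bij L"
    using inj_linear_imp_inv_linear[OF L(1)] linear_injective_imp_surjective[OF L(1)]
    by (simp_all add: bij_def)
  have "inv_into UNIV f y = inv_into UNIV L y + inv_into UNIV L (- b)" for y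
  proof -
    have "f (inv_into UNIV L y + inv_into UNIV L (- b)) = y"
      using M(2) by (simp add: L(2) linear_add[OF L(1)] bij_is_surj surj_f_inv_f)
    then show ?thesis using bij_is_inj[OF f] by (metis inv_f_f)
  qed
  then have "inv_into UNIV f = (\<lambda>y. inv_into UNIV L y + inv_into UNIV L (- b))" by (rule ext)
  then show ?thesis unfolding mem_aff_group using M(1) bij_imp_bij_inv[OF f] by blast
qed

lemma group_aff_group: "Group.group (aff_group :: ('a::euclidean_space \<Rightarrow> 'a) monoid)"
proof (rule groupI)
  fix f g :: "'a \<Rightarrow> 'a" assume f: "f \<in> carrier aff_group" and g: "g \<in> carrier aff_group"
  obtain L b M c where *: "linear L" "f = (\<lambda>x. L x + b)" "linear M" "g = (\<lambda>x. M x + c)"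
    using f g unfolding mem_aff_group by auto
  have "f \<circ> g = (\<lambda>x. (L \<circ> M) x + (L c + b))" by (auto simp: * linear_add fun_eq_iff)
  moreover have "linear (L \<circ> M)" using * linear_compose by blast
  moreover have "bij (f \<circ> g)" using f g bij_comp unfolding mem_aff_group by blast
  ultimately show "f \<otimes>\<^bsub>aff_group\<^esub> g \<in> carrier aff_group" unfolding mem_aff_group aff_group_simps by blast
next
  show "\<one>\<^bsub>aff_group\<^esub> \<in> (carrier aff_group :: ('a \<Rightarrow> 'a) set)" by (simp add: isom_aff_group isom_id)
next
  fix f :: "'a \<Rightarrow> 'a" assume f: "f \<in> carrier aff_group"
  then have "inv_into UNIV f \<circ> f = id" by (simp add: mem_aff_group bij_is_inj)
  then show "\<exists>g\<in>carrier aff_group. g \<otimes>\<^bsub>aff_group\<^esub> f = \<one>\<^bsub>aff_group\<^esub>"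
    using inv_into_aff_group[OF f] by auto
qed (simp_all add: comp_assoc)

lemma inv_aff_group:
  assumes "f \<in> carrier aff_group"
  shows "inv\<^bsub>aff_group\<^esub> f = inv_into UNIV f"
proof -
  have "inv_into UNIV f \<circ> f = id" using assms by (simp add: mem_aff_group bij_is_inj)
  then show ?thesis
    using group.inv_equality[OF group_aff_group _ assms inv_into_aff_group[OF assms]] by simp
qed

lemma foldr_comp_append: "foldr (\<circ>) (xs @ ys) id = foldr (\<circ>) xs id \<circ> foldr (\<circ>) ys id"
  by (induction xs) (simp_all add: comp_assoc)

section \<open>Words in the base reflections\<close>

locale based_root_sys = root_sys +
  fixes A0 :: "'a set"
  assumes A0: "A0 \<in> alcoves \<Phi>"
begin

abbreviation "\<Delta> \<equiv> Delta_aff \<Phi> A0"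
abbreviation "word ss \<equiv> foldr (\<circ>) ss id"

text \<open>Explicit words, so that letters can be counted; \<open>Waff_eq\<close> identifies this
  set with \<open>Waff\<close>.\<close>

definition W\<Delta> :: "('a \<Rightarrow> 'a) set" where
  "W\<Delta> = {word ss | ss. set ss \<subseteq> \<Delta>}"

lemma DeltaE:
  assumes "s \<in> \<Delta>"
  obtains H where "H \<in> walls \<Phi> A0" "H \<in> hyps" "s = hrefl H"
  using assms wall_hyp unfolding Delta_aff_def by blast

lemma Delta_symm: "s \<in> \<Delta> \<Longrightarrow> symm s" and Delta_invol: "s \<in> \<Delta> \<Longrightarrow> s \<circ> s = id"
  by (elim DeltaE, simp add: hrefl_symm hrefl_involution)+

lemma word_Cons: "word (s # ss) = s \<circ> word ss"
  by simp

lemma word_symm: "set ss \<subseteq> \<Delta> \<Longrightarrow> symm (word ss)"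
  by (induction ss) (simp_all add: symm_id symm_comp Delta_symm)

lemma WD_symm: "g \<in> W\<Delta> \<Longrightarrow> symm g"
  unfolding W\<Delta>_def using word_symm by blast

lemma WD_id: "id \<in> W\<Delta>"
  unfolding W\<Delta>_def by (intro CollectI exI[of _ "[]"]) simp

lemma WD_comp: "g \<in> W\<Delta> \<Longrightarrow> h \<in> W\<Delta> \<Longrightarrow> g \<circ> h \<in> W\<Delta>"
proof -
  assume "g \<in> W\<Delta>" "h \<in> W\<Delta>"
  then obtain ss ts where "set ss \<subseteq> \<Delta>" "g = word ss" "set ts \<subseteq> \<Delta>" "h = word ts"
    unfolding W\<Delta>_def by blast
  then have "g \<circ> h = word (ss @ ts)" "set (ss @ ts) \<subseteq> \<Delta>" by (simp_all only: foldr_comp_append set_append Un_subset_iff)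
  then show ?thesis unfolding W\<Delta>_def by blast
qed

lemma WD_Delta: "s \<in> \<Delta> \<Longrightarrow> s \<in> W\<Delta>"
  unfolding W\<Delta>_def by (intro CollectI exI[of _ "[s]"]) simp

lemma WD_inv: "g \<in> W\<Delta> \<Longrightarrow> inv_into UNIV g \<in> W\<Delta>"
proof -
  have "\<exists>h\<in>W\<Delta>. h \<circ> word ss = id" if "set ss \<subseteq> \<Delta>" for ss
    using that
  proof (induction ss)
    case Nil
    show ?case by (intro bexI[of _ id] WD_id) simp
  next
    case (Cons s ss)
    have s: "s \<in> \<Delta>" "set ss \<subseteq> \<Delta>" using Cons.prems by simp_all
    obtain h where h: "h \<in> W\<Delta>" "h \<circ> word ss = id" using Cons.IH[OF s(2)] by blast
    have "(h \<circ> s) \<circ> (s \<circ> word ss) = h \<circ> (s \<circ> s) \<circ> word ss" by (simp add: comp_assoc)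
    also have "\<dots> = id" unfolding Delta_invol[OF s(1)] comp_id by (rule h(2))
    finally show ?case unfolding word_Cons using WD_comp[OF h(1) WD_Delta[OF s(1)]] by blast
  qed
  moreover assume "g \<in> W\<Delta>"
  ultimately obtain h where h: "h \<in> W\<Delta>" "h \<circ> g = id" unfolding W\<Delta>_def by blast
  have "bij g" using \<open>g \<in> W\<Delta>\<close> WD_symm symm_bij by blast
  have "g \<circ> inv_into UNIV g = id" using bij_is_surj[OF \<open>bij g\<close>] surj_iff by blast
  then have "h = h \<circ> g \<circ> inv_into UNIV g" unfolding comp_assoc by simp
  then have "h = inv_into UNIV g" unfolding h(2) by simp
  then show ?thesis using h(1) by simp
qed

text \<open>Induction on the distance from A0. The target B is reflected closer in a separating wall
  of A0, so that only base reflections are ever multiplied.\<close>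

lemma WD_transitive:
  assumes "B \<in> alcs"
  shows "\<exists>g\<in>W\<Delta>. g ` A0 = B"
  using assms
proof (induction "card (Sep A0 B)" arbitrary: B rule: less_induct)
  case less
  show ?case
  proof (cases "B = A0")
    case True
    then show ?thesis using WD_id by (metis image_id id_apply)
  next
    case False
    then obtain H where H: "H \<in> walls \<Phi> A0" "separates H A0 B"
      using exists_separating_wall[OF A0 less.prems] by blast
    let ?s = "hrefl H"
    have Hh: "H \<in> hyps" using wall_hyp[OF H(1)] .
    have s: "?s \<in> \<Delta>" unfolding Delta_aff_def using H(1) by blast
    have ss: "?s ` ?s ` S = S" for S using Delta_invol[OF s] by (metis image_comp image_id id_apply)
    have sB: "?s ` B \<in> alcs" using symm_alcove[OF Delta_symm[OF s] less.prems] .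
    have "Sep (?s ` A0) B = Sep A0 B - {H}"
      unfolding Sep_def using separates_cross[OF A0 H(1) less.prems] H(2) by blast
    \<comment> \<open>The reflection preserves distances, so moving B is the same as moving A0
      across the wall, where H drops out of \<open>Sep\<close>.\<close>
    moreover have "card (Sep A0 (?s ` B)) = card (Sep (?s ` A0) B)"
      using symm_dist[OF Delta_symm[OF s], of A0 "?s ` B"] unfolding alcove_dist_eq ss by simp
    moreover have "H \<in> Sep A0 B" unfolding Sep_def using H(2) Hh by blast
    ultimately have "card (Sep A0 (?s ` B)) < card (Sep A0 B)"
      using card_Diff1_less[OF finite_Sep[OF A0 less.prems]] by simp
    then obtain g where g: "g \<in> W\<Delta>" "g ` A0 = ?s ` B" using less.hyps sB by blast
    have "(?s \<circ> g) ` A0 = B" by (simp only: image_comp[symmetric] g(2) ss)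
    then show ?thesis using WD_comp[OF WD_Delta[OF s] g(1)] by blast
  qed
qed

lemma hrefl_conj:
  assumes "symm g" "H \<in> hyps"
  shows "hrefl (g ` H) = g \<circ> hrefl H \<circ> inv_into UNIV g"
proof -
  have "hrefl (g ` H) \<circ> (g \<circ> inv_into UNIV g) = g \<circ> hrefl H \<circ> inv_into UNIV g"
    using symm_hrefl[OF assms] by (simp add: comp_assoc[symmetric])
  moreover have "g \<circ> inv_into UNIV g = id"
    using symm_bij[OF assms(1)] bij_is_surj surj_iff by blast
  ultimately show ?thesis by simp
qed

text \<open>Every hyperplane is a wall of some alcove, every alcove is an image of the base alcove,
  and conjugation carries the reflections along.\<close>

lemma hrefl_WD:
  assumes H: "H \<in> hyps"
  shows "hrefl H \<in> W\<Delta>"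
proof -
  obtain \<alpha> k where a: "\<alpha> \<in> \<Phi>" "\<alpha> \<noteq> 0" "H = ahyp \<alpha> (of_int k)" using H hypsE by blast
  have "((- of_int k) / (\<alpha> \<bullet> \<alpha>)) *\<^sub>R \<alpha> \<in> ahyp \<alpha> (of_int k)" using a(2) by simp
  from generic_point_on_hyperplane[OF a(2) this zero_less_one]
  obtain p where p: "p \<in> H" "\<forall>K\<in>hyps. p \<in> K \<longrightarrow> K = H" unfolding a(3) by blast
  obtain e where e: "e > 0" "\<forall>H\<in>hyps. H \<inter> ball p e \<noteq> {} \<longrightarrow> p \<in> H"
    using locally_finite_hyps[of p] by blast
  \<comment> \<open>A point at distance e/2 from the generic point \<open>p\<close>, normal to H;
    only H meets the ball of radius e.\<close>
  define x where "x = p + (e / (2 * norm \<alpha>)) *\<^sub>R \<alpha>"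
  have na: "norm \<alpha> > 0" using a(2) by simp
  then have "dist p x = e / 2" using e(1) by (simp add: x_def dist_norm)
  then have xb: "x \<in> ball p e" using e(1) by simp
  have px: "\<alpha> \<bullet> p + of_int k = 0" using p(1) a(3) by simp
  have xH: "\<alpha> \<bullet> x + of_int k > 0"
  proof -
    have "\<alpha> \<bullet> x + of_int k = (e / (2 * norm \<alpha>)) * (\<alpha> \<bullet> \<alpha>)"
      using px by (simp add: x_def inner_add_right)
    then show ?thesis using e(1) na a(2) by simp
  qed
  have xreg: "x \<in> reg"
  proof (rule ccontr)
    assume "x \<notin> reg"
    then obtain K where K: "K \<in> hyps" "x \<in> K" unfolding reg_def by blast
    then have "K = H" using e(2) xb p(2) by blast
    then show False using K(2) a(3) xH by simp
  qed
  let ?A = "cell x"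
  note A = cell_alcove[OF xreg] cell_self[OF xreg]
  have "p \<in> closure ?A"
  proof (rule closure_alcove_mem[OF A])
    fix \<beta> m assume b: "\<beta> \<in> \<Phi>" "\<beta> \<bullet> x + of_int m > 0"
    show "\<beta> \<bullet> p + of_int m \<ge> 0"
      using near_sign[OF e(2) b(1) _ xb, of m] b(2) by (cases "\<beta> \<bullet> p + of_int m = 0") auto
  qed
  then have "panel_point ?A H p" unfolding panel_point_def using H p by blast
  then have w: "H \<in> walls \<Phi> ?A" using panel_point_wall[OF A(1)] by blast
  obtain g where g: "g \<in> W\<Delta>" "g ` A0 = ?A" using WD_transitive[OF A(1)] by blast
  let ?h = "inv_into UNIV g"
  have hA: "?h ` ?A = A0" unfolding g(2)[symmetric]
    using symm_bij[OF WD_symm[OF g(1)]] by (simp add: bij_is_inj image_inv_f_f)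
  have K: "?h ` H \<in> walls \<Phi> A0"
    using symm_wall[OF WD_symm[OF WD_inv[OF g(1)]] A(1) w] unfolding hA .
  have "g ` ?h ` H = H" using symm_bij[OF WD_symm[OF g(1)]] by (simp add: bij_is_surj image_f_inv_f)
  then have "hrefl H = g \<circ> hrefl (?h ` H) \<circ> ?h"
    using hrefl_conj[OF WD_symm[OF g(1)] wall_hyp[OF K]] by simp
  moreover have "hrefl (?h ` H) \<in> W\<Delta>" using K WD_Delta unfolding Delta_aff_def by blast
  ultimately show ?thesis using WD_comp g(1) WD_inv by metis
qed

lemma Waff_eq: "Waff \<Phi> = W\<Delta>"
proof
  have sub: "hrefl ` hyps \<subseteq> carrier aff_group"
    using hrefl_symm symm_isom isom_aff_group by blast
  show "Waff \<Phi> \<subseteq> W\<Delta>"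
  proof
    fix w assume "w \<in> Waff \<Phi>"
    then show "w \<in> W\<Delta>" unfolding Waff_def
    proof (induction rule: generate.induct)
      case one
      show ?case by (simp only: aff_group_simps WD_id)
    next
      case (incl h)
      then show ?case using hrefl_WD by blast
    next
      case (inv h)
      then have "h \<in> W\<Delta>" using hrefl_WD by blast
      moreover have "inv\<^bsub>aff_group\<^esub> h = inv_into UNIV h" using inv sub inv_aff_group by blast
      ultimately show ?case using WD_inv by simp
    next
      case (eng h1 h2)
      then show ?case by (simp only: aff_group_simps WD_comp)
    qed
  qed
  have "word ss \<in> Waff \<Phi>" if "set ss \<subseteq> \<Delta>" for ss
    using that
  proof (induction ss)
    case Nil
    then show ?case unfolding Waff_def using generate.one[of aff_group] by (simp add: id_def)
  next
    case (Cons s ss)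
    have s: "s \<in> \<Delta>" "set ss \<subseteq> \<Delta>" using Cons.prems by simp_all
    then have "s \<in> hrefl ` hyps" using DeltaE by (metis image_eqI)
    then have "s \<in> generate aff_group (hrefl ` hyps)" by (rule generate.incl)
    from generate.eng[OF this Cons.IH[OF s(2), unfolded Waff_def]]
    show ?case unfolding Waff_def by (simp only: word_Cons aff_group_simps)
  qed
  then show "W\<Delta> \<subseteq> Waff \<Phi>" unfolding W\<Delta>_def by blast
qed

section \<open>Length and distance\<close>

text \<open>The exchange condition. Scanning from the left, H either is the wall of the current
  letter, which then cancels, or is carried past the letter to s(H), which separates the base alcove
  from the image under the remaining word.\<close>

lemma word_exchange:
  assumes "set ss \<subseteq> \<Delta>" "H \<in> hyps" "separates H A0 (word ss ` A0)"
  shows "\<exists>ss'. set ss' \<subseteq> \<Delta> \<and> hrefl H \<circ> word ss = word ss' \<and> Suc (length ss') = length ss"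
  using assms
proof (induction ss arbitrary: H)
  case Nil
  then show ?case using separates_self[OF A0 Nil.prems(2)] by (simp add: id_def)
next
  case (Cons s r)
  have s: "s \<in> \<Delta>" and r: "set r \<subseteq> \<Delta>" using Cons.prems(1) by auto
  obtain K where K: "K \<in> walls \<Phi> A0" "K \<in> hyps" "s = hrefl K" using s DeltaE by blast
  have ss: "s \<circ> s = id" "s ` s ` S = S" for S
    using Delta_invol[OF s] by (auto simp: fun_eq_iff image_image)
  note symm = Delta_symm[OF s]
  let ?B = "word r ` A0"
  have B: "?B \<in> alcs" using symm_alcove[OF word_symm[OF r] A0] .
  have sB: "s ` ?B \<in> alcs" using symm_alcove[OF symm B] .
  have sep: "separates H A0 (s ` ?B)" using Cons.prems(3) by (simp only: word_Cons image_comp)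
  show ?case
  proof (cases "H = K")
    case True
    then have "hrefl H \<circ> word (s # r) = word r" using ss(1) K(3) by (simp add: comp_assoc[symmetric])
    then show ?thesis using r by (metis length_Cons)
  next
    case False
    then have "separates H (s ` A0) (s ` ?B)"
      using separates_cross[OF A0 K(1) sB Cons.prems(2)] sep K(3) by blast
    moreover have sH: "s ` H \<in> hyps" using symm_hyp[OF symm Cons.prems(2)] .
    ultimately have "separates (s ` H) A0 ?B"
      using symm_separates[OF symm sH, of A0 ?B] unfolding ss(2) by blast
    then obtain r' where r': "set r' \<subseteq> \<Delta>" "hrefl (s ` H) \<circ> word r = word r'" "Suc (length r') = length r"
      using Cons.IH[OF r sH] by blast
    have "hrefl H \<circ> s = s \<circ> hrefl (s ` H)" using symm_hrefl[OF symm sH] unfolding ss(2) .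
    then have "hrefl H \<circ> word (s # r) = s \<circ> (hrefl (s ` H) \<circ> word r)" by (simp add: comp_assoc[symmetric])
    also have "\<dots> = word (s # r')" using r'(2) by simp
    finally have eq: "hrefl H \<circ> word (s # r) = word (s # r')" .
    have "set (s # r') \<subseteq> \<Delta>" "Suc (length (s # r')) = length (s # r)" using r'(1,3) s by simp_all
    then show ?thesis using eq by blast
  qed
qed

text \<open>d(A0, sB) = d(sA0, B), and crossing K toggles K alone, so left multiplication by a base
  reflection changes the distance by exactly one.\<close>

lemma card_Sep_reflect:
  assumes K: "K \<in> walls \<Phi> A0" and B: "B \<in> alcs"
  shows "if separates K A0 B then Suc (card (Sep A0 (hrefl K ` B))) = card (Sep A0 B)
    else card (Sep A0 (hrefl K ` B)) = Suc (card (Sep A0 B))"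
proof -
  note Kh = wall_hyp[OF K]
  let ?s = "hrefl K"
  have ss: "?s ` ?s ` S = S" for S
    using hrefl_involution[OF Kh] by (auto simp: fun_eq_iff image_image)
  have "card (Sep A0 (?s ` B)) = card (Sep (?s ` A0) B)"
    using symm_dist[OF hrefl_symm[OF Kh], of A0 "?s ` B"] unfolding alcove_dist_eq ss by simp
  moreover have "Sep (?s ` A0) B = (if separates K A0 B then Sep A0 B - {K} else insert K (Sep A0 B))"
    unfolding Sep_def using separates_cross[OF A0 K B] Kh by auto
  ultimately have c: "card (Sep A0 (?s ` B)) = card (if separates K A0 B then Sep A0 B - {K} else insert K (Sep A0 B))"
    by simp
  have mem: "separates K A0 B \<longleftrightarrow> K \<in> Sep A0 B" unfolding Sep_def using Kh by blast
  show ?thesis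
  proof (cases "separates K A0 B")
    case True
    then show ?thesis using c mem card_Suc_Diff1[OF finite_Sep[OF A0 B], of K] by presburger
  next
    case False
    then show ?thesis using c mem card_insert_disjoint[OF finite_Sep[OF A0 B], of K] by presburger
  qed
qed

text \<open>If a new first letter increases the distance, it is kept; if it decreases the distance,
  \<open>word_exchange\<close> removes a letter from the reduced word of the tail.\<close>

lemma reduced_word:
  assumes "set ss \<subseteq> \<Delta>"
  shows "\<exists>ss'. set ss' \<subseteq> \<Delta> \<and> word ss' = word ss \<and> length ss' = card (Sep A0 (word ss ` A0))"
    and "card (Sep A0 (word ss ` A0)) \<le> length ss"
proof -
  have "(\<exists>ss'. set ss' \<subseteq> \<Delta> \<and> word ss' = word ss \<and> length ss' = card (Sep A0 (word ss ` A0)))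
    \<and> card (Sep A0 (word ss ` A0)) \<le> length ss"
    using assms
  proof (induction ss)
    case Nil
    have "Sep A0 A0 = {}" using separates_self[OF A0] unfolding Sep_def by blast
    then show ?case by simp
  next
    case (Cons s r)
    have s: "s \<in> \<Delta>" and r: "set r \<subseteq> \<Delta>" using Cons.prems(1) by auto
    obtain K where K: "K \<in> walls \<Phi> A0" "K \<in> hyps" "s = hrefl K" using s DeltaE by blast
    let ?B = "word r ` A0"
    have B: "?B \<in> alcs" using symm_alcove[OF word_symm[OF r] A0] .
    obtain r' where r': "set r' \<subseteq> \<Delta>" "word r' = word r" "length r' = card (Sep A0 ?B)"
      and le: "card (Sep A0 ?B) \<le> length r" using Cons.IH[OF r] by blast
    have img: "word (s # r) ` A0 = hrefl K ` ?B" by (simp only: word_Cons K(3) image_comp)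
    show ?case
    proof (cases "separates K A0 ?B")
      case True
      then obtain r'' where r'': "set r'' \<subseteq> \<Delta>" "hrefl K \<circ> word r' = word r''" "Suc (length r'') = length r'"
        using word_exchange[OF r'(1) K(2)] r'(2) by auto
      have c: "Suc (card (Sep A0 (hrefl K ` ?B))) = card (Sep A0 ?B)"
        using card_Sep_reflect[OF K(1) B] True by simp
      have "word r'' = word (s # r)" using r''(2) r'(2) K(3) by simp
      moreover have "length r'' = card (Sep A0 (word (s # r) ` A0))"
        unfolding img using c r''(3) r'(3) by simp
      moreover have "card (Sep A0 (word (s # r) ` A0)) \<le> length (s # r)"
        unfolding img using c le by simp
      ultimately show ?thesis using r''(1) by blast
    next
      case False
      then have c: "card (Sep A0 (hrefl K ` ?B)) = Suc (card (Sep A0 ?B))"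
        using card_Sep_reflect[OF K(1) B] by simp
      have "word (s # r') = word (s # r)" using r'(2) by simp
      moreover have "length (s # r') = card (Sep A0 (word (s # r) ` A0))"
        unfolding img using c r'(3) by simp
      moreover have "card (Sep A0 (word (s # r) ` A0)) \<le> length (s # r)"
        unfolding img using c le by simp
      moreover have "set (s # r') \<subseteq> \<Delta>" using s r'(1) by simp
      ultimately show ?thesis by blast
    qed
  qed
  then show "\<exists>ss'. set ss' \<subseteq> \<Delta> \<and> word ss' = word ss \<and> length ss' = card (Sep A0 (word ss ` A0))"
    "card (Sep A0 (word ss ` A0)) \<le> length ss" by blast+
qed

lemma aff_length_eq:
  assumes "w \<in> Waff \<Phi>"
  shows "aff_length \<Phi> A0 w = alcove_dist \<Phi> A0 (w ` A0)"
  unfolding aff_length_def alcove_dist_eq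
proof (rule Least_equality)
  obtain ss where "set ss \<subseteq> \<Delta>" "w = word ss" using assms unfolding Waff_eq W\<Delta>_def by blast
  then show "\<exists>ss. length ss = card (Sep A0 (w ` A0)) \<and> set ss \<subseteq> \<Delta> \<and> w = word ss"
    using reduced_word(1)[of ss] by auto
next
  fix n assume "\<exists>ss. length ss = n \<and> set ss \<subseteq> \<Delta> \<and> w = word ss"
  then show "card (Sep A0 (w ` A0)) \<le> n" using reduced_word(2) by blast
qed

text \<open>Distance zero leaves only the empty reduced word.\<close>

lemma Waff_free:
  assumes "w \<in> Waff \<Phi>" "w ` A0 = A0"
  shows "w = id"
proof -
  obtain ss where ss: "set ss \<subseteq> \<Delta>" "w = word ss" using assms unfolding Waff_eq W\<Delta>_def by blast
  have "Sep A0 A0 = {}" using separates_self[OF A0] unfolding Sep_def by blast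
  then show ?thesis using reduced_word(1)[OF ss(1)] assms(2) unfolding ss(2)[symmetric] by auto
qed

text \<open>Reduced words turn a fixed distance into a fixed word length over the finite alphabet
  \<open>\<Delta>\<close>. This is the finiteness that lets the displacement attain its
  maximum.\<close>

lemma finite_Waff_dist: "finite {w \<in> Waff \<Phi>. alcove_dist \<Phi> A0 (w ` A0) = n}"
proof -
  have "finite \<Delta>" unfolding Delta_aff_def using finite_walls[OF A0] by simp
  then have "finite (word ` {ss. set ss \<subseteq> \<Delta> \<and> length ss = n})"
    using finite_lists_length_eq by blast
  moreover have "{w \<in> Waff \<Phi>. alcove_dist \<Phi> A0 (w ` A0) = n} \<subseteq> word ` {ss. set ss \<subseteq> \<Delta> \<and> length ss = n}"
  proof
    fix w assume "w \<in> {w \<in> Waff \<Phi>. alcove_dist \<Phi> A0 (w ` A0) = n}"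
    then obtain ss where ss: "set ss \<subseteq> \<Delta>" "w = word ss" "card (Sep A0 (w ` A0)) = n"
      unfolding Waff_eq W\<Delta>_def alcove_dist_eq by blast
    obtain ss' where ss': "set ss' \<subseteq> \<Delta>" "word ss' = word ss" "length ss' = card (Sep A0 (word ss ` A0))"
      using reduced_word(1)[OF ss(1)] by blast
    show "w \<in> word ` {ss. set ss \<subseteq> \<Delta> \<and> length ss = n}"
      by (rule image_eqI[of _ _ ss']) (use ss ss' in simp_all)
  qed
  ultimately show ?thesis by (rule finite_subset[rotated])
qed

text \<open>Otherwise the hyperplane would contain a regular point, whose alcove the reflection
  would preserve; \<open>Waff_free\<close>, transported from the base alcove, would make the
  reflection the identity.\<close>

lemma reflection_in_Waff:
  assumes "\<alpha> \<noteq> 0" "hrefl (ahyp \<alpha> c) \<in> Waff \<Phi>"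
  shows "ahyp \<alpha> c \<in> hyps"
proof (rule ccontr)
  let ?K = "ahyp \<alpha> c"
  assume no: "?K \<notin> hyps"
  have "((- c) / (\<alpha> \<bullet> \<alpha>)) *\<^sub>R \<alpha> \<in> ?K" using assms(1) by simp
  from generic_point_on_hyperplane[OF assms(1) this zero_less_one]
  obtain p where p: "p \<in> ?K" "\<forall>H\<in>hyps. p \<in> H \<longrightarrow> H = ?K" by blast
  then have "p \<in> reg" unfolding reg_def using no by blast
  note A = cell_alcove[OF this] cell_self[OF this]
  have s: "symm (hrefl ?K)" using assms(2) WD_symm unfolding Waff_eq by blast
  have "hrefl ?K p = p" using hrefl_hyperplane(2)[OF assms(1) p(1)] .
  then have "p \<in> hrefl ?K ` cell p" using A(2) by (metis image_eqI)
  then have fixA: "hrefl ?K ` cell p = cell p" using alcove_disjoint[OF symm_alcove[OF s A(1)] A(1)] A(2) by blast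
  obtain g where g: "g \<in> W\<Delta>" "g ` A0 = cell p" using WD_transitive[OF A(1)] by blast
  let ?h = "inv_into UNIV g"
  have hg: "?h \<circ> g = id" "g \<circ> ?h = id" and hA: "?h ` cell p = A0"
    using symm_bij[OF WD_symm[OF g(1)]] unfolding g(2)[symmetric]
    by (simp_all add: bij_is_inj bij_is_surj surj_iff[symmetric] image_inv_f_f)
  let ?w = "?h \<circ> hrefl ?K \<circ> g"
  have "?w \<in> Waff \<Phi>" using assms(2) g(1) WD_inv WD_comp unfolding Waff_eq by blast
  moreover have "?w ` A0 = A0" by (simp only: image_comp[symmetric] g(2) fixA hA)
  ultimately have "?w = id" by (rule Waff_free)
  then have "g \<circ> ?w \<circ> ?h = id" using hg by simp
  moreover have "g \<circ> ?w \<circ> ?h = (g \<circ> ?h) \<circ> hrefl ?K \<circ> (g \<circ> ?h)" by (simp add: comp_assoc)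
  ultimately have "hrefl ?K = id" unfolding hg by simp
  then show False using hrefl_hyperplane(5)[OF assms(1)] by blast
qed

text \<open>Normalizing \<open>Waff\<close> is a condition on group elements, not on hyperplanes.
  Conjugating the reflection in H gives the reflection in f(H), and
  \<open>reflection_in_Waff\<close> places f(H) in the arrangement; the inverse is treated likewise
  to obtain all hyperplanes.\<close>

lemma normalizer_symm:
  assumes f: "f \<in> carrier (aff_normalizer \<Phi>)" "isom f"
  shows "symm f"
proof -
  let ?g = "inv_into UNIV f"
  have g: "isom ?g" using f(2) by (rule isom_inv)
  have fg: "f \<circ> ?g = id" "?g \<circ> f = id" using isom_bij[OF f(2)]
    by (simp_all add: bij_is_inj bij_is_surj surj_iff[symmetric])
  have norm: "{f \<circ> w \<circ> ?g | w. w \<in> Waff \<Phi>} = Waff \<Phi>"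
    using f(1) inv_aff_group[OF isom_aff_group[OF f(2)]] unfolding aff_normalizer_def by simp
  have hyp: "h ` H \<in> hyps" if h: "isom h" and H: "H \<in> hyps" and mem: "hrefl (h ` H) \<in> Waff \<Phi>" for h H
  proof -
    obtain \<alpha> k where a: "\<alpha> \<noteq> 0" "H = ahyp \<alpha> (of_int k)" using H hypsE by blast
    obtain L b where L: "orthogonal_transformation L" "h = (\<lambda>x. L x + b)" using h unfolding isom_def by blast
    have "h ` H = ahyp (L \<alpha>) (of_int k - L \<alpha> \<bullet> b)" "L \<alpha> \<noteq> 0"
      using isom_ahyp(1,3)[OF L] a by blast+
    then show ?thesis using mem reflection_in_Waff by simp
  qed
  have conj: "hrefl (h ` H) \<circ> h = h \<circ> hrefl H" if h: "isom h" and H: "H \<in> hyps" for h H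
  proof -
    obtain \<alpha> k where a: "\<alpha> \<noteq> 0" "H = ahyp \<alpha> (of_int k)" using H hypsE by blast
    show ?thesis using isom_hrefl[OF h a(1)] unfolding a(2) by (simp add: fun_eq_iff)
  qed
  have W: "hrefl H \<in> Waff \<Phi>" if "H \<in> hyps" for H using hrefl_WD[OF that] unfolding Waff_eq .
  have 1: "f ` H \<in> hyps" if H: "H \<in> hyps" for H
  proof (rule hyp[OF f(2) H])
    have "hrefl (f ` H) = hrefl (f ` H) \<circ> f \<circ> ?g" using fg(1) by (simp add: comp_assoc)
    also have "\<dots> = f \<circ> hrefl H \<circ> ?g" unfolding conj[OF f(2) H] ..
    finally show "hrefl (f ` H) \<in> Waff \<Phi>" using norm W[OF H] by blast
  qed
  have 2: "?g ` H \<in> hyps" if H: "H \<in> hyps" for H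
  proof (rule hyp[OF g H])
    obtain w where w: "w \<in> Waff \<Phi>" "hrefl H = f \<circ> w \<circ> ?g" using norm W[OF H] by blast
    have "hrefl (?g ` H) = hrefl (?g ` H) \<circ> ?g \<circ> f" using fg(2) by (simp add: comp_assoc)
    also have "\<dots> = ?g \<circ> hrefl H \<circ> f" unfolding conj[OF g H] ..
    also have "\<dots> = (?g \<circ> f) \<circ> w \<circ> (?g \<circ> f)" unfolding w(2) by (simp add: comp_assoc)
    also have "\<dots> = w" unfolding fg(2) by simp
    finally show "hrefl (?g ` H) \<in> Waff \<Phi>" using w(1) by simp
  qed
  have "f ` ?g ` H = H" for H using fg(1) by (metis image_comp image_id id_apply)
  then have "(\<lambda>H. f ` H) ` hyps = hyps" using 1 2 by (metis (no_types, lifting) image_eqI image_subsetI subsetI equalityI)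
  then show ?thesis using f(2) unfolding symm_def by blast
qed

end

section \<open>Quasi-Coxeter groups\<close>

sublocale quasi_coxeter \<subseteq> based_root_sys \<Phi> A0
  using reduced base_alcove(1) unfolding reduced_root_system_def by unfold_locales auto

section \<open>Distance under wall crossings and level steps\<close>

context root_sys
begin

lemma dist_sym: "alcove_dist \<Phi> A B = alcove_dist \<Phi> B A"
  unfolding alcove_dist_eq Sep_def using separates_sym by metis

lemma dist_cross_Suc:
  assumes A: "A \<in> alcs" and H: "H \<in> walls \<Phi> A" and B: "B \<in> alcs" and "\<not> separates H A B"
  shows "alcove_dist \<Phi> (hrefl H ` A) B = Suc (alcove_dist \<Phi> A B)"
proof -
  have "Sep (hrefl H ` A) B = insert H (Sep A B)"
    unfolding Sep_def using separates_cross[OF A H B] wall_hyp[OF H] assms(4) by auto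
  moreover have "H \<notin> Sep A B" unfolding Sep_def using assms(4) by blast
  ultimately show ?thesis using finite_Sep[OF A B] by (simp add: alcove_dist_eq)
qed

text \<open>The two crossings toggle H and K in \<open>Sep\<close>. As exactly one of them separates
  A from B, one leaves and the other enters.\<close>

lemma dist_cross_both:
  assumes A: "A \<in> alcs" and H: "H \<in> walls \<Phi> A" and B: "B \<in> alcs" and K: "K \<in> walls \<Phi> B"
    and one: "separates H A B \<noteq> separates K A B"
  shows "alcove_dist \<Phi> (hrefl H ` A) (hrefl K ` B) = alcove_dist \<Phi> A B"
proof -
  note Hh = wall_hyp[OF H] and Kh = wall_hyp[OF K]
  let ?A' = "hrefl H ` A" and ?B' = "hrefl K ` B"
  have B': "?B' \<in> alcs" using symm_alcove[OF hrefl_symm[OF Kh] B] .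
  have sep: "separates G ?A' ?B' \<longleftrightarrow> (G = H) \<noteq> ((G = K) \<noteq> separates G A B)" if G: "G \<in> hyps" for G
    using separates_cross[OF A H B' G] separates_cross[OF B K A G] separates_sym[of G] by metis
  have swap: "card (insert P (S - {Q})) = card S" if "finite S" "Q \<in> S" "P \<notin> S" for P Q :: "'a set" and S
    using that by (metis DiffD1 card_insert_disjoint card_Suc_Diff1 finite_Diff)
  show ?thesis
  proof (cases "separates H A B")
    case True
    then have "Sep ?A' ?B' = insert K (Sep A B - {H})"
      unfolding Sep_def using sep Hh Kh one by auto
    moreover have "H \<in> Sep A B" "K \<notin> Sep A B" unfolding Sep_def using True one Hh by auto
    ultimately show ?thesis unfolding alcove_dist_eq using swap[OF finite_Sep[OF A B]] by simp
  next
    case False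
    then have "Sep ?A' ?B' = insert H (Sep A B - {K})"
      unfolding Sep_def using sep Hh Kh one by auto
    moreover have "K \<in> Sep A B" "H \<notin> Sep A B" unfolding Sep_def using False one Kh by auto
    ultimately show ?thesis unfolding alcove_dist_eq using swap[OF finite_Sep[OF A B]] by simp
  qed
qed

lemma hrefl_fixed_iff:
  assumes "H \<in> hyps"
  shows "hrefl H x = x \<longleftrightarrow> x \<in> H"
proof -
  obtain \<alpha> k where a: "\<alpha> \<noteq> 0" "H = ahyp \<alpha> (of_int k)" using assms hypsE by blast
  have "\<alpha> \<bullet> hrefl H x + of_int k = - (\<alpha> \<bullet> x + of_int k)"
    using hrefl_hyperplane(1)[OF a(1)] unfolding a(2) .
  then have "hrefl H x = x \<Longrightarrow> x \<in> H" unfolding a(2) mem_ahyp by simp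
  then show ?thesis using hrefl_fixes[OF assms] by blast
qed

text \<open>For \<open>\<phi>\<close> the action of an element of the quasi-Coxeter group, this is one step of a
  lateral conjugation.\<close>

definition level_step :: "('a \<Rightarrow> 'a) \<Rightarrow> 'a set \<Rightarrow> 'a set \<Rightarrow> bool" where
  "level_step \<phi> A B \<longleftrightarrow> (\<exists>H\<in>walls \<Phi> A. B = hrefl H ` A \<and>
     alcove_dist \<Phi> B (\<phi> ` B) = alcove_dist \<Phi> A (\<phi> ` A))"

lemma level_steps_alcove:
  assumes "(level_step \<phi>)\<^sup>*\<^sup>* A B" "A \<in> alcs"
  shows "B \<in> alcs" "alcove_dist \<Phi> B (\<phi> ` B) = alcove_dist \<Phi> A (\<phi> ` A)"
proof -
  have "B \<in> alcs \<and> alcove_dist \<Phi> B (\<phi> ` B) = alcove_dist \<Phi> A (\<phi> ` A)"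
    using assms
  proof (induction rule: rtranclp_induct)
    case base
    then show ?case by simp
  next
    case (step B C)
    then obtain H where H: "H \<in> walls \<Phi> B" "C = hrefl H ` B" unfolding level_step_def by blast
    have "C \<in> alcs" using symm_alcove[OF hrefl_symm[OF wall_hyp[OF H(1)]]] step H(2) by blast
    then show ?case using step unfolding level_step_def by auto
  qed
  then show "B \<in> alcs" "alcove_dist \<Phi> B (\<phi> ` B) = alcove_dist \<Phi> A (\<phi> ` A)" by blast+
qed

text \<open>Assumption \<open>up\<close> says that the derivative of \<open>\<lambda>x. (norm (\<phi> x - x))\<^sup>2\<close> at \<open>q\<close> in the outward
  direction \<open>\<alpha>\<close> is positive. If \<open>H\<close> and \<open>\<phi> ` H\<close> both separated \<open>B\<close> from \<open>\<phi> ` B\<close>, or if they coincided,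
  it would be nonpositive.\<close>

lemma uphill_level_step:
  assumes L: "orthogonal_transformation L" "\<phi> = (\<lambda>x. L x + b)" and \<phi>: "symm \<phi>"
    and B: "B \<in> alcs" and a: "\<alpha> \<in> \<Phi>" "B \<subseteq> {z. \<alpha> \<bullet> z + of_int k < 0}"
    and q: "panel_point B (ahyp \<alpha> (of_int k)) q"
    and up: "(L \<alpha> - \<alpha>) \<bullet> (\<phi> q - q) > 0"
    and stuck: "\<And>H. H \<in> walls \<Phi> B \<Longrightarrow> \<phi> ` H \<noteq> H \<Longrightarrow> separates H B (\<phi> ` B) \<or> separates (\<phi> ` H) B (\<phi> ` B)"
  shows "level_step \<phi> B (hrefl (ahyp \<alpha> (of_int k)) ` B)"
proof -
  let ?H = "ahyp \<alpha> (of_int k)"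
  define c where "c = of_int k - L \<alpha> \<bullet> b"
  have nz: "\<alpha> \<noteq> 0" "L \<alpha> \<noteq> 0" using root_nonzero[OF a(1)] isom_ahyp(3)[OF L] by blast+
  have im: "\<phi> ` ?H = ahyp (L \<alpha>) c" using isom_ahyp(1)[OF L] unfolding c_def .
  have val: "L \<alpha> \<bullet> \<phi> x + c = \<alpha> \<bullet> x + of_int k" for x using isom_ahyp(2)[OF L] unfolding c_def .
  have H: "?H \<in> hyps" "q \<in> closure B" "\<alpha> \<bullet> q + of_int k = 0" using q unfolding panel_point_def by auto
  have wall: "?H \<in> walls \<Phi> B" using panel_point_wall[OF B q] .
  have \<phi>q: "\<phi> q \<in> closure (\<phi> ` B)" using H(2) isom_closure[OF symm_isom[OF \<phi>], of B] by blast
  obtain x where x: "x \<in> B" using alcove_facts(1)[OF B] by blast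
  have xneg: "\<alpha> \<bullet> x + of_int k < 0" "L \<alpha> \<bullet> \<phi> x + c < 0" using x a(2) val[of x] by auto
  have up': "L \<alpha> \<bullet> (\<phi> q - q) - \<alpha> \<bullet> (\<phi> q - q) > 0" using up by (simp add: inner_diff_left)
  have ne: "\<phi> ` ?H \<noteq> ?H"
  proof
    assume eq: "\<phi> ` ?H = ?H"
    have "q \<in> ?H" using H(3) by simp
    then have "\<phi> q \<in> ?H" "q \<in> \<phi> ` ?H" using eq by blast+
    then have "\<alpha> \<bullet> (\<phi> q - q) = 0" "L \<alpha> \<bullet> (\<phi> q - q) = 0"
      using H(3) val[of q] unfolding im by (auto simp: inner_diff_right)
    then show False using up' by simp
  qed
  have "\<not> (separates ?H B (\<phi> ` B) \<and> separates (\<phi> ` ?H) B (\<phi> ` B))"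
  proof
    assume s: "separates ?H B (\<phi> ` B) \<and> separates (\<phi> ` ?H) B (\<phi> ` B)"
    have 1: "\<phi> ` B \<subseteq> {z. \<alpha> \<bullet> z + of_int k > 0}"
      using s x xneg(1) unfolding separates_halfspaces[OF nz(1)] by fastforce
    have 2: "B \<subseteq> {z. L \<alpha> \<bullet> z + c > 0}"
      using s x xneg(2) unfolding im separates_halfspaces[OF nz(2)] by fastforce
    have "\<alpha> \<bullet> (\<phi> q - q) \<ge> 0"
      using closure_alcove_sign(1)[OF \<phi>q 1] H(3) by (simp add: inner_diff_right)
    moreover have "L \<alpha> \<bullet> (\<phi> q - q) \<le> 0"
      using closure_alcove_sign(1)[OF H(2) 2] val[of q] H(3) by (simp add: inner_diff_right)
    ultimately show False using up' by linarith
  qed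
  then have one: "separates ?H B (\<phi> ` B) \<noteq> separates (\<phi> ` ?H) B (\<phi> ` B)"
    using stuck[OF wall ne] by blast
  have "\<phi> ` hrefl ?H ` B = hrefl (\<phi> ` ?H) ` \<phi> ` B"
    using symm_hrefl[OF \<phi> H(1)] by (simp only: image_comp)
  then have "alcove_dist \<Phi> (hrefl ?H ` B) (\<phi> ` hrefl ?H ` B) = alcove_dist \<Phi> B (\<phi> ` B)"
    using dist_cross_both[OF B wall symm_alcove[OF \<phi> B] symm_wall[OF \<phi> B wall] one] by simp
  then show ?thesis unfolding level_step_def using wall by blast
qed

end

section \<open>The action of the quasi-Coxeter group on alcoves\<close>

context quasi_coxeter
begin

abbreviation "WT \<equiv> Wtilde \<Phi> \<Omega> \<psi>"

lemma group_WT: "Group.group WT"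
  using transl_normal by (rule normal.axioms(2))

lemma Omega_group: "Group.group \<Omega>"
  using Omega_comm by (rule comm_group.axioms(2))

lemma psi_carrier: "\<tau> \<in> carrier \<Omega> \<Longrightarrow> \<psi> \<tau> \<in> carrier (aff_normalizer \<Phi>)"
  using psi_hom unfolding hom_def by blast

lemma psi_aff: "\<tau> \<in> carrier \<Omega> \<Longrightarrow> \<psi> \<tau> \<in> carrier aff_group"
  using psi_carrier[of \<tau>] unfolding aff_normalizer_def by simp

lemma psi_bij: "\<tau> \<in> carrier \<Omega> \<Longrightarrow> bij (\<psi> \<tau>)"
  using psi_aff[of \<tau>] mem_aff_group by blast

lemma psi_mult: "\<tau> \<in> carrier \<Omega> \<Longrightarrow> \<sigma> \<in> carrier \<Omega> \<Longrightarrow> \<psi> (\<tau> \<otimes>\<^bsub>\<Omega>\<^esub> \<sigma>) = \<psi> \<tau> \<circ> \<psi> \<sigma>"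
  using psi_hom unfolding hom_def aff_normalizer_def by (simp add: aff_group_def)

lemma psi_one: "\<psi> \<one>\<^bsub>\<Omega>\<^esub> = id"
proof -
  have 1: "\<one>\<^bsub>\<Omega>\<^esub> \<in> carrier \<Omega>" using Omega_group group.is_monoid monoid.one_closed by blast
  have "\<psi> \<one>\<^bsub>\<Omega>\<^esub> \<circ> \<psi> \<one>\<^bsub>\<Omega>\<^esub> = \<psi> \<one>\<^bsub>\<Omega>\<^esub>"
    using psi_mult[OF 1 1] Omega_group 1 by (simp add: group.is_monoid monoid.l_one)
  then have "\<psi> \<one>\<^bsub>\<Omega>\<^esub> (\<psi> \<one>\<^bsub>\<Omega>\<^esub> x) = \<psi> \<one>\<^bsub>\<Omega>\<^esub> x" for x by (metis comp_apply)
  then have "\<psi> \<one>\<^bsub>\<Omega>\<^esub> x = x" for x using bij_is_inj[OF psi_bij[OF 1]] by (simp add: inj_eq)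
  then show ?thesis by (simp add: fun_eq_iff)
qed

lemma mem_WT: "w \<in> carrier WT \<longleftrightarrow> fst w \<in> Waff \<Phi> \<and> snd w \<in> carrier \<Omega>"
  unfolding Wtilde_def by (cases w) simp

lemma act_eq: "act \<psi> w = fst w \<circ> \<psi> (snd w)"
  by (simp add: act_def fun_eq_iff)

lemma mult_WT:
  "fst (x \<otimes>\<^bsub>WT\<^esub> y) = fst x \<circ> (\<psi> (snd x) \<circ> fst y \<circ> inv\<^bsub>aff_group\<^esub> (\<psi> (snd x)))"
  "snd (x \<otimes>\<^bsub>WT\<^esub> y) = snd x \<otimes>\<^bsub>\<Omega>\<^esub> snd y"
  unfolding Wtilde_def by (simp_all add: case_prod_unfold)

lemma act_mult:
  assumes "x \<in> carrier WT" "y \<in> carrier WT"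
  shows "act \<psi> (x \<otimes>\<^bsub>WT\<^esub> y) = act \<psi> x \<circ> act \<psi> y"
proof -
  have t: "snd x \<in> carrier \<Omega>" "snd y \<in> carrier \<Omega>" using assms mem_WT by blast+
  have "inv\<^bsub>aff_group\<^esub> (\<psi> (snd x)) \<circ> \<psi> (snd x) = id"
    using psi_bij[OF t(1)] by (simp add: inv_aff_group[OF psi_aff[OF t(1)]] bij_is_inj)
  then have c: "(inv\<^bsub>aff_group\<^esub> (\<psi> (snd x))) (\<psi> (snd x) z) = z" for z by (metis comp_apply id_apply)
  show ?thesis unfolding act_eq mult_WT psi_mult[OF t] by (simp add: fun_eq_iff c)
qed

lemma WT_closed: "x \<in> carrier WT \<Longrightarrow> y \<in> carrier WT \<Longrightarrow> x \<otimes>\<^bsub>WT\<^esub> y \<in> carrier WT"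
  using group_WT group.is_monoid monoid.m_closed by metis

lemma act_embed: "act \<psi> (embed \<Omega> u) = u"
  by (simp add: act_eq embed_def psi_one)

lemma embed_WT: "u \<in> Waff \<Phi> \<Longrightarrow> embed \<Omega> u \<in> carrier WT"
  using Omega_group by (simp add: mem_WT embed_def group.is_monoid monoid.one_closed)

text \<open>\<Omega> is only assumed to act by affine maps. Writing the element as a translation
  times an element of \<open>Wfin\<close> shows that its action preserves distances.\<close>

lemma act_isom:
  assumes "w \<in> carrier WT"
  shows "isom (act \<psi> w)"
proof -
  have "w \<in> transl \<Phi> \<Omega> \<psi> <#>\<^bsub>WT\<^esub> embed \<Omega> ` Wfin \<Phi> v0" using assms transl_Wfin_prod by simp
  then obtain l u where lu: "l \<in> transl \<Phi> \<Omega> \<psi>" "u \<in> Wfin \<Phi> v0" "w = l \<otimes>\<^bsub>WT\<^esub> embed \<Omega> u"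
    unfolding set_mult_def by blast
  obtain c where c: "l \<in> carrier WT" "\<And>x. act \<psi> l x = x + c" using lu(1) unfolding transl_def by blast
  have u: "u \<in> Waff \<Phi>" using lu(2) unfolding Wfin_def by blast
  have "act \<psi> w = act \<psi> l \<circ> u" unfolding lu(3) act_mult[OF c(1) embed_WT[OF u]] act_embed ..
  moreover have "isom (act \<psi> l)"
    unfolding isom_def by (intro exI[of _ "\<lambda>x. x"] exI[of _ c]) (simp add: fun_eq_iff c(2))
  moreover have "isom u" using u WD_symm symm_isom unfolding Waff_eq by blast
  ultimately show ?thesis using isom_comp by simp
qed

lemma psi_symm:
  assumes t: "\<tau> \<in> carrier \<Omega>"
  shows "symm (\<psi> \<tau>)"
proof (rule normalizer_symm[OF psi_carrier[OF t]])
  have "(id, \<tau>) \<in> carrier WT" using t WD_id by (simp only: mem_WT Waff_eq fst_conv snd_conv simp_thms)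
  then have "isom (act \<psi> (id, \<tau>))" by (rule act_isom)
  then show "isom (\<psi> \<tau>)" by (simp add: act_eq)
qed

lemma act_symm: "w \<in> carrier WT \<Longrightarrow> symm (act \<psi> w)"
  unfolding act_eq mem_WT Waff_eq using WD_symm psi_symm symm_comp by blast

lemma act_A0: "w \<in> carrier WT \<Longrightarrow> act \<psi> w ` A0 = fst w ` A0"
  unfolding act_eq mem_WT by (simp only: image_comp[symmetric] Omega_base)

text \<open>\<open>len\<close> sees only \<open>fst w\<close>, and so does the image of the base
  alcove, because \<Omega> stabilizes it.\<close>

lemma len_eq: "w \<in> carrier WT \<Longrightarrow> len \<Phi> A0 w = alcove_dist \<Phi> A0 (act \<psi> w ` A0)"
  unfolding len_def by (simp only: act_A0) (simp add: mem_WT aff_length_eq)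

text \<open>Pulled back to the base alcove, the alcoves reached from \<open>A\<close> involve only finitely many
  conjugates of \<open>w\<close>, because the length of these conjugates and their component in \<open>\<Omega>\<close> are constant.\<close>

lemma displacement_attains_max:
  assumes w: "w \<in> carrier WT" and A: "A \<in> alcs"
  shows "\<exists>B p. (level_step (act \<psi> w))\<^sup>*\<^sup>* A B \<and> p \<in> closure B \<and>
    (\<forall>C x. (level_step (act \<psi> w))\<^sup>*\<^sup>* A C \<longrightarrow> x \<in> closure C \<longrightarrow>
      norm (act \<psi> w x - x) \<le> norm (act \<psi> w p - p))"
proof -
  define \<phi> where "\<phi> = act \<psi> w"
  define S where "S = {B. (level_step \<phi>)\<^sup>*\<^sup>* A B}"
  define n where "n = alcove_dist \<Phi> A (\<phi> ` A)"
  \<comment> \<open>Conjugates of w by those g that carry A0 to a reached alcove; the intertwining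
    equation expresses the conjugation on the level of actions.\<close>
  define Y where "Y = {y \<in> carrier WT. snd y = snd w \<and> (\<exists>g\<in>W\<Delta>. g ` A0 \<in> S \<and> g \<circ> act \<psi> y = \<phi> \<circ> g)}"
  have S: "B \<in> alcs" "alcove_dist \<Phi> B (\<phi> ` B) = n" if "B \<in> S" for B
    using level_steps_alcove[OF _ A] that unfolding S_def n_def by blast+
  have "Y \<subseteq> {f \<in> Waff \<Phi>. alcove_dist \<Phi> A0 (f ` A0) = n} \<times> {snd w}"
  proof
    fix y assume y: "y \<in> Y"
    then obtain g where g: "g \<in> W\<Delta>" "g ` A0 \<in> S" "g \<circ> act \<psi> y = \<phi> \<circ> g" and yc: "y \<in> carrier WT" "snd y = snd w"
      unfolding Y_def by blast
    have "alcove_dist \<Phi> A0 (fst y ` A0) = alcove_dist \<Phi> (g ` A0) (g ` act \<psi> y ` A0)"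
      unfolding symm_dist[OF WD_symm[OF g(1)]] act_A0[OF yc(1)] ..
    also have "g ` act \<psi> y ` A0 = \<phi> ` g ` A0" using g(3) by (simp only: image_comp)
    finally have "alcove_dist \<Phi> A0 (fst y ` A0) = n" using S(2)[OF g(2)] by simp
    then show "y \<in> {f \<in> Waff \<Phi>. alcove_dist \<Phi> A0 (f ` A0) = n} \<times> {snd w}"
      using yc mem_WT by (simp add: mem_Times_iff)
  qed
  then have fin: "finite Y" using finite_Waff_dist finite_subset by blast
  \<comment> \<open>All displacement lengths on closures of reached alcoves, rewritten over
    \<open>closure A0\<close> as a finite union of compact sets. \<open>inK\<close> and
    \<open>fromK\<close> are the two inclusions.\<close>
  define K where "K = (\<Union>y\<in>Y. (\<lambda>x. norm (act \<psi> y x - x)) ` closure A0)"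
  have disp: "norm (\<phi> (g x) - g x) = norm (act \<psi> y x - x)" if "g \<in> W\<Delta>" "g \<circ> act \<psi> y = \<phi> \<circ> g" for g y x
  proof -
    have "\<phi> (g x) = g (act \<psi> y x)" using that(2) by (metis comp_apply)
    then show ?thesis using isom_norm[OF symm_isom[OF WD_symm[OF that(1)]]] by simp
  qed
  have inK: "norm (\<phi> x - x) \<in> K" if B: "B \<in> S" and x: "x \<in> closure B" for B x
  proof -
    obtain g where g: "g \<in> W\<Delta>" "g ` A0 = B" using WD_transitive[OF S(1)[OF B]] by blast
    let ?h = "inv_into UNIV g"
    have gh: "g \<circ> ?h = id" using symm_bij[OF WD_symm[OF g(1)]] bij_is_surj surj_iff by blast
    have e: "embed \<Omega> ?h \<in> carrier WT" "embed \<Omega> g \<in> carrier WT"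
      using g(1) WD_inv embed_WT unfolding Waff_eq by blast+
    let ?y = "embed \<Omega> ?h \<otimes>\<^bsub>WT\<^esub> w \<otimes>\<^bsub>WT\<^esub> embed \<Omega> g"
    have y: "?y \<in> carrier WT" using e w WT_closed by blast
    have ay: "act \<psi> ?y = ?h \<circ> \<phi> \<circ> g"
      unfolding act_mult[OF WT_closed[OF e(1) w] e(2)] act_mult[OF e(1) w] act_embed \<phi>_def ..
    have "g \<circ> act \<psi> ?y = (g \<circ> ?h) \<circ> \<phi> \<circ> g" unfolding ay by (simp only: comp_assoc)
    then have conj: "g \<circ> act \<psi> ?y = \<phi> \<circ> g" unfolding gh by simp
    have "snd ?y = snd w"
      using w Omega_group unfolding mult_WT mem_WT by (simp add: embed_def group.is_monoid monoid.l_one monoid.r_one)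
    then have yY: "?y \<in> Y" unfolding Y_def using y conj g B by blast
    obtain x0 where x0: "x0 \<in> closure A0" "x = g x0"
      using x isom_closure[OF symm_isom[OF WD_symm[OF g(1)]], of A0] unfolding g(2) by blast
    have "norm (\<phi> x - x) = norm (act \<psi> ?y x0 - x0)" unfolding x0(2) by (rule disp[OF g(1) conj])
    then show ?thesis unfolding K_def using yY x0(1) by blast
  qed
  have fromK: "\<exists>B\<in>S. \<exists>x\<in>closure B. r = norm (\<phi> x - x)" if r: "r \<in> K" for r
  proof -
    obtain y x where yx: "y \<in> Y" "x \<in> closure A0" "r = norm (act \<psi> y x - x)" using r unfolding K_def by blast
    then obtain g where g: "g \<in> W\<Delta>" "g ` A0 \<in> S" "g \<circ> act \<psi> y = \<phi> \<circ> g" unfolding Y_def by blast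
    have "g x \<in> closure (g ` A0)" using yx(2) isom_closure[OF symm_isom[OF WD_symm[OF g(1)]], of A0] by blast
    moreover have "r = norm (\<phi> (g x) - g x)" using disp[OF g(1,3), of x] yx(3) by simp
    ultimately show ?thesis using g(2) by blast
  qed
  have "compact ((\<lambda>x. norm (act \<psi> y x - x)) ` closure A0)" if "y \<in> Y" for y
  proof (rule compact_continuous_image)
    have "isom (act \<psi> y)" using that act_isom unfolding Y_def by blast
    then show "continuous_on (closure A0) (\<lambda>x. norm (act \<psi> y x - x))"
      by (intro continuous_on_norm continuous_on_diff isom_continuous continuous_on_id)
    show "compact (closure A0)" using alcove_bounded[OF A0] by (simp add: compact_closure)
  qed
  then have "compact K" unfolding K_def using fin by (intro compact_UN) auto
  moreover obtain x where "x \<in> A" using alcove_facts(1)[OF A] by blast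
  then have "norm (\<phi> x - x) \<in> K" using inK[of A x] closure_subset unfolding S_def by blast
  ultimately obtain r where r: "r \<in> K" "\<forall>s\<in>K. s \<le> r" using compact_attains_sup[of K] by blast
  obtain B p where "B \<in> S" "p \<in> closure B" "r = norm (\<phi> p - p)" using fromK[OF r(1)] by blast
  then show ?thesis using r(2) inK unfolding S_def \<phi>_def[symmetric] by blast
qed

theorem level_steps_reach_diamond:
  assumes w: "w \<in> carrier WT" "w \<notin> transl \<Phi> \<Omega> \<psi>" and A: "A \<in> alcs"
  shows "\<exists>B. (level_step (act \<psi> w))\<^sup>*\<^sup>* A B \<and> (\<exists>H\<in>walls \<Phi> B. act \<psi> w ` H \<noteq> H \<and>
    \<not> separates H B (act \<psi> w ` B) \<and> \<not> separates (act \<psi> w ` H) B (act \<psi> w ` B))"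
proof (rule ccontr)
  assume no: "\<not> ?thesis"
  define \<phi> where "\<phi> = act \<psi> w"
  define S where "S = {B. (level_step \<phi>)\<^sup>*\<^sup>* A B}"
  have \<phi>: "symm \<phi>" unfolding \<phi>_def by (rule act_symm[OF w(1)])
  obtain L b where L: "orthogonal_transformation L" "\<phi> = (\<lambda>x. L x + b)"
    using symm_isom[OF \<phi>] unfolding isom_def by blast
  have lin: "linear L" using L(1) orthogonal_transformation_linear by blast
  have S: "B \<in> alcs" if "B \<in> S" for B
    using level_steps_alcove(1)[OF _ A] that unfolding S_def by blast
  have stuck: "separates H B (\<phi> ` B) \<or> separates (\<phi> ` H) B (\<phi> ` B)"
    if "B \<in> S" "H \<in> walls \<Phi> B" "\<phi> ` H \<noteq> H" for B H
    using no that unfolding S_def \<phi>_def by blast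
  define M where "M = inv_into UNIV L"
  have M: "linear M" "L (M y) = y" for y
    using orthogonal_transformation_inv[OF L(1)] orthogonal_transformation_surj[OF L(1)]
    unfolding M_def by (simp_all add: orthogonal_transformation_linear surj_f_inv_f)
  \<comment> \<open>Half the gradient of D: \<open>M\<close>, the inverse of the orthogonal map
    \<open>L\<close>, is its adjoint.\<close>
  define grad where "grad x = M (\<phi> x - x) - (\<phi> x - x)" for x
  have grad: "v \<bullet> grad x = (L v - v) \<bullet> (\<phi> x - x)" for v x
  proof -
    have "L v \<bullet> (\<phi> x - x) = L v \<bullet> L (M (\<phi> x - x))" by (simp add: M(2))
    also have "\<dots> = v \<bullet> M (\<phi> x - x)" using L(1) unfolding orthogonal_transformation_def by blast
    finally show ?thesis by (simp add: grad_def inner_diff_right inner_diff_left)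
  qed
  have cont\<phi>: "continuous_on V \<phi>" for V using isom_continuous[OF symm_isom[OF \<phi>]] .
  have contM: "continuous_on V M" for V using M(1) linear_continuous_on linear_linear by blast
  have contg: "continuous_on UNIV grad"
    unfolding grad_def
    by (intro continuous_on_diff continuous_on_compose2[OF contM[of UNIV]] cont\<phi> continuous_on_id subset_UNIV)
  \<comment> \<open>D is quadratic, so the expansion is exact; its second-order term is a square,
    which is the convexity of D.\<close>
  have expand: "(norm (\<phi> (x + v) - (x + v)))\<^sup>2 = (norm (\<phi> x - x))\<^sup>2 + 2 * (v \<bullet> grad x) + (norm (L v - v))\<^sup>2" for x v
  proof -
    have "\<phi> (x + v) - (x + v) = (\<phi> x - x) + (L v - v)" by (simp add: L(2) linear_add[OF lin])
    moreover have "(norm (y + z))\<^sup>2 = (norm y)\<^sup>2 + 2 * (z \<bullet> y) + (norm z)\<^sup>2" for y z :: 'a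
      by (simp add: power2_norm_eq_inner inner_add_left inner_add_right inner_commute)
    ultimately show ?thesis unfolding grad by (simp only:)
  qed
  obtain B p where B: "B \<in> S" and p: "p \<in> closure B"
    and max: "\<And>C x. C \<in> S \<Longrightarrow> x \<in> closure C \<Longrightarrow> norm (\<phi> x - x) \<le> norm (\<phi> p - p)"
    using displacement_attains_max[OF w(1) A] unfolding S_def \<phi>_def by blast
  define u where "u = grad p"
  \<comment> \<open>With a zero gradient, maximality on B makes the square term vanish for every v
    with p + v in B. As B is open, L is then the identity and \<phi> a translation.\<close>
  have "u \<noteq> 0"
  proof
    assume u0: "u = 0"
    have fixv: "L v - v = 0" if "p + v \<in> B" for v
    proof -
      have "p + v \<in> closure B" using that closure_subset by blast
      then have "(norm (\<phi> (p + v) - (p + v)))\<^sup>2 \<le> (norm (\<phi> p - p))\<^sup>2" using max[OF B] by simp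
      then have "(norm (L v - v))\<^sup>2 \<le> 0" unfolding expand using u0 by (simp add: u_def)
      then show ?thesis by simp
    qed
    obtain x where x: "x \<in> B" using alcove_facts(1)[OF S[OF B]] by blast
    obtain e where e: "e > 0" "ball x e \<subseteq> B" using alcove_facts(2)[OF S[OF B]] x by (rule openE)
    have "L v = v" for v
    proof (cases "v = 0")
      case True
      then show ?thesis using linear_0[OF lin] by simp
    next
      case False
      define c where "c = e / (2 * norm v)"
      have c: "c > 0" "c * norm v < e" using False e(1) by (auto simp: c_def)
      have "dist x (x + c *\<^sub>R v) < e" using c by (simp add: dist_norm)
      then have "x + c *\<^sub>R v \<in> B" using e(2) by auto
      \<comment> \<open>p itself may lie outside B, so \<open>fixv\<close> is applied to two
        displacements from p that differ by c v.\<close>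
      then have "L (x - p + c *\<^sub>R v) - (x - p + c *\<^sub>R v) = 0" by (intro fixv) (simp add: algebra_simps)
      moreover have "L (x - p) - (x - p) = 0" using x by (intro fixv) simp
      ultimately have "c *\<^sub>R L v = c *\<^sub>R v" by (simp add: linear_add[OF lin] linear_cmul[OF lin])
      then show ?thesis using c(1) by simp
    qed
    then have "\<forall>x. act \<psi> w x = x + b" using L(2) unfolding \<phi>_def by simp
    then show False using w unfolding transl_def by blast
  qed
  then have un: "norm u > 0" by simp
  \<comment> \<open>The outward normals of walls that can be crossed in direction u. Being finitely
    many, they remain uphill on a whole neighbourhood \<open>U\<close> of p.\<close>
  define \<Psi> where "\<Psi> = {\<alpha> \<in> \<Phi>. \<alpha> \<bullet> u > 0}"
  define U where "U = (\<Inter>\<alpha>\<in>\<Psi>. grad -` {z. \<alpha> \<bullet> z > 0})"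
  have "open U"
    unfolding U_def \<Psi>_def using finite_roots
    by (intro open_INT ballI open_vimage contg open_halfspace_gt) simp
  moreover have "p \<in> U" unfolding U_def \<Psi>_def u_def by auto
  ultimately obtain r where r: "r > 0" "ball p r \<subseteq> U" by (rule openE)
  \<comment> \<open>A segment of length r/4 starting within r/2 of p stays in
    \<open>ball p r\<close>.\<close>
  define T where "T = r / (4 * norm u)"
  have T: "T > 0" "T * norm u < r / 2" using r(1) un by (auto simp: T_def)
  \<comment> \<open>Starting points whose endpoints beat the maximum. The set is open and contains
    p, a point of \<open>closure B\<close>, so it meets B and leaves room for a generic start inside
    B.\<close>
  define N where "N = ball p (r / 2) \<inter> {x. norm (\<phi> (x + T *\<^sub>R u) - (x + T *\<^sub>R u)) > norm (\<phi> p - p)}"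
  have "continuous_on UNIV (\<lambda>x. norm (\<phi> (x + T *\<^sub>R u) - (x + T *\<^sub>R u)))"
    by (intro continuous_on_norm continuous_on_diff continuous_on_add continuous_on_id continuous_on_const
        continuous_on_compose2[OF cont\<phi>[of UNIV]] subset_UNIV)
  then have "open ((\<lambda>x. norm (\<phi> (x + T *\<^sub>R u) - (x + T *\<^sub>R u))) -` {norm (\<phi> p - p)<..})"
    by (intro open_vimage open_greaterThan)
  moreover have "N = ball p (r / 2) \<inter> (\<lambda>x. norm (\<phi> (x + T *\<^sub>R u) - (x + T *\<^sub>R u))) -` {norm (\<phi> p - p)<..}"
    unfolding N_def by auto
  ultimately have "open N" by (simp add: open_Int)
  have "(norm (\<phi> p - p))\<^sup>2 < (norm (\<phi> (p + T *\<^sub>R u) - (p + T *\<^sub>R u)))\<^sup>2"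
  proof -
    have "(T *\<^sub>R u) \<bullet> grad p > 0" using T(1) \<open>u \<noteq> 0\<close> unfolding u_def[symmetric] by simp
    then show ?thesis unfolding expand using zero_le_power2[of "norm (L (T *\<^sub>R u) - T *\<^sub>R u)"] by linarith
  qed
  then have "norm (\<phi> p - p) < norm (\<phi> (p + T *\<^sub>R u) - (p + T *\<^sub>R u))"
    by (rule power2_less_imp_less) simp
  then have "p \<in> N" unfolding N_def using r(1) by simp
  then have "N \<inter> B \<noteq> {}" using p open_Int_closure_eq_empty[OF \<open>open N\<close>] by blast
  then obtain x where x: "x \<in> N \<inter> B" "generic_line x u" "x + T *\<^sub>R u \<in> reg"
    using exists_generic_line[of "N \<inter> B" u T] \<open>open N\<close> alcove_facts(2)[OF S[OF B]] by blast
  have near: "x + t *\<^sub>R u \<in> U" if "0 \<le> t" "t \<le> T" for t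
  proof -
    have "norm ((x - p) + t *\<^sub>R u) \<le> norm (x - p) + t * norm u"
      using norm_triangle_ineq[of "x - p" "t *\<^sub>R u"] that(1) by simp
    also have "\<dots> \<le> norm (x - p) + T * norm u" using that(2) by (simp add: mult_right_mono)
    also have "\<dots> < r / 2 + r / 2"
      using x(1) T(2) unfolding N_def by (intro add_strict_mono) (auto simp: dist_norm norm_minus_commute)
    finally have "dist p (x + t *\<^sub>R u) < r"
      unfolding dist_commute[of p] by (simp add: dist_norm algebra_simps)
    then show ?thesis using r(2) by auto
  qed
  have "cell (x + T *\<^sub>R u) \<in> S"
  proof (rule generic_line_stays[OF x(2,3)])
    show "S \<subseteq> alcs" using S by blast
    show "B \<in> S" by (rule B)
    show "x + 0 *\<^sub>R u \<in> B" using x(1) by simp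
    show "0 \<le> T" using T(1) by simp
    fix C t \<alpha> k
    assume C: "C \<in> S" "0 \<le> t" "t \<le> T" and a: "\<alpha> \<in> \<Phi>" "\<alpha> \<bullet> u > 0" "C \<subseteq> {z. \<alpha> \<bullet> z + of_int k < 0}"
      and pp: "panel_point C (ahyp \<alpha> (of_int k)) (x + t *\<^sub>R u)"
    have "\<alpha> \<bullet> grad (x + t *\<^sub>R u) > 0" using near[OF C(2,3)] a(1,2) unfolding U_def \<Psi>_def by auto
    then have "(L \<alpha> - \<alpha>) \<bullet> (\<phi> (x + t *\<^sub>R u) - (x + t *\<^sub>R u)) > 0" unfolding grad .
    then have "level_step \<phi> C (hrefl (ahyp \<alpha> (of_int k)) ` C)"
      by (rule uphill_level_step[OF L \<phi> S[OF C(1)] a(1,3) pp]) (rule stuck[OF C(1)])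
    then show "hrefl (ahyp \<alpha> (of_int k)) ` C \<in> S" using C(1) unfolding S_def by simp
  qed simp
  moreover have "x + T *\<^sub>R u \<in> closure (cell (x + T *\<^sub>R u))"
    using cell_self[OF x(3)] closure_subset by blast
  ultimately show False using max x(1) unfolding N_def by (metis (no_types, lifting) IntD1 IntD2 mem_Collect_eq not_le)
qed

section \<open>The Diamond Property for pairs\<close>

lemma lat_conj_pair_refl: "lat_conj_pair \<Phi> A0 (M, N) (M, N)"
  unfolding lat_conj_pair_def
  unfolding case_prod_conv
  by (rule exI[of _ "0::nat"], rule exI[of _ "\<lambda>_. id"], rule exI[of _ "\<lambda>_. M"], rule exI[of _ "\<lambda>_. N"]) simp

lemma lat_conj_pair_step:
  assumes "lat_conj_pair \<Phi> A0 P (M, N)" "s \<in> \<Delta>"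
    and "alcove_dist \<Phi> (alc (move \<Phi> A0 M s)) (alc (move \<Phi> A0 N s)) = alcove_dist \<Phi> (alc M) (alc N)"
  shows "lat_conj_pair \<Phi> A0 P (move \<Phi> A0 M s, move \<Phi> A0 N s)"
proof -
  obtain M0 N0 where P: "P = (M0, N0)" by (cases P)
  obtain n :: nat and t Ms Ns where
    t: "\<forall>i\<in>{1..n}. t i \<in> \<Delta>" "Ms 0 = M0" "Ns 0 = N0"
      "\<forall>i\<in>{1..n}. Ms i = move \<Phi> A0 (Ms (i - 1)) (t i) \<and> Ns i = move \<Phi> A0 (Ns (i - 1)) (t i)"
      "Ms n = M" "Ns n = N"
      "\<forall>i\<le>n. alcove_dist \<Phi> (alc (Ms i)) (alc (Ns i)) = alcove_dist \<Phi> (alc M0) (alc N0)"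
    using assms(1) unfolding lat_conj_pair_def P by auto
  define t' Ms' Ns' where "t' = t(Suc n := s)" and "Ms' = Ms(Suc n := move \<Phi> A0 M s)"
    and "Ns' = Ns(Suc n := move \<Phi> A0 N s)"
  have "\<forall>i\<in>{1..Suc n}. t' i \<in> \<Delta>" using t(1) assms(2) by (auto simp: t'_def)
  moreover have "Ms' 0 = M0" "Ns' 0 = N0" using t(2,3) by (simp_all add: Ms'_def Ns'_def)
  moreover have "\<forall>i\<in>{1..Suc n}. Ms' i = move \<Phi> A0 (Ms' (i - 1)) (t' i) \<and> Ns' i = move \<Phi> A0 (Ns' (i - 1)) (t' i)"
  proof
    fix i assume i: "i \<in> {1..Suc n}"
    show "Ms' i = move \<Phi> A0 (Ms' (i - 1)) (t' i) \<and> Ns' i = move \<Phi> A0 (Ns' (i - 1)) (t' i)"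
    proof (cases "i = Suc n")
      case True
      then show ?thesis using t(5,6) by (simp add: Ms'_def Ns'_def t'_def)
    next
      case False
      then have "i \<in> {1..n}" "i - 1 \<noteq> Suc n" using i by auto
      then show ?thesis using t(4) False by (simp add: Ms'_def Ns'_def t'_def)
    qed
  qed
  moreover have "Ms' (Suc n) = move \<Phi> A0 M s" "Ns' (Suc n) = move \<Phi> A0 N s" by (simp_all add: Ms'_def Ns'_def)
  moreover have "\<forall>i\<le>Suc n. alcove_dist \<Phi> (alc (Ms' i)) (alc (Ns' i)) = alcove_dist \<Phi> (alc M0) (alc N0)"
    using t(5-7) assms(3) by (auto simp: Ms'_def Ns'_def le_Suc_eq)
  ultimately show ?thesis unfolding lat_conj_pair_def P by blast
qed

text \<open>The invariant carried along a lateral conjugation: it guarantees that each wall of the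
  current alcove is hit by some label.\<close>

definition labeled :: "'a marked \<Rightarrow> bool" where
  "labeled M \<longleftrightarrow> alc M \<in> alcs \<and> bij_betw (lab M) \<Delta> (walls \<Phi> (alc M))"

lemma labeled_transport:
  assumes "symm f" "labeled M"
  shows "labeled (transport \<Phi> A0 f M)"
proof -
  have A: "alc M \<in> alcs" and l: "bij_betw (lab M) \<Delta> (walls \<Phi> (alc M))"
    using assms(2) unfolding labeled_def by auto
  have inj: "inj f" and surj: "f ` inv_into UNIV f ` H = H" for H
    using symm_bij[OF assms(1)] by (auto simp: bij_is_inj bij_is_surj image_f_inv_f)
  have pull: "inv_into UNIV f ` f ` alc M = alc M" using inj by (simp add: image_inv_f_f)
  have "bij_betw (\<lambda>H. f ` H) (walls \<Phi> (alc M)) (walls \<Phi> (f ` alc M))"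
  proof (rule bij_betw_imageI)
    show "inj_on (\<lambda>H. f ` H) (walls \<Phi> (alc M))"
      by (rule inj_on_image) (rule inj_on_subset[OF inj subset_UNIV])
    have "H \<in> (\<lambda>H. f ` H) ` walls \<Phi> (alc M)" if H: "H \<in> walls \<Phi> (f ` alc M)" for H
    proof -
      have "inv_into UNIV f ` H \<in> walls \<Phi> (alc M)"
        using symm_wall[OF symm_inv[OF assms(1)] symm_alcove[OF assms(1) A] H] unfolding pull .
      then show ?thesis using surj[of H] by (metis image_eqI)
    qed
    then show "(\<lambda>H. f ` H) ` walls \<Phi> (alc M) = walls \<Phi> (f ` alc M)"
      using symm_wall[OF assms(1) A] by blast
  qed
  from bij_betw_trans[OF l this]
  have "bij_betw (\<lambda>r. f ` lab M r) \<Delta> (walls \<Phi> (f ` alc M))" by (simp add: comp_def)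
  then have "bij_betw (\<lambda>r\<in>\<Delta>. f ` lab M r) \<Delta> (walls \<Phi> (f ` alc M))"
    by (rule iffD1[OF bij_betw_cong, rotated]) simp
  then show ?thesis unfolding labeled_def transport_def using symm_alcove[OF assms(1) A] by simp
qed

lemma transport_comp: "transport \<Phi> A0 f (transport \<Phi> A0 g M) = transport \<Phi> A0 (f \<circ> g) M"
  by (auto simp: transport_def image_comp fun_eq_iff restrict_def)

text \<open>The partner carries the labels composed with \<phi>, so the label of H points to
  \<phi>(H) there, and the reflection in \<phi>(H) after \<phi> is \<phi> after the reflection in H.
  The pair thus keeps the form (M', \<phi> M').\<close>

lemma level_steps_lat_conj_pair:
  assumes \<phi>: "symm \<phi>" and steps: "(level_step \<phi>)\<^sup>*\<^sup>* (alc M) B" and M: "labeled M"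
  shows "\<exists>M'. labeled M' \<and> alc M' = B \<and>
    lat_conj_pair \<Phi> A0 (M, transport \<Phi> A0 \<phi> M) (M', transport \<Phi> A0 \<phi> M')"
  using steps
proof (induction rule: rtranclp_induct)
  case base
  then show ?case using M lat_conj_pair_refl by blast
next
  case (step B C)
  then obtain M' where M': "labeled M'" "alc M' = B"
    "lat_conj_pair \<Phi> A0 (M, transport \<Phi> A0 \<phi> M) (M', transport \<Phi> A0 \<phi> M')" by blast
  obtain H where H: "H \<in> walls \<Phi> B" "C = hrefl H ` B" "alcove_dist \<Phi> C (\<phi> ` C) = alcove_dist \<Phi> B (\<phi> ` B)"
    using step.hyps(2) unfolding level_step_def by blast
  note Hh = wall_hyp[OF H(1)]
  have "H \<in> lab M' ` \<Delta>" using M'(1,2) H(1) unfolding labeled_def bij_betw_def by blast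
  then obtain s where s: "s \<in> \<Delta>" "lab M' s = H" by blast
  have m: "move \<Phi> A0 M' s = transport \<Phi> A0 (hrefl H) M'" unfolding move_def s(2) ..
  have "lab (transport \<Phi> A0 \<phi> M') s = \<phi> ` H" using s by (simp add: transport_def)
  then have m': "move \<Phi> A0 (transport \<Phi> A0 \<phi> M') s = transport \<Phi> A0 \<phi> (move \<Phi> A0 M' s)"
    unfolding m unfolding move_def transport_comp using symm_hrefl[OF \<phi> Hh] by simp
  have C: "alc (move \<Phi> A0 M' s) = C" unfolding m H(2) M'(2)[symmetric] by (simp add: transport_def)
  have al: "alc (transport \<Phi> A0 \<phi> K) = \<phi> ` alc K" for K by (simp add: transport_def)
  have "lat_conj_pair \<Phi> A0 (M, transport \<Phi> A0 \<phi> M) (move \<Phi> A0 M' s, move \<Phi> A0 (transport \<Phi> A0 \<phi> M') s)"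
    using H(3) by (intro lat_conj_pair_step[OF M'(3) s(1)]) (simp only: m' al C M'(2))
  moreover have "labeled (move \<Phi> A0 M' s)" unfolding m by (rule labeled_transport[OF hrefl_symm[OF Hh] M'(1)])
  ultimately show ?case using C unfolding m' by blast
qed

theorem NT_compatible_diamond_pair:
  assumes "marked_alcove \<Phi> A0 M" "NT_compatible \<Phi> A0 \<Omega> \<psi> M N"
  shows "diamond_pair \<Phi> A0 (M, N)"
proof -
  obtain w where w: "w \<in> carrier WT" "w \<notin> transl \<Phi> \<Omega> \<psi>" "N = transport \<Phi> A0 (act \<psi> w) M"
    using assms(2) unfolding NT_compatible_def by blast
  let ?\<phi> = "act \<psi> w"
  note \<phi> = act_symm[OF w(1)]
  have M: "labeled M" "alc M \<in> alcs" using assms(1) unfolding marked_alcove_def labeled_def by auto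
  obtain B H where B: "(level_step ?\<phi>)\<^sup>*\<^sup>* (alc M) B" and H: "H \<in> walls \<Phi> B" "?\<phi> ` H \<noteq> H"
    "\<not> separates H B (?\<phi> ` B)" "\<not> separates (?\<phi> ` H) B (?\<phi> ` B)"
    using level_steps_reach_diamond[OF w(1,2) M(2)] by blast
  obtain M' where M': "labeled M'" "alc M' = B" "lat_conj_pair \<Phi> A0 (M, N) (M', transport \<Phi> A0 ?\<phi> M')"
    using level_steps_lat_conj_pair[OF \<phi> B M(1)] unfolding w(3) by blast
  have "H \<in> lab M' ` \<Delta>" using M'(1,2) H(1) unfolding labeled_def bij_betw_def by blast
  then obtain s where s: "s \<in> \<Delta>" "lab M' s = H" by blast
  have Balc: "B \<in> alcs" "?\<phi> ` B \<in> alcs" using M' symm_alcove[OF \<phi>] unfolding labeled_def by auto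
  note Hh = wall_hyp[OF H(1)]
  have "same_side H B (?\<phi> ` B)" "same_side (?\<phi> ` H) B (?\<phi> ` B)"
    using same_side_iff[OF Balc] Hh symm_hyp[OF \<phi> Hh] H(3,4) by blast+
  moreover have N': "lab (transport \<Phi> A0 ?\<phi> M') s = ?\<phi> ` H" "alc (transport \<Phi> A0 ?\<phi> M') = ?\<phi> ` B"
    using s M'(2) by (simp_all add: transport_def)
  ultimately have "direct_diamond_pair \<Phi> A0 (M', transport \<Phi> A0 ?\<phi> M')"
    unfolding direct_diamond_pair_def case_prod_conv
    by (intro bexI[OF _ s(1)]) (simp only: N' s(2) M'(2) H(2)[symmetric] simp_thms)
  then show ?thesis unfolding diamond_pair_def using M'(3) by blast
qed

section \<open>The Diamond Property for elements\<close>

lemma lat_conj_refl: "lat_conj \<Phi> A0 \<Omega> \<psi> w w"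
  unfolding lat_conj_def by (auto intro!: exI[of _ "0::nat"] exI[of _ "\<lambda>_. w"])

lemma lat_conj_step:
  assumes "lat_conj \<Phi> A0 \<Omega> \<psi> w w'" "s \<in> \<Delta>"
    and w'': "w'' = embed \<Omega> s \<otimes>\<^bsub>WT\<^esub> w' \<otimes>\<^bsub>WT\<^esub> embed \<Omega> s" "len \<Phi> A0 w'' = len \<Phi> A0 w'"
  shows "lat_conj \<Phi> A0 \<Omega> \<psi> w w''"
proof -
  obtain n :: nat and t ws where
    t: "\<forall>i\<in>{1..n}. t i \<in> \<Delta>" "ws 0 = w"
      "\<forall>i\<in>{1..n}. ws i = embed \<Omega> (t i) \<otimes>\<^bsub>WT\<^esub> ws (i - 1) \<otimes>\<^bsub>WT\<^esub> embed \<Omega> (t i)"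
      "ws n = w'" "\<forall>i\<le>n. len \<Phi> A0 (ws i) = len \<Phi> A0 w"
    using assms(1) unfolding lat_conj_def by auto
  define t' ws' where "t' = t(Suc n := s)" and "ws' = ws(Suc n := w'')"
  have "\<forall>i\<in>{1..Suc n}. t' i \<in> \<Delta>" using t(1) assms(2) by (auto simp: t'_def)
  moreover have "ws' 0 = w" using t(2) by (simp add: ws'_def)
  moreover have "\<forall>i\<in>{1..Suc n}. ws' i = embed \<Omega> (t' i) \<otimes>\<^bsub>WT\<^esub> ws' (i - 1) \<otimes>\<^bsub>WT\<^esub> embed \<Omega> (t' i)"
  proof
    fix i assume i: "i \<in> {1..Suc n}"
    show "ws' i = embed \<Omega> (t' i) \<otimes>\<^bsub>WT\<^esub> ws' (i - 1) \<otimes>\<^bsub>WT\<^esub> embed \<Omega> (t' i)"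
    proof (cases "i = Suc n")
      case True
      then show ?thesis using t(4) w''(1) by (simp add: ws'_def t'_def)
    next
      case False
      then have "i \<in> {1..n}" "i - 1 \<noteq> Suc n" using i by auto
      then show ?thesis using t(3) False by (simp add: ws'_def t'_def)
    qed
  qed
  moreover have "ws' (Suc n) = w''" by (simp add: ws'_def)
  moreover have "\<forall>i\<le>Suc n. len \<Phi> A0 (ws' i) = len \<Phi> A0 w"
    using t(4,5) w''(2) by (auto simp: ws'_def le_Suc_eq)
  ultimately show ?thesis unfolding lat_conj_def by blast
qed

text \<open>Reads the length of a conjugate as a distance at g(A0), which is how level steps become
  length-preserving conjugations.\<close>

lemma len_conjugate:
  assumes "w \<in> carrier WT" "symm g" "g \<circ> act \<psi> w = \<phi> \<circ> g"
  shows "len \<Phi> A0 w = alcove_dist \<Phi> (g ` A0) (\<phi> ` g ` A0)"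
proof -
  have "len \<Phi> A0 w = alcove_dist \<Phi> (g ` A0) (g ` act \<psi> w ` A0)"
    unfolding len_eq[OF assms(1)] symm_dist[OF assms(2)] ..
  also have "g ` act \<psi> w ` A0 = \<phi> ` g ` A0" using assms(3) by (simp only: image_comp)
  finally show ?thesis .
qed

lemma Delta_WT: "s \<in> \<Delta> \<Longrightarrow> embed \<Omega> s \<in> carrier WT"
  using embed_WT WD_Delta unfolding Waff_eq by blast

text \<open>The crossed wall of g(A0) pulls back to a wall of A0 with reflection s, and g s(A0) is
  the next alcove; replacing g by g s replaces w' by s w' s. The invariant compares actions, since
  \<psi> may have a kernel.\<close>

lemma level_steps_lat_conj:
  assumes w: "w \<in> carrier WT" and steps: "(level_step (act \<psi> w))\<^sup>*\<^sup>* A0 B"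
  shows "\<exists>g\<in>W\<Delta>. g ` A0 = B \<and> (\<exists>w'\<in>carrier WT. g \<circ> act \<psi> w' = act \<psi> w \<circ> g \<and> lat_conj \<Phi> A0 \<Omega> \<psi> w w')"
  using steps
proof (induction rule: rtranclp_induct)
  case base
  show ?case
  proof (intro bexI[of _ id] bexI[of _ w] conjI)
    show "id ` A0 = A0" by simp
    show "id \<circ> act \<psi> w = act \<psi> w \<circ> id" by simp
  qed (rule lat_conj_refl w WD_id)+
next
  case (step B C)
  let ?\<phi> = "act \<psi> w"
  obtain g w' where g: "g \<in> W\<Delta>" "g ` A0 = B" and w': "w' \<in> carrier WT" "g \<circ> act \<psi> w' = ?\<phi> \<circ> g" "lat_conj \<Phi> A0 \<Omega> \<psi> w w'"
    using step.IH by blast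
  obtain H where H: "H \<in> walls \<Phi> B" "C = hrefl H ` B" "alcove_dist \<Phi> C (?\<phi> ` C) = alcove_dist \<Phi> B (?\<phi> ` B)"
    using step.hyps(2) unfolding level_step_def by blast
  note gs = WD_symm[OF g(1)]
  have B: "B \<in> alcs" using symm_alcove[OF gs A0] unfolding g(2) .
  let ?K = "inv_into UNIV g ` H"
  have gK: "g ` ?K = H" using symm_bij[OF gs] by (simp add: bij_is_surj image_f_inv_f)
  have pull: "inv_into UNIV g ` B = A0"
    using symm_bij[OF gs] unfolding g(2)[symmetric] by (simp add: bij_is_inj image_inv_f_f)
  have K: "?K \<in> walls \<Phi> A0" using symm_wall[OF symm_inv[OF gs] B H(1)] unfolding pull .
  define s where "s = hrefl ?K"
  have s: "s \<in> \<Delta>" unfolding Delta_aff_def s_def using K by blast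
  have gs': "hrefl H \<circ> g = g \<circ> s" using symm_hrefl[OF gs wall_hyp[OF K]] unfolding gK s_def .
  have g': "g \<circ> s \<in> W\<Delta>" "(g \<circ> s) ` A0 = C"
  proof -
    show "g \<circ> s \<in> W\<Delta>" using WD_comp[OF g(1) WD_Delta[OF s]] .
    show "(g \<circ> s) ` A0 = C" unfolding gs'[symmetric] H(2) g(2)[symmetric] by (simp only: image_comp)
  qed
  note e = Delta_WT[OF s]
  let ?w'' = "embed \<Omega> s \<otimes>\<^bsub>WT\<^esub> w' \<otimes>\<^bsub>WT\<^esub> embed \<Omega> s"
  have w'': "?w'' \<in> carrier WT" using WT_closed[OF WT_closed[OF e w'(1)] e] .
  have "act \<psi> ?w'' = s \<circ> act \<psi> w' \<circ> s"
    unfolding act_mult[OF WT_closed[OF e w'(1)] e] act_mult[OF e w'(1)] act_embed ..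
  then have "g \<circ> s \<circ> act \<psi> ?w'' = g \<circ> (s \<circ> s) \<circ> act \<psi> w' \<circ> s" by (simp only: comp_assoc)
  also have "\<dots> = ?\<phi> \<circ> (g \<circ> s)" unfolding Delta_invol[OF s] comp_id w'(2) by (simp only: comp_assoc)
  finally have conj: "g \<circ> s \<circ> act \<psi> ?w'' = ?\<phi> \<circ> (g \<circ> s)" .
  have "len \<Phi> A0 ?w'' = len \<Phi> A0 w'"
    unfolding len_conjugate[OF w'' WD_symm[OF g'(1)] conj] len_conjugate[OF w'(1) gs w'(2)] g'(2) g(2)
    by (rule H(3))
  then have "lat_conj \<Phi> A0 \<Omega> \<psi> w ?w''" using lat_conj_step[OF w'(3) s refl] by blast
  then show ?case using g' w'' conj by blast
qed

text \<open>Pulled back by g, the two non-separation conditions say that multiplying w' by s on the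
  left and on the right increases the length, and \<phi>(H) distinct from H yields that s w' s
  differs from w'.\<close>

theorem non_translation_diamond:
  assumes w: "w \<in> carrier WT" "w \<notin> transl \<Phi> \<Omega> \<psi>"
  shows "diamond \<Phi> A0 \<Omega> \<psi> w"
proof -
  let ?\<phi> = "act \<psi> w"
  obtain B H where B: "(level_step ?\<phi>)\<^sup>*\<^sup>* A0 B" and H: "H \<in> walls \<Phi> B" "?\<phi> ` H \<noteq> H"
    "\<not> separates H B (?\<phi> ` B)" "\<not> separates (?\<phi> ` H) B (?\<phi> ` B)"
    using level_steps_reach_diamond[OF w A0] by blast
  obtain g w' where g: "g \<in> W\<Delta>" "g ` A0 = B" and w': "w' \<in> carrier WT" "g \<circ> act \<psi> w' = ?\<phi> \<circ> g" "lat_conj \<Phi> A0 \<Omega> \<psi> w w'"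
    using level_steps_lat_conj[OF w(1) B] by blast
  let ?\<chi> = "act \<psi> w'"
  note gs = WD_symm[OF g(1)] and \<chi> = act_symm[OF w'(1)]
  have Balc: "B \<in> alcs" using symm_alcove[OF gs A0] unfolding g(2) .
  define K where "K = inv_into UNIV g ` H"
  have gK: "g ` K = H" unfolding K_def using symm_bij[OF gs] by (simp add: bij_is_surj image_f_inv_f)
  have pull: "inv_into UNIV g ` B = A0"
    using symm_bij[OF gs] unfolding g(2)[symmetric] by (simp add: bij_is_inj image_inv_f_f)
  have K: "K \<in> walls \<Phi> A0" using symm_wall[OF symm_inv[OF gs] Balc H(1)] unfolding pull K_def .
  note Kh = wall_hyp[OF K]
  have g\<chi>: "g ` ?\<chi> ` V = ?\<phi> ` g ` V" for V using w'(2) by (simp only: image_comp)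
  have ne: "?\<chi> ` K \<noteq> K"
  proof
    assume "?\<chi> ` K = K"
    then have "?\<phi> ` H = H" using g\<chi>[of K] unfolding gK by (simp only: gK)
    then show False using H(2) by contradiction
  qed
  have sep1: "\<not> separates K A0 (?\<chi> ` A0)"
    using H(3) symm_separates[OF gs Kh, of A0 "?\<chi> ` A0"] unfolding g\<chi> gK g(2) by blast
  \<comment> \<open>Right multiplication reflects \<chi>(A0) in its own wall \<chi>(K), hence this
    order of the two alcoves.\<close>
  have sep2: "\<not> separates (?\<chi> ` K) (?\<chi> ` A0) A0"
    using H(4) symm_separates[OF gs symm_hyp[OF \<chi> Kh], of "?\<chi> ` A0" A0] separates_sym
    unfolding g\<chi> gK g(2) by blast
  define s where "s = hrefl K"
  have s: "s \<in> \<Delta>" unfolding Delta_aff_def s_def using K by blast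
  note e = Delta_WT[OF s] and C = symm_alcove[OF \<chi> A0]
  have a1: "act \<psi> (embed \<Omega> s \<otimes>\<^bsub>WT\<^esub> w') = s \<circ> ?\<chi>" unfolding act_mult[OF e w'(1)] act_embed ..
  have a2: "act \<psi> (w' \<otimes>\<^bsub>WT\<^esub> embed \<Omega> s) = ?\<chi> \<circ> s" unfolding act_mult[OF w'(1) e] act_embed ..
  have c\<chi>: "hrefl (?\<chi> ` K) \<circ> ?\<chi> = ?\<chi> \<circ> s" unfolding s_def by (rule symm_hrefl[OF \<chi> Kh])
  have len0: "len \<Phi> A0 w' = alcove_dist \<Phi> A0 (?\<chi> ` A0)" by (rule len_eq[OF w'(1)])
  have "len \<Phi> A0 (embed \<Omega> s \<otimes>\<^bsub>WT\<^esub> w') = card (Sep A0 (s ` ?\<chi> ` A0))"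
    unfolding len_eq[OF WT_closed[OF e w'(1)]] a1 alcove_dist_eq by (simp only: image_comp)
  then have l1: "len \<Phi> A0 (embed \<Omega> s \<otimes>\<^bsub>WT\<^esub> w') > len \<Phi> A0 w'"
    using card_Sep_reflect[OF K C] sep1 unfolding len0 alcove_dist_eq s_def by simp
  have "len \<Phi> A0 (w' \<otimes>\<^bsub>WT\<^esub> embed \<Omega> s) = alcove_dist \<Phi> A0 (hrefl (?\<chi> ` K) ` ?\<chi> ` A0)"
    unfolding len_eq[OF WT_closed[OF w'(1) e]] a2 c\<chi>[symmetric] by (simp only: image_comp)
  also have "\<dots> = Suc (alcove_dist \<Phi> (?\<chi> ` A0) A0)"
    using dist_cross_Suc[OF C symm_wall[OF \<chi> A0 K] A0 sep2] dist_sym by metis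
  finally have l2: "len \<Phi> A0 (w' \<otimes>\<^bsub>WT\<^esub> embed \<Omega> s) > len \<Phi> A0 w'"
    unfolding len0 dist_sym[of A0] by simp
  have "embed \<Omega> s \<otimes>\<^bsub>WT\<^esub> w' \<otimes>\<^bsub>WT\<^esub> embed \<Omega> s \<noteq> w'"
  proof
    assume "embed \<Omega> s \<otimes>\<^bsub>WT\<^esub> w' \<otimes>\<^bsub>WT\<^esub> embed \<Omega> s = w'"
    then have "s \<circ> ?\<chi> \<circ> s = ?\<chi>"
      using act_mult[OF WT_closed[OF e w'(1)] e] unfolding a1 act_embed by simp
    then have "s \<circ> ?\<chi> \<circ> (s \<circ> s) = ?\<chi> \<circ> s" by (simp only: comp_assoc[symmetric])
    \<comment> \<open>The reflections in K and \<chi>(K) agree after \<chi>, which is onto; so they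
      are equal, and comparing fixed points gives K = \<chi>(K).\<close>
    then have "s \<circ> ?\<chi> = hrefl (?\<chi> ` K) \<circ> ?\<chi>" unfolding Delta_invol[OF s] c\<chi> comp_id .
    then have "hrefl K (?\<chi> x) = hrefl (?\<chi> ` K) (?\<chi> x)" for x unfolding s_def by (metis comp_apply)
    then have eq: "hrefl K y = hrefl (?\<chi> ` K) y" for y
      using bij_is_surj[OF symm_bij[OF \<chi>]] by (metis surjD)
    have "y \<in> K \<longleftrightarrow> y \<in> ?\<chi> ` K" for y
      using hrefl_fixed_iff[OF Kh] hrefl_fixed_iff[OF symm_hyp[OF \<chi> Kh]] eq by metis
    then show False using ne by blast
  qed
  then have "direct_diamond \<Phi> A0 \<Omega> \<psi> w'" unfolding direct_diamond_def using s l1 l2 by blast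
  then show ?thesis unfolding diamond_def using w'(1,3) by blast
qed

end

theorem mainTheorem3:
  fixes \<Phi> :: "'a::euclidean_space set"
    and v0 :: 'a and C0 A0 :: "'a set"
    and \<Omega> :: "('o, 'm) monoid_scheme"
    and \<psi> :: "'o \<Rightarrow> 'a \<Rightarrow> 'a"
  assumes "quasi_coxeter \<Phi> v0 C0 A0 \<Omega> \<psi>"
  shows "(\<forall>M N. marked_alcove \<Phi> A0 M \<and> marked_alcove \<Phi> A0 N \<and> NT_compatible \<Phi> A0 \<Omega> \<psi> M N \<longrightarrow>
            diamond_pair \<Phi> A0 (M, N)) \<and>
         (\<forall>w\<in>carrier (Wtilde \<Phi> \<Omega> \<psi>). w \<notin> transl \<Phi> \<Omega> \<psi> \<longrightarrow> diamond \<Phi> A0 \<Omega> \<psi> w)"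
  using quasi_coxeter.NT_compatible_diamond_pair[OF assms]
    quasi_coxeter.non_translation_diamond[OF assms] by blast

end
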